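(* Let $0<\alpha<1$, $T>0$, and for $u_0\in H$ consider $$\mathrm{i}^\alpha\partial_t^\alpha u(t)+Au(t)=0,\quad t\in(0,T),\qquad u(0)=u_0. \tag{P}$$ Then: (i) for any $u_T\in H_1$, there exists a weak solution $u\in C([0,T];H)$ to (P) (for some initial datum $u_0\in H$) such that $u(T)=u_T$; (ii) there exists a constant $C>0$ such that for any weak solution $u$ to (P) (with any $u_0\in H$), $$\|u(0)\|\le C\|u(T)\|_1,$$ where $\|u(T)\|_1=+\infty$ if $u(T)\notin H_1$.
   Context: $(H,\langle\cdot,\cdot\rangle)$ is a complex Hilbert space with norm $\|\cdot\|$; $A:D(A)\subset H\to H$ is a negative-definite self-adjoint operator with compact resolvent. The eigenvalues of $-A$ are $0<\lambda_1\le\lambda_2\le\cdots\to\infty$, with a corresponding orthonormal (Hilbert) basis of eigenvectors $\{\varphi_n\}_{n\ge1}\subset D(A)$. For $s\ge0$, $H_s=\{u\in H:\sum_n\lambda_n^{2s}|\langle u,\varphi_n\rangle|^2<\infty\}$ with $\|u\|_s^2=\sum_n\lambda_n^{2s}|\langle u,\varphi_n\rangle|^2$; $H_{-s}=H_s'$ is its dual (identifying $H=H'$) with norm $\|u\|_{-s}^2=\sum_n\lambda_n^{-2s}|\langle u,\varphi_n\rangle_{-s,s}|^2$. Powers: $\mathrm{i}^{\alpha}=e^{\mathrm{i}\pi\alpha/2}$, $\mathrm{i}^{-\alpha}=e^{-\mathrm{i}\pi\alpha/2}$. Caputo derivative for $0<\alpha<1$: $\partial_t^\alpha u(t)=\frac{1}{\Gamma(1-\alpha)}\int_0^t(t-s)^{-\alpha}\partial_su(s)\,\mathrm{d}s$,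 understood coefficientwise for $u(t)=\sum_nu_n(t)\varphi_n$ with $u_n$ absolutely continuous on $[0,T]$. Weak solution of (P) for $u_0\in H$: a function $u$ such that (1) $u\in C([0,T];H)$; (2) $\partial_t^\alpha u(t),Au(t)\in H_{-1/\alpha}$ for almost all $t\in(0,T)$ and the equation holds in $H_{-1/\alpha}$ for almost all $t$; (3) $\lim_{t\to0^+}\|u(t)-u_0\|=0$. For each $u_0\in H$ there is exactly one weak solution, given by $u(t)=\sum_n\langle u_0,\varphi_n\rangle E_{\alpha,1}(\mathrm{i}^{-\alpha}\lambda_nt^\alpha)\varphi_n$, where $E_{\alpha,\beta}(z)=\sum_{k\ge0}z^k/\Gamma(\alpha k+\beta)$ is the Mittag-Leffler function. *)

theory Defs
  imports "HOL-Analysis.Analysis"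
begin

section \<open>Complex Hilbert spaces\<close>

text \<open>The inner product is linear in its first and antilinear in its second argument, so that
  the Fourier coefficients of \<open>u\<close> with respect to an orthonormal basis are \<open>cinner u (\<phi> n)\<close>.\<close>

class complex_inner = real_normed_vector +
  fixes scaleC :: "complex \<Rightarrow> 'a \<Rightarrow> 'a" (infixr \<open>*\<^sub>C\<close> 75)
    and cinner :: "'a \<Rightarrow> 'a \<Rightarrow> complex"
  assumes scaleC_add_right: "c *\<^sub>C (x + y) = c *\<^sub>C x + c *\<^sub>C y"
    and scaleC_add_left: "(c + d) *\<^sub>C x = c *\<^sub>C x + d *\<^sub>C x"
    and scaleC_scaleC: "c *\<^sub>C d *\<^sub>C x = (c * d) *\<^sub>C x"
    and scaleR_scaleC: "scaleR r x = complex_of_real r *\<^sub>C x"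
    and cinner_commute: "cinner x y = cnj (cinner y x)"
    and cinner_add_left: "cinner (x + y) z = cinner x z + cinner y z"
    and cinner_scaleC_left: "cinner (c *\<^sub>C x) y = c * cinner x y"
    and norm_eq_sqrt_cinner: "norm x = sqrt (Re (cinner x x))"

class complex_hilbert = complex_inner + complete_space

global_interpretation complex_vector: vector_space "scaleC :: complex \<Rightarrow> 'a \<Rightarrow> 'a::complex_inner"
proof
  fix c d :: complex and x y :: 'a
  show "c *\<^sub>C (x + y) = c *\<^sub>C x + c *\<^sub>C y" by (rule scaleC_add_right)
  show "(c + d) *\<^sub>C x = c *\<^sub>C x + d *\<^sub>C x" by (rule scaleC_add_left)
  show "c *\<^sub>C d *\<^sub>C x = (c * d) *\<^sub>C x" by (rule scaleC_scaleC)
  show "1 *\<^sub>C x = x" using scaleR_scaleC[of 1 x] by simp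
qed

section \<open>The operator and its eigenbasis\<close>

text \<open>An unbounded operator is a pair of a domain \<open>D\<close> and a function \<open>A\<close> of which only the
  values on \<open>D\<close> matter.\<close>

definition linear_operator_on :: "'a::complex_inner set \<Rightarrow> ('a \<Rightarrow> 'a) \<Rightarrow> bool" where
  "linear_operator_on D A \<longleftrightarrow> complex_vector.subspace D \<and>
     (\<forall>u\<in>D. \<forall>v\<in>D. A (u + v) = A u + A v) \<and> (\<forall>c. \<forall>u\<in>D. A (c *\<^sub>C u) = c *\<^sub>C A u)"

text \<open>The last conjunct says that the graph of the adjoint equals the graph of \<open>A\<close>; in
  particular the domains agree.\<close>

definition selfadjoint_operator :: "'a::complex_inner set \<Rightarrow> ('a \<Rightarrow> 'a) \<Rightarrow> bool" where
  "selfadjoint_operator D A \<longleftrightarrow> linear_operator_on D A \<and> closure D = UNIV \<and>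
     (\<forall>v w. (\<forall>u\<in>D. cinner (A u) v = cinner u w) \<longleftrightarrow> (v \<in> D \<and> A v = w))"

text \<open>For a self-adjoint operator \<open>cinner (A u) u\<close> is real.\<close>

definition negative_definite_operator :: "'a::complex_inner set \<Rightarrow> ('a \<Rightarrow> 'a) \<Rightarrow> bool" where
  "negative_definite_operator D A \<longleftrightarrow> (\<forall>u\<in>D. u \<noteq> 0 \<longrightarrow> Re (cinner (A u) u) < 0)"

text \<open>\<open>R\<close> is the inverse of \<open>A - z\<close>. By the resolvent identity, compactness of the
  resolvent at one point of the resolvent set is the same as compactness at all of them.\<close>

definition compact_resolvent :: "'a::complex_inner set \<Rightarrow> ('a \<Rightarrow> 'a) \<Rightarrow> bool" where
  "compact_resolvent D A \<longleftrightarrow> (\<exists>z R.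
     (\<forall>v. R v \<in> D \<and> A (R v) - z *\<^sub>C R v = v) \<and> (\<forall>u\<in>D. R (A u - z *\<^sub>C u) = u) \<and>
     (\<forall>S. bounded S \<longrightarrow> compact (closure (R ` S))))"

definition orthonormal_basis :: "(nat \<Rightarrow> 'a::complex_inner) \<Rightarrow> bool" where
  "orthonormal_basis \<phi> \<longleftrightarrow> (\<forall>m n. cinner (\<phi> m) (\<phi> n) = (if m = n then 1 else 0)) \<and>
     closure (complex_vector.span (range \<phi>)) = UNIV"

text \<open>Since the eigenvectors form a basis, \<open>\<mu>\<close> lists all eigenvalues of \<open>-A\<close>, with
  multiplicity. Indices start at 0.\<close>

definition eigenbasis ::
  "'a::complex_inner set \<Rightarrow> ('a \<Rightarrow> 'a) \<Rightarrow> (nat \<Rightarrow> real) \<Rightarrow> (nat \<Rightarrow> 'a) \<Rightarrow> bool" where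
  "eigenbasis D A \<mu> \<phi> \<longleftrightarrow> 0 < \<mu> 0 \<and> mono \<mu> \<and> filterlim \<mu> at_top sequentially \<and>
     orthonormal_basis \<phi> \<and> (\<forall>n. \<phi> n \<in> D \<and> - A (\<phi> n) = \<mu> n *\<^sub>R \<phi> n)"

section \<open>The scale of spaces\<close>

definition H_sp :: "(nat \<Rightarrow> real) \<Rightarrow> (nat \<Rightarrow> 'a::complex_inner) \<Rightarrow> real \<Rightarrow> 'a set" where
  "H_sp \<mu> \<phi> s = {u. summable (\<lambda>n. \<mu> n powr (2 * s) * (cmod (cinner u (\<phi> n)))\<^sup>2)}"

definition H_norm :: "(nat \<Rightarrow> real) \<Rightarrow> (nat \<Rightarrow> 'a::complex_inner) \<Rightarrow> real \<Rightarrow> 'a \<Rightarrow> real" where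
  "H_norm \<mu> \<phi> s u = sqrt (\<Sum>n. \<mu> n powr (2 * s) * (cmod (cinner u (\<phi> n)))\<^sup>2)"

definition H_enorm :: "(nat \<Rightarrow> real) \<Rightarrow> (nat \<Rightarrow> 'a::complex_inner) \<Rightarrow> real \<Rightarrow> 'a \<Rightarrow> ennreal" where
  "H_enorm \<mu> \<phi> s u = (if u \<in> H_sp \<mu> \<phi> s then ennreal (H_norm \<mu> \<phi> s u) else \<infinity>)"

text \<open>The dual of \<open>H_sp \<mu> \<phi> s\<close> as the set of its bounded antilinear functionals, extended by 0
  outside so that equality of functions is equality of functionals. The duality pairing of \<open>f\<close>
  and \<open>v\<close> is \<open>f v\<close>; antilinearity makes the identification \<open>w \<mapsto> cinner w\<close> of \<open>H\<close> with its dual,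
  and hence the inclusion of \<open>H\<close> in the dual of \<open>H_sp \<mu> \<phi> s\<close>, complex linear.\<close>

definition H_dual :: "(nat \<Rightarrow> real) \<Rightarrow> (nat \<Rightarrow> 'a::complex_inner) \<Rightarrow> real \<Rightarrow> ('a \<Rightarrow> complex) set" where
  "H_dual \<mu> \<phi> s = {f.
     (\<forall>v\<in>H_sp \<mu> \<phi> s. \<forall>w\<in>H_sp \<mu> \<phi> s. f (v + w) = f v + f w) \<and>
     (\<forall>c. \<forall>v\<in>H_sp \<mu> \<phi> s. f (c *\<^sub>C v) = cnj c * f v) \<and>
     (\<exists>C. \<forall>v\<in>H_sp \<mu> \<phi> s. cmod (f v) \<le> C * H_norm \<mu> \<phi> s v) \<and>
     (\<forall>v. v \<notin> H_sp \<mu> \<phi> s \<longrightarrow> f v = 0)}"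

text \<open>The extension by duality of \<open>A\<close> to all of \<open>H\<close>, with values in the dual of \<open>H_sp \<mu> \<phi> s\<close>, for
  \<open>s \<ge> 1\<close>; then \<open>H_sp \<mu> \<phi> s \<subseteq> H_sp \<mu> \<phi> 1 = D\<close>, so \<open>A v\<close> makes sense. For \<open>u \<in> D\<close> the result is the
  functional identified with the vector \<open>A u\<close>.\<close>

definition A_dual ::
  "(nat \<Rightarrow> real) \<Rightarrow> (nat \<Rightarrow> 'a::complex_inner) \<Rightarrow> real \<Rightarrow> ('a \<Rightarrow> 'a) \<Rightarrow> 'a \<Rightarrow> 'a \<Rightarrow> complex" where
  "A_dual \<mu> \<phi> s A u = (\<lambda>v. if v \<in> H_sp \<mu> \<phi> s then cinner u (A v) else 0)"

section \<open>The Caputo derivative\<close>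

definition absolutely_continuous_on :: "real \<Rightarrow> real \<Rightarrow> (real \<Rightarrow> complex) \<Rightarrow> bool" where
  "absolutely_continuous_on a b g \<longleftrightarrow> (\<forall>\<epsilon>>0. \<exists>\<delta>>0. \<forall>(m::nat) x y.
     (\<forall>i<m. a \<le> x i \<and> x i \<le> y i \<and> y i \<le> b) \<and>
     (\<forall>i<m. \<forall>j<m. i \<noteq> j \<longrightarrow> {x i<..<y i} \<inter> {x j<..<y j} = {}) \<and>
     (\<Sum>i<m. y i - x i) < \<delta> \<longrightarrow> (\<Sum>i<m. cmod (g (y i) - g (x i))) < \<epsilon>)"

text \<open>\<open>h\<close> is the almost everywhere derivative of \<open>g\<close>, which exists if \<open>g\<close> is absolutely
  continuous; the integral in the definition then exists for almost every \<open>t\<close> and does not depend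
  on the choice of \<open>h\<close>.\<close>

definition has_caputo_derivative ::
  "(real \<Rightarrow> complex) \<Rightarrow> real \<Rightarrow> complex \<Rightarrow> real \<Rightarrow> bool" where
  "has_caputo_derivative g \<alpha> d t \<longleftrightarrow> (\<exists>h.
     (AE s in lebesgue. 0 < s \<and> s < t \<longrightarrow> (g has_vector_derivative h s) (at s)) \<and>
     set_integrable lebesgue {0..t} (\<lambda>s. (t - s) powr (- \<alpha>) *\<^sub>R h s) \<and>
     d = (1 / Gamma (1 - \<alpha>)) *\<^sub>R (LINT s:{0..t}|lebesgue. (t - s) powr (- \<alpha>) *\<^sub>R h s))"

text \<open>The functional \<open>f\<close> is the coefficientwise Caputo derivative of \<open>u\<close> at \<open>t\<close>.\<close>

definition has_caputo_derivative_dual ::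
  "(nat \<Rightarrow> real) \<Rightarrow> (nat \<Rightarrow> 'a::complex_inner) \<Rightarrow> real \<Rightarrow> (real \<Rightarrow> 'a) \<Rightarrow> real \<Rightarrow>
    ('a \<Rightarrow> complex) \<Rightarrow> real \<Rightarrow> bool" where
  "has_caputo_derivative_dual \<mu> \<phi> s u \<alpha> f t \<longleftrightarrow> f \<in> H_dual \<mu> \<phi> s \<and>
     (\<forall>n. has_caputo_derivative (\<lambda>\<tau>. cinner (u \<tau>) (\<phi> n)) \<alpha> (f (\<phi> n)) t)"

section \<open>Weak solutions\<close>

text \<open>Weak solutions on \<open>[0, T]\<close> of \<open>\<i>\<^sup>\<alpha> \<partial>\<^sub>t\<^sup>\<alpha> u + A u = 0\<close>, \<open>u 0 = u\<^sub>0\<close>; the complex power is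
  \<open>exp (\<i> \<pi> \<alpha> / 2)\<close>.\<close>

definition weak_solution ::
  "('a::complex_inner \<Rightarrow> 'a) \<Rightarrow> (nat \<Rightarrow> real) \<Rightarrow> (nat \<Rightarrow> 'a) \<Rightarrow> real \<Rightarrow> real \<Rightarrow> 'a \<Rightarrow> (real \<Rightarrow> 'a) \<Rightarrow> bool"
  where
  "weak_solution A \<mu> \<phi> \<alpha> T u\<^sub>0 u \<longleftrightarrow>
     continuous_on {0..T} u \<and>
     (\<forall>n. absolutely_continuous_on 0 T (\<lambda>t. cinner (u t) (\<phi> n))) \<and>
     (AE t in lebesgue. 0 < t \<and> t < T \<longrightarrow>
        (\<exists>f. has_caputo_derivative_dual \<mu> \<phi> (1 / \<alpha>) u \<alpha> f t \<and>
             A_dual \<mu> \<phi> (1 / \<alpha>) A (u t) \<in> H_dual \<mu> \<phi> (1 / \<alpha>) \<and>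
             (\<forall>v\<in>H_sp \<mu> \<phi> (1 / \<alpha>).
                exp (\<i> * of_real (pi * \<alpha> / 2)) * f v + A_dual \<mu> \<phi> (1 / \<alpha>) A (u t) v = 0))) \<and>
     ((\<lambda>t. norm (u t - u\<^sub>0)) \<longlongrightarrow> 0) (at_right 0)"

end

theory Submission
  imports Defs "HOL-Complex_Analysis.Complex_Analysis"
begin

text \<open>The \<open>n\<close>-th Fourier coefficient of a weak solution is \<open>u\<^sub>n(0) E\<^sub>\<alpha>(\<i>\<^bsup>-\<alpha>\<^esup> \<mu>\<^sub>n t\<^sup>\<alpha>)\<close>. Writing the
  Mittag-Leffler series as a Hankel contour integral and collapsing the contour onto the cut gives,
  for \<open>Re w > 0\<close>, the representation \<open>E\<^sub>\<alpha>(w\<^sup>\<alpha>) = e\<^sup>w / \<alpha> - \<integral> exp(- w e\<^sup>x) k(x) dx\<close> with a density \<open>k \<ge> 0\<close>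
  of total mass \<open>1/\<alpha> - 1\<close>. The argument \<open>\<i>\<^bsup>-\<alpha>\<^esup> \<mu>\<^sub>n t\<^sup>\<alpha>\<close> corresponds to an imaginary \<open>w\<close>, where
  \<open>|e\<^sup>w| = 1\<close>; hence the modulus of the multiplier lies between \<open>1/\<alpha> - (1/\<alpha> - 1) = 1\<close> and
  \<open>2/\<alpha> - 1\<close>, uniformly in \<open>n\<close> and \<open>t\<close>. So \<open>u(0)\<close> is recovered from \<open>u(T)\<close> by division, without increasing
  the norm.\<close>

section \<open>The Mittag-Leffler function and its Caputo derivative\<close>

text \<open>The numbers \<open>1/\<alpha>\<close> and \<open>1/\<alpha> - 1\<close> are linked: the
  first is the residue at s = 1 of s^(\<alpha>-1)/(s^\<alpha>-1), the Laplace transform of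
  E_\<alpha>(t^\<alpha>), and the second is what remains once the value E_\<alpha>(0) = 1 is
  accounted for. Two obstacles shape the proof. The contour computation is carried out for real t >
  0, where everything converges absolutely, while the points of interest are imaginary. The identity
  theorem carries the representation to the right half-plane; the bounds involve only the mass of
  the density, so they survive the passage to the boundary. Also, a weak solution satisfies its
  scalar equations only at almost every time and with an unspecified almost everywhere derivative.
  The coefficient formula thus needs a uniqueness theorem, which rests on Abel inversion and on
  recovering an absolutely continuous function from its derivative. The k-th iterate of the
  resulting Volterra inequality is a multiple of the k-th term of a convergent Mittag-Leffler
  series. The upper bound on the multipliers serves existence: it yields continuity in H.\<close>

definition mittag_leffler :: "real \<Rightarrow> complex \<Rightarrow> complex" where
  "mittag_leffler \<alpha> z = (\<Sum>k. z ^ k / of_real (Gamma (\<alpha> * real k + 1)))"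

text \<open>The two-parameter function E_{\<alpha>,\<alpha>}, which is \<alpha> times the derivative
  of E_\<alpha>.\<close>

definition mittag_leffler_diag :: "real \<Rightarrow> complex \<Rightarrow> complex" where
  "mittag_leffler_diag \<alpha> z = (\<Sum>k. z ^ k / of_real (Gamma (\<alpha> * real k + \<alpha>)))"

text \<open>The logarithm of Gamma is convex, and x + 1 is the convex combination of x + a and x + 1
  + a with weights a and 1 - a.\<close>

lemma Gamma_add_bound:
  fixes x a :: real
  assumes "0 < a" "a < 1" "0 < x"
  shows "Gamma (x + 1) \<le> Gamma (x + 1 + a) * (x + a) powr (- a)"
proof -
  have "(ln \<circ> Gamma) ((1 - (1 - a)) *\<^sub>R (x + a) + (1 - a) *\<^sub>R (x + 1 + a))
      \<le> (1 - (1 - a)) * (ln \<circ> Gamma) (x + a) + (1 - a) * (ln \<circ> Gamma) (x + 1 + a)"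
    using assms by (intro convex_onD[OF log_convex_Gamma_real]) auto
  moreover have "(1 - (1 - a)) *\<^sub>R (x + a) + (1 - a) *\<^sub>R (x + 1 + a) = x + 1"
    by (simp add: algebra_simps)
  ultimately have "ln (Gamma (x + 1)) \<le> a * ln (Gamma (x + a)) + (1 - a) * ln (Gamma (x + 1 + a))"
    by simp
  moreover have "Gamma (x + a + 1) = (x + a) * Gamma (x + a)"
    using assms nonpos_Ints_nonpos[of "x + a"] by (intro Gamma_plus1) linarith
  then have "Gamma (x + 1 + a) = (x + a) * Gamma (x + a)"
    by (simp only: add_ac)
  then have "ln (Gamma (x + 1 + a)) = ln (x + a) + ln (Gamma (x + a))"
    using assms Gamma_real_pos[of "x + a", THEN less_imp_neq] by (simp add: ln_mult)
  ultimately have "ln (Gamma (x + 1)) \<le> ln (Gamma (x + 1 + a)) + (- a) * ln (x + a)"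
    by (simp add: algebra_simps)
  also have "\<dots> = ln (Gamma (x + 1 + a) * (x + a) powr (- a))"
    using assms Gamma_real_pos[of "x + 1 + a", THEN less_imp_neq] by (simp add: ln_mult ln_powr)
  finally show ?thesis
    using assms by simp
qed

text \<open>By \<open>Gamma_add_bound\<close> the ratio of consecutive terms is at most r (\<alpha>k
  + \<alpha>)^(-\<alpha>), which tends to 0. The same terms return in the uniqueness proof as bounds
  of a Volterra iteration.\<close>

lemma summable_mittag_leffler_real:
  fixes r :: real
  assumes "0 < \<alpha>" "\<alpha> < 1" "0 \<le> r"
  shows "summable (\<lambda>k. r ^ k / Gamma (\<alpha> * real k + 1))"
proof -
  have "(\<lambda>k. r * (\<alpha> * real k + \<alpha>) powr (- \<alpha>)) \<longlonglongrightarrow> 0"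
    using assms by real_asymp
  then have "\<forall>\<^sub>F k in sequentially. r * (\<alpha> * real k + \<alpha>) powr (- \<alpha>) < 1/2"
    by (rule order_tendstoD) simp
  then obtain N where N: "\<And>k. k \<ge> N \<Longrightarrow> r * (\<alpha> * real k + \<alpha>) powr (- \<alpha>) < 1/2"
    by (auto simp: eventually_sequentially)
  show ?thesis
  \<comment> \<open>Index 0 is excluded because \<open>Gamma_add_bound\<close> needs x > 0.\<close>
  proof (rule summable_ratio_test[of "1/2" "max N 1"])
    fix k assume k: "max N 1 \<le> k"
    define x where "x = \<alpha> * real k"
    have x: "0 < x" using k assms by (simp add: x_def)
    have G: "0 < Gamma (x + 1)" "0 < Gamma (x + 1 + \<alpha>)" using x assms by auto
    have "r * Gamma (x + 1) \<le> r * (Gamma (x + 1 + \<alpha>) * (x + \<alpha>) powr (- \<alpha>))"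
      using assms Gamma_add_bound[of \<alpha> x] x by (intro mult_left_mono) auto
    also have "\<dots> = (r * (x + \<alpha>) powr (- \<alpha>)) * Gamma (x + 1 + \<alpha>)" by simp
    also have "\<dots> \<le> 1/2 * Gamma (x + 1 + \<alpha>)"
      using N[of k] k G by (intro mult_right_mono) (auto simp: x_def)
    finally have "r / Gamma (x + 1 + \<alpha>) \<le> 1/2 * (1 / Gamma (x + 1))"
      using G by (simp add: field_simps)
    then have "r ^ k * (r / Gamma (x + 1 + \<alpha>)) \<le> r ^ k * (1/2 * (1 / Gamma (x + 1)))"
      using assms by (intro mult_left_mono) auto
    moreover have "\<alpha> * real (Suc k) + 1 = x + 1 + \<alpha>" by (simp add: x_def algebra_simps)
    ultimately show "norm (r ^ Suc k / Gamma (\<alpha> * real (Suc k) + 1))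
        \<le> 1/2 * norm (r ^ k / Gamma (\<alpha> * real k + 1))"
      using G assms by (simp add: x_def[symmetric] mult_ac abs_of_pos add_ac)
  qed auto
qed

lemma summable_norm_mittag_leffler:
  assumes "0 < \<alpha>" "\<alpha> < 1"
  shows "summable (\<lambda>k. norm (z ^ k / of_real (Gamma (\<alpha> * real k + 1)) :: complex))"
proof -
  have "0 < Gamma (\<alpha> * real k + 1)" for k using assms by (intro Gamma_real_pos add_nonneg_pos) auto
  then have "norm (z ^ k / of_real (Gamma (\<alpha> * real k + 1)) :: complex)
      = cmod z ^ k / Gamma (\<alpha> * real k + 1)" for k
    by (simp add: norm_divide norm_power abs_of_pos)
  then show ?thesis using summable_mittag_leffler_real[OF assms, of "cmod z"] by simp
qed

lemma mittag_leffler_0 [simp]: "mittag_leffler \<alpha> 0 = 1"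
  unfolding mittag_leffler_def using powser_zero[of "\<lambda>k. 1 / of_real (Gamma (\<alpha> * real k + 1)) :: complex"]
  by (simp add: field_simps)

lemma mittag_leffler_sums:
  assumes "0 < \<alpha>" "\<alpha> < 1"
  shows "(\<lambda>k. z ^ k / of_real (Gamma (\<alpha> * real k + 1))) sums mittag_leffler \<alpha> z"
  unfolding mittag_leffler_def
  by (intro summable_sums summable_norm_cancel[OF summable_norm_mittag_leffler[OF assms]])

lemma Gamma_mult_Suc:
  assumes "0 < \<alpha>"
  shows "Gamma (\<alpha> * real (Suc k) + 1) = \<alpha> * real (Suc k) * Gamma (\<alpha> * real k + \<alpha>)"
proof -
  have "\<alpha> * real (Suc k) \<notin> \<int>\<^sub>\<le>\<^sub>0"
    using assms nonpos_Ints_nonpos[of "\<alpha> * real (Suc k)"] mult_pos_pos[of \<alpha> "real (Suc k)"]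
    by linarith
  then have "Gamma (\<alpha> * real (Suc k) + 1) = \<alpha> * real (Suc k) * Gamma (\<alpha> * real (Suc k))"
    by (rule Gamma_plus1)
  then show ?thesis by (simp add: algebra_simps)
qed

text \<open>The factor k + 1 from termwise differentiation cancels against Gamma(\<alpha>(k+1) + 1)
  = \<alpha>(k+1) Gamma(\<alpha>k + \<alpha>) and leaves 1/\<alpha>. Convergence of the
  E_{\<alpha>,\<alpha>} series is a by-product of differentiating an entire power series.\<close>

lemma mittag_leffler_has_field_derivative:
  assumes "0 < \<alpha>" "\<alpha> < 1"
  shows "(mittag_leffler \<alpha> has_field_derivative mittag_leffler_diag \<alpha> z / of_real \<alpha>) (at z)"
    and "summable (\<lambda>k. norm (z ^ k / of_real (Gamma (\<alpha> * real k + \<alpha>)) :: complex))"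
proof -
  define c where "c k = (1 / of_real (Gamma (\<alpha> * real k + 1)) :: complex)" for k
  have c: "summable (\<lambda>k. c k * w ^ k)" for w
    using sums_summable[OF mittag_leffler_sums[OF assms, of w]] by (simp add: c_def)
  have d: "diffs c k = 1 / of_real (Gamma (\<alpha> * real k + \<alpha>)) / of_real \<alpha>" for k
  proof -
    have "diffs c k = of_nat (Suc k) / of_real (Gamma (\<alpha> * real (Suc k) + 1))"
      by (simp add: diffs_def c_def)
    also have "\<dots> = 1 / of_real (Gamma (\<alpha> * real k + \<alpha>)) / of_real \<alpha>"
      using assms unfolding Gamma_mult_Suc[OF assms(1)]
      by (simp add: field_simps del: of_nat_Suc)
    finally show ?thesis .
  qed
  have sm: "summable (\<lambda>k. norm (diffs c k * w ^ k))" for w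
  proof (rule powser_insidea)
    show "summable (\<lambda>k. diffs c k * of_real (cmod w + 1) ^ k)"
      by (rule termdiff_converges_all) (rule c)
    have "norm w < \<bar>cmod w + 1\<bar>" by simp
    then show "norm w < norm (of_real (cmod w + 1) :: complex)" by (simp only: norm_of_real)
  qed
  have s2: "summable (\<lambda>k. w ^ k / of_real (Gamma (\<alpha> * real k + \<alpha>)) :: complex)" for w
    using summable_mult[OF summable_norm_cancel[OF sm[of w]], of "of_real \<alpha>"] assms
    by (simp add: d)
  have "(\<Sum>k. diffs c k * z ^ k) = mittag_leffler_diag \<alpha> z / of_real \<alpha>"
    using suminf_divide[OF s2, of z "of_real \<alpha>"] by (simp add: d mittag_leffler_diag_def)
  moreover have "((\<lambda>z. \<Sum>k. c k * z ^ k) has_field_derivative (\<Sum>k. diffs c k * z ^ k)) (at z)"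
    by (rule termdiffs_strong_converges_everywhere) (rule c)
  moreover have "(\<lambda>z. \<Sum>k. c k * z ^ k) = mittag_leffler \<alpha>"
    by (simp add: fun_eq_iff mittag_leffler_def c_def)
  ultimately show "(mittag_leffler \<alpha> has_field_derivative mittag_leffler_diag \<alpha> z / of_real \<alpha>) (at z)"
    by simp
  show "summable (\<lambda>k. norm (z ^ k / of_real (Gamma (\<alpha> * real k + \<alpha>)) :: complex))"
    using summable_mult[OF sm[of z], of "\<alpha>"] assms
    by (simp add: d norm_divide norm_mult)
qed

lemma holomorphic_mittag_leffler:
  assumes "0 < \<alpha>" "\<alpha> < 1"
  shows "mittag_leffler \<alpha> holomorphic_on S"
  by (meson assms field_differentiable_at_within field_differentiable_def holomorphic_on_def
      mittag_leffler_has_field_derivative(1))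

lemma continuous_mittag_leffler:
  assumes "0 < \<alpha>" "\<alpha> < 1"
  shows "continuous_on S (mittag_leffler \<alpha>)"
  using holomorphic_mittag_leffler[OF assms] by (rule holomorphic_on_imp_continuous_on)

section \<open>The Beta integral and termwise fractional differentiation\<close>

text \<open>Rescaling [0, t] to [0, 1] gives the Beta function. This one integral drives the Caputo
  derivative of a power, Abel's kernel and the Volterra iteration.\<close>

lemma has_bochner_integral_Beta:
  fixes a b t :: real
  assumes "0 < a" "0 < b" "0 < t"
  shows "has_bochner_integral lborel
    (\<lambda>s. indicator {0..t} s * ((t - s) powr (a - 1) * s powr (b - 1)))
    (Gamma a * Gamma b / Gamma (a + b) * t powr (a + b - 1))"
proof -
  let ?f = "\<lambda>s::real. indicator {0..1} s * (s powr (b - 1) * (1 - s) powr (a - 1))"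
  have "has_bochner_integral lborel ?f (Beta b a)"
  proof -
    have i: "integrable lborel ?f"
      using integrable_Beta[OF assms(2,1)] by (simp add: set_integrable_def)
    have "integral\<^sup>L lborel ?f = Beta b a"
      using set_borel_integral_eq_integral(2)[OF integrable_Beta[OF assms(2,1)]]
        integral_unique[OF has_integral_Beta_real[OF assms(2,1)]]
      by (simp add: set_lebesgue_integral_def)
    with i show ?thesis by (simp add: has_bochner_integral_iff)
  qed
  then have "has_bochner_integral lborel (\<lambda>s. ?f (0 + (1/t) * s)) (Beta b a /\<^sub>R \<bar>1/t\<bar>)"
    using assms by (subst lborel_has_bochner_integral_real_affine_iff[symmetric]) auto
  \<comment> \<open>The powers of s/t and 1 - s/t carry a factor t^(2-a-b), removed here; the
    Jacobian supplies one more t.\<close>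
  then have "has_bochner_integral lborel (\<lambda>s. t powr (a + b - 2) * ?f (0 + (1/t) * s))
     (t powr (a + b - 2) * (Beta b a /\<^sub>R \<bar>1/t\<bar>))"
    by (intro has_bochner_integral_mult_right)
  moreover have "t powr (a + b - 2) * ?f (0 + (1/t) * s)
     = indicator {0..t} s * ((t - s) powr (a - 1) * s powr (b - 1))" for s
  proof (cases "s \<in> {0..t}")
    case True
    then have "(1 - s / t) powr (a - 1) = (t - s) powr (a - 1) / t powr (a - 1)"
      using assms by (simp add: powr_divide[symmetric] diff_divide_distrib)
    moreover have "(s / t) powr (b - 1) = s powr (b - 1) / t powr (b - 1)"
      using True assms by (simp add: powr_divide)
    moreover have "t powr (a + b - 2) = t powr (a - 1) * t powr (b - 1)"
      using assms by (simp add: powr_add[symmetric])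
    ultimately show ?thesis using True assms by (simp add: mult_ac)
  next
    case False
    then show ?thesis using assms by (auto simp: indicator_def field_simps)
  qed
  moreover have "t powr (a + b - 2) * (Beta b a /\<^sub>R \<bar>1/t\<bar>)
     = Gamma a * Gamma b / Gamma (a + b) * t powr (a + b - 1)"
  proof -
    have "t powr (a + b - 1) = t powr (a + b - 2) * t"
      using assms powr_add[of t "a + b - 2" 1] by (simp add: algebra_simps)
    then show ?thesis
      using assms by (simp add: Beta_def add.commute mult_ac)
  qed
  ultimately show ?thesis by simp
qed

text \<open>Differentiating the series termwise and integrating it against the kernel with the Beta
  integral shifts the index by one.\<close>

lemma has_caputo_derivative_mittag_leffler:
  fixes b :: complex
  assumes \<alpha>: "0 < \<alpha>" "\<alpha> < 1" and t: "0 < t"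
  shows "has_caputo_derivative (\<lambda>s. mittag_leffler \<alpha> (b * of_real (s powr \<alpha>))) \<alpha>
           (b * mittag_leffler \<alpha> (b * of_real (t powr \<alpha>))) t"
proof -
  define h where "h s = b * of_real (s powr (\<alpha> - 1)) * mittag_leffler_diag \<alpha> (b * of_real (s powr \<alpha>))" for s
  have der: "((\<lambda>s. mittag_leffler \<alpha> (b * of_real (s powr \<alpha>))) has_vector_derivative h s) (at s)"
    if "0 < s" for s
  proof -
    have "((\<lambda>s. s powr \<alpha>) has_real_derivative \<alpha> * s powr (\<alpha> - 1)) (at s)"
      using that by (auto intro!: derivative_eq_intros)
    then have "((\<lambda>s. b * of_real (s powr \<alpha>)) has_vector_derivative b * of_real (\<alpha> * s powr (\<alpha> - 1))) (at s)"
      by (intro has_vector_derivative_mult_right has_vector_derivative_of_real)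
         (simp add: has_real_derivative_iff_has_vector_derivative)
    then have "((mittag_leffler \<alpha> \<circ> (\<lambda>s. b * of_real (s powr \<alpha>))) has_vector_derivative
       b * of_real (\<alpha> * s powr (\<alpha> - 1)) * (mittag_leffler_diag \<alpha> (b * of_real (s powr \<alpha>)) / of_real \<alpha>)) (at s)"
      by (rule field_vector_diff_chain_at) (rule mittag_leffler_has_field_derivative(1)[OF \<alpha>])
    then show ?thesis using \<alpha> by (simp add: o_def h_def mult_ac)
  qed
  \<comment> \<open>\<open>F k\<close> is the k-th term of the series for the Caputo integrand
    (t-s)^(-\<alpha>) h(s), cut off to [0, t].\<close>
  define F where "F k s = (b ^ Suc k / of_real (Gamma (\<alpha> * real k + \<alpha>))) *
     complex_of_real (indicator {0..t} s * ((t - s) powr (1 - \<alpha> - 1) * s powr (\<alpha> * real k + \<alpha> - 1)))" for k s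
  define C where "C k = Gamma (1 - \<alpha>) * t powr (\<alpha> * real k) / Gamma (\<alpha> * real k + 1)" for k
  have pos: "0 < \<alpha> * real k + \<alpha>" for k using \<alpha> by (simp add: add_nonneg_pos)
  have G: "0 < Gamma (\<alpha> * real k + \<alpha>)" "0 < Gamma (\<alpha> * real k + 1)" for k
    using \<alpha> pos by (auto intro!: Gamma_real_pos add_nonneg_pos)
  have base: "has_bochner_integral lborel
      (\<lambda>s. indicator {0..t} s * ((t - s) powr (1 - \<alpha> - 1) * s powr (\<alpha> * real k + \<alpha> - 1)))
      (Gamma (\<alpha> * real k + \<alpha>) * C k)" for k
    using has_bochner_integral_Beta[of "1 - \<alpha>" "\<alpha> * real k + \<alpha>" t] \<alpha> pos[of k] t
    by (simp add: C_def algebra_simps)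
  have F: "has_bochner_integral lborel (F k) (b ^ Suc k * of_real (C k))" for k
  proof -
    have "has_bochner_integral lborel (F k)
       ((b ^ Suc k / of_real (Gamma (\<alpha> * real k + \<alpha>))) * of_real (Gamma (\<alpha> * real k + \<alpha>) * C k))"
      unfolding F_def by (intro has_bochner_integral_mult_right has_bochner_integral_of_real base)
    then show ?thesis using G(1)[of k] by (simp add: mult_ac)
  qed
  have nF: "has_bochner_integral lborel (\<lambda>s. norm (F k s)) (cmod b ^ Suc k * C k)" for k
  proof -
    have "has_bochner_integral lborel (\<lambda>s. cmod b ^ Suc k / Gamma (\<alpha> * real k + \<alpha>) *
       (indicator {0..t} s * ((t - s) powr (1 - \<alpha> - 1) * s powr (\<alpha> * real k + \<alpha> - 1))))
       (cmod b ^ Suc k / Gamma (\<alpha> * real k + \<alpha>) * (Gamma (\<alpha> * real k + \<alpha>) * C k))"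
      by (intro has_bochner_integral_mult_right base)
    moreover have "norm (F k s) = cmod b ^ Suc k / Gamma (\<alpha> * real k + \<alpha>) *
       (indicator {0..t} s * ((t - s) powr (1 - \<alpha> - 1) * s powr (\<alpha> * real k + \<alpha> - 1)))" for s
      using G(1)[of k] by (simp add: F_def norm_mult norm_divide norm_power indicator_def)
    ultimately show ?thesis using G(1)[of k] by (simp add: mult_ac)
  qed
  have tp: "t powr (\<alpha> * real k) = (t powr \<alpha>) ^ k" for k
    using t by (simp add: powr_realpow[symmetric] powr_powr)
  have Csum: "(\<lambda>k. b ^ Suc k * complex_of_real (C k)) sums
     (of_real (Gamma (1 - \<alpha>)) * (b * mittag_leffler \<alpha> (b * of_real (t powr \<alpha>))))"
  proof -
    have "b ^ Suc k * complex_of_real (C k) = of_real (Gamma (1 - \<alpha>)) * b *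
        ((b * of_real (t powr \<alpha>)) ^ k / of_real (Gamma (\<alpha> * real k + 1)))" for k
      by (simp add: C_def tp power_mult_distrib)
    then show ?thesis
      using sums_mult[OF mittag_leffler_sums[OF \<alpha>, of "b * of_real (t powr \<alpha>)"],
        of "of_real (Gamma (1 - \<alpha>)) * b"] by (simp add: mult_ac)
  qed
  \<comment> \<open>The L1 norms of the terms sum to a multiple of a real Mittag-Leffler series at
    |b| t^\<alpha>; this licenses the exchange of sum and integral.\<close>
  have Cabs: "summable (\<lambda>k. cmod b ^ Suc k * C k)"
  proof -
    have "cmod b ^ Suc k * C k = Gamma (1 - \<alpha>) * cmod b *
        ((cmod b * t powr \<alpha>) ^ k / Gamma (\<alpha> * real k + 1))" for k
      by (simp add: C_def tp power_mult_distrib)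
    then show ?thesis
      using summable_mult[OF summable_mittag_leffler_real[OF \<alpha>, of "cmod b * t powr \<alpha>"],
        of "Gamma (1 - \<alpha>) * cmod b"] by simp
  qed
  have Fs: "F k s = complex_of_real (indicator {0..t} s * (t - s) powr (- \<alpha>)) * (b * of_real (s powr (\<alpha> - 1)))
       * ((b * of_real (s powr \<alpha>)) ^ k / of_real (Gamma (\<alpha> * real k + \<alpha>)))" for k s
  proof (cases "0 < s")
    case True
    then have "s powr (\<alpha> * real k + \<alpha> - 1) = s powr (\<alpha> - 1) * (s powr \<alpha>) ^ k"
      by (simp add: powr_realpow[symmetric] powr_powr powr_add[symmetric] algebra_simps)
    then show ?thesis by (simp add: F_def power_mult_distrib)
  next
    \<comment> \<open>For s < 0 the indicator vanishes; at s = 0 both sides are 0 because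
      \<open>0 powr x = 0\<close>.\<close>
    case False
    then show ?thesis by (auto simp: F_def indicator_def)
  qed
  have Fsum: "summable (\<lambda>k. norm (F k s))" for s
    unfolding Fs norm_mult[of "_ * _"]
    by (intro summable_mult mittag_leffler_has_field_derivative(2)[OF \<alpha>])
  have Finf: "(\<Sum>k. F k s) = indicator {0..t} s *\<^sub>R ((t - s) powr (- \<alpha>) *\<^sub>R h s)" for s
    unfolding Fs
    by (subst suminf_mult[OF summable_norm_cancel[OF mittag_leffler_has_field_derivative(2)[OF \<alpha>]]])
       (simp add: mittag_leffler_diag_def[symmetric] h_def scaleR_conv_of_real mult_ac)
  have int: "integrable lborel (\<lambda>s. \<Sum>k. F k s)"
    and su: "(\<lambda>k. integral\<^sup>L lborel (F k)) sums (\<integral>s. (\<Sum>k. F k s) \<partial>lborel)"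
    using integrable_suminf[of lborel F] sums_integral[of lborel F] F nF Fsum Cabs
    by (simp_all add: has_bochner_integral_iff)
  have val: "(\<integral>s. (\<Sum>k. F k s) \<partial>lborel) = of_real (Gamma (1 - \<alpha>)) * (b * mittag_leffler \<alpha> (b * of_real (t powr \<alpha>)))"
    using sums_unique2[OF su] Csum F by (simp add: has_bochner_integral_iff)
  have "Gamma (1 - \<alpha>) > 0" using \<alpha> by auto
  then show ?thesis
    unfolding has_caputo_derivative_def set_integrable_def set_lebesgue_integral_def
    using int val der
    by (intro exI[of _ h])
       (auto simp: Finf integrable_completion integral_completion scaleR_conv_of_real)
qed

section \<open>Integrals over the Hankel contour\<close>

text \<open>Contours are written in the coordinate \<open>\<zeta>\<close> with \<open>s = e\<^sup>\<zeta>\<close>: the two sides of the cut become the lines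
  \<open>Im \<zeta> = \<plusminus>\<pi>\<close>, and powers of \<open>s\<close> become entire. The strip
  is wider than \<open>\<pi>\<close> but contains no zero of \<open>1 - e\<^bsup>-\<alpha>\<zeta>\<^esup>\<close> other than 0, because \<open>4 < 2\<pi>/\<alpha>\<close>.\<close>

definition strip :: "complex set" where
  "strip = {z. \<bar>Im z\<bar> < 4}"

definition jump :: "(complex \<Rightarrow> complex) \<Rightarrow> real \<Rightarrow> complex" where
  "jump g x = g (Complex x pi) - g (Complex x (- pi))"

definition vert :: "(complex \<Rightarrow> complex) \<Rightarrow> real \<Rightarrow> complex" where
  "vert g x = \<i> * integral {-pi..pi} (\<lambda>y. g (Complex x y))"

text \<open>In along Im \<zeta> = -pi from +infinity to Re \<zeta> = x, up the vertical segment, out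
  along Im \<zeta> = pi: Hankel's contour around the negative axis, with the circle |s| = e^x as the
  segment. The integration is with respect to d\<zeta> = ds/s.\<close>

definition hankel :: "(complex \<Rightarrow> complex) \<Rightarrow> real \<Rightarrow> complex" where
  "hankel g x = (LINT s:{x..}|lborel. jump g s) + vert g x"

section \<open>Moving the contour and collapsing it onto the cut\<close>

lemma strip_eq: "strip = {z. Im z < 4} \<inter> {z. Im z > - 4}"
  by (auto simp: strip_def)

lemma open_strip: "open strip"
  unfolding strip_eq by (intro open_Int open_halfspace_Im_lt open_halfspace_Im_gt)

lemma convex_strip: "convex strip"
  unfolding strip_eq by (intro convex_Int convex_halfspace_Im_lt convex_halfspace_Im_gt)

lemma contour_integral_linepath_same_Im:
  assumes "a < b"
  shows "contour_integral (linepath (Complex a c) (Complex b c)) f = integral {a..b} (\<lambda>x. f (Complex x c))"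
proof -
  have lp: "linepath (Complex a c) (Complex b c) x = Complex (linepath a b x) c" for x
    by (simp add: linepath_def complex_eq_iff algebra_simps)
  have "contour_integral (linepath (Complex a c) (Complex b c)) f
      = contour_integral (linepath (of_real a) (of_real b)) (\<lambda>z. f (Complex (Re z) c))"
    unfolding contour_integral_integral linepath_of_real
    by (simp add: lp vector_derivative_linepath_at complex_eq_iff) (simp add: linepath_def)
  also have "\<dots> = integral {a..b} (\<lambda>x. f (Complex x c))"
    using contour_integral_linepath_Reals_eq[of "of_real a" "of_real b" "\<lambda>z. f (Complex (Re z) c)"] assms
    by simp
  finally show ?thesis .
qed

text \<open>The residue theorem on the rectangle with sides Re = a, b and Im = -pi, pi, in which 0
  is the only possible singularity. The top side runs from right to left, so the horizontal sides
  together give minus the integral of \<open>jump\<close>.\<close>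

lemma rectangle_residue:
  assumes g: "g holomorphic_on (strip - {0})" and ab: "a < 0" "0 < b"
  shows "vert g b - vert g a - integral {a..b} (jump g) = 2 * pi * \<i> * residue g 0"
proof -
  let ?R = "rectpath (Complex a (- pi)) (Complex b pi)"
  have pi4: "pi < 4" by (rule pi_less_4)
  have cont: "continuous_on (strip - {0}) g" using g by (rule holomorphic_on_imp_continuous_on)
  have cb: "cbox (Complex a (- pi)) (Complex b pi) \<subseteq> strip"
    using pi4 by (auto simp: strip_def in_cbox_complex_iff)
  have img: "path_image ?R \<subseteq> strip - {0}"
  proof -
    have "path_image ?R = cbox (Complex a (- pi)) (Complex b pi) - box (Complex a (- pi)) (Complex b pi)"
      using ab by (intro path_image_rectpath_cbox_minus_box) auto
    moreover have "0 \<in> box (Complex a (- pi)) (Complex b pi)"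
      using ab by (auto simp: in_box_complex_iff)
    ultimately show ?thesis using cb by auto
  qed
  have "contour_integral ?R g = 2 * pi * \<i> * (\<Sum>p\<in>{0}. winding_number ?R p * residue g p)"
  proof (rule Residue_theorem[OF open_strip convex_connected[OF convex_strip]])
    show "\<forall>z. z \<notin> strip \<longrightarrow> winding_number ?R z = 0"
      using cb ab by (auto intro!: winding_number_rectpath_outside)
  qed (use g img in auto)
  moreover have "winding_number ?R 0 = 1"
    using ab by (intro winding_number_rectpath) (auto simp: in_box_complex_iff)
  ultimately have R: "contour_integral ?R g = 2 * pi * \<i> * residue g 0" by simp
  have seg: "path_image (linepath (Complex a (- pi)) (Complex b (- pi))) \<subseteq> path_image ?R"
     "path_image (linepath (Complex b (- pi)) (Complex b pi)) \<subseteq> path_image ?R"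
     "path_image (linepath (Complex b pi) (Complex a pi)) \<subseteq> path_image ?R"
     "path_image (linepath (Complex a pi) (Complex a (- pi))) \<subseteq> path_image ?R"
    by (auto simp: rectpath_def Let_def path_image_join)
  have ci: "g contour_integrable_on (linepath p q)" if "path_image (linepath p q) \<subseteq> path_image ?R" for p q
    using that img by (intro contour_integrable_continuous_linepath continuous_on_subset[OF cont]) auto
  have "contour_integral ?R g =
     contour_integral (linepath (Complex a (- pi)) (Complex b (- pi))) g
     + (contour_integral (linepath (Complex b (- pi)) (Complex b pi)) g
     + (contour_integral (linepath (Complex b pi) (Complex a pi)) g
     + contour_integral (linepath (Complex a pi) (Complex a (- pi))) g))"
    using ci[OF seg(1)] ci[OF seg(2)] ci[OF seg(3)] ci[OF seg(4)]
    by (simp add: rectpath_def Let_def)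
  also have "contour_integral (linepath (Complex b pi) (Complex a pi)) g
     = - contour_integral (linepath (Complex a pi) (Complex b pi)) g"
    using ci[OF seg(3)] by (subst contour_integral_reverse_linepath[symmetric])
      (auto simp: closed_segment_commute intro!: continuous_on_subset[OF cont] order_trans[OF seg(3) img, simplified])
  also have "contour_integral (linepath (Complex a pi) (Complex a (- pi))) g
     = - contour_integral (linepath (Complex a (- pi)) (Complex a pi)) g"
    by (subst contour_integral_reverse_linepath[symmetric])
      (auto simp: closed_segment_commute intro!: continuous_on_subset[OF cont] order_trans[OF seg(4) img, simplified])
  also have "contour_integral (linepath (Complex b (- pi)) (Complex b pi)) g = vert g b"
    unfolding vert_def by (rule contour_integral_linepath_same_Re) auto
  also have "contour_integral (linepath (Complex a (- pi)) (Complex a pi)) g = vert g a"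
    unfolding vert_def by (rule contour_integral_linepath_same_Re) auto
  finally have E: "2 * pi * \<i> * residue g 0 = vert g b - vert g a -
     (contour_integral (linepath (Complex a pi) (Complex b pi)) g -
      contour_integral (linepath (Complex a (- pi)) (Complex b (- pi))) g)"
    using R by simp
  have hi: "(\<lambda>x. g (Complex x c)) integrable_on {a..b}" if "\<bar>c\<bar> = pi" for c
    using that pi4 by (intro integrable_continuous_real continuous_on_compose2[OF cont])
      (auto simp: strip_def Complex_eq complex_eq_iff intro!: continuous_intros)
  have "contour_integral (linepath (Complex a pi) (Complex b pi)) g -
      contour_integral (linepath (Complex a (- pi)) (Complex b (- pi))) g = integral {a..b} (jump g)"
    using ab by (simp add: contour_integral_linepath_same_Im jump_def[abs_def] integral_diff hi)
  with E show ?thesis by simp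
qed

lemma hankel_shift:
  assumes g: "g holomorphic_on (strip - {0})" and ab: "a < 0" "0 < b"
    and int: "set_integrable lborel {a..} (jump g)"
  shows "hankel g b = hankel g a + 2 * pi * \<i> * residue g 0"
proof -
  have i1: "set_integrable lborel {a..b} (jump g)" and i2: "set_integrable lborel {b..} (jump g)"
    using ab by (auto intro: set_integrable_subset[OF int])
  have "(LINT s:{a..}|lborel. jump g s) = (LINT s:{a..b} \<union> {b..}|lborel. jump g s)"
    using ab by (intro arg_cong2[where f = "\<lambda>A. set_lebesgue_integral lborel A"]) auto
  also have "\<dots> = (LINT s:{a..b}|lborel. jump g s) + (LINT s:{b..}|lborel. jump g s)"
  proof (rule set_integral_Un_AE)
    show "AE x in lborel. \<not> (x \<in> {a..b} \<and> x \<in> {b..})"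
      using AE_lborel_singleton[of b] by eventually_elim auto
  qed (use i1 i2 in auto)
  also have "(LINT s:{a..b}|lborel. jump g s) = integral {a..b} (jump g)"
    by (rule set_borel_integral_eq_integral(2)[OF i1])
  finally show ?thesis
    using rectangle_residue[OF g ab] by (simp add: hankel_def algebra_simps)
qed

text \<open>The segment at Re \<zeta> = x is the circle |s| = e^x shrinking onto the branch point.
  Its length in \<zeta> stays 2 pi, so a uniform limit c of g leaves 2 pi i c.\<close>

lemma vert_tendsto:
  assumes cont: "\<And>x. x < 0 \<Longrightarrow> continuous_on {-pi..pi} (\<lambda>y. g (Complex x y))"
    and bnd: "\<And>x y. x < 0 \<Longrightarrow> \<bar>y\<bar> \<le> pi \<Longrightarrow> norm (g (Complex x y) - c) \<le> e x"
    and e: "(e \<longlongrightarrow> 0) at_bot"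
  shows "(vert g \<longlongrightarrow> 2 * pi * \<i> * c) at_bot"
proof -
  have "norm (vert g x - 2 * pi * \<i> * c) \<le> e x * (2 * pi)" if x: "x < 0" for x
  proof -
    have i: "(\<lambda>y. g (Complex x y)) integrable_on {-pi..pi}"
      using cont[OF x] by (rule integrable_continuous_real)
    have "vert g x - 2 * pi * \<i> * c = \<i> * integral {-pi..pi} (\<lambda>y. g (Complex x y) - c)"
      by (simp add: vert_def integral_diff[OF i integrable_const_ivl] scaleR_conv_of_real algebra_simps)
    moreover have "norm (integral {-pi..pi} (\<lambda>y. g (Complex x y) - c)) \<le> e x * (pi - (- pi))"
      using x by (intro integral_bound continuous_intros cont bnd) auto
    ultimately show ?thesis by (simp add: norm_mult)
  qed
  then have "\<forall>\<^sub>F x in at_bot. norm (vert g x - 2 * pi * \<i> * c) \<le> e x * (2 * pi)"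
    by (intro eventually_mono[OF eventually_gt_at_bot[of 0]]) auto
  moreover have "((\<lambda>x. e x * (2 * pi)) \<longlongrightarrow> 0) at_bot"
    using tendsto_mult_left_zero[OF e] .
  ultimately have "((\<lambda>x. vert g x - 2 * pi * \<i> * c) \<longlongrightarrow> 0) at_bot"
    by (rule Lim_null_comparison)
  then show ?thesis by (simp add: Lim_null[symmetric])
qed

text \<open>The contour is pulled over the point \<zeta> = 0, that is s = 1, and then shrunk onto
  the cut. Dominated convergence completes the cut integral, and L is what remains of the small
  circle.\<close>

lemma hankel_eq_limit:
  assumes g: "g holomorphic_on (strip - {0})" and b: "0 < b"
    and int: "integrable lborel (jump g)"
    and lim: "(vert g \<longlongrightarrow> L) at_bot"
  shows "hankel g b = integral\<^sup>L lborel (jump g) + L + 2 * pi * \<i> * residue g 0"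
proof -
  define a where "a n = - real (Suc n)" for n
  have a: "filterlim a at_bot sequentially"
    unfolding a_def by real_asymp
  have 1: "(\<lambda>n. vert g (a n)) \<longlonglongrightarrow> L"
    using lim a by (rule filterlim_compose)
  have 2: "(\<lambda>n. LINT s:{a n..}|lborel. jump g s) \<longlonglongrightarrow> integral\<^sup>L lborel (jump g)"
    unfolding set_lebesgue_integral_def
  proof (rule integral_dominated_convergence[where w = "\<lambda>s. norm (jump g s)"])
    show "AE x in lborel. (\<lambda>n. indicat_real {a n..} x *\<^sub>R jump g x) \<longlonglongrightarrow> jump g x"
    proof (intro AE_I2 tendsto_eventually)
      fix x :: real
      obtain N where "- x \<le> real N" using real_arch_simple by blast
      then show "\<forall>\<^sub>F n in sequentially. indicat_real {a n..} x *\<^sub>R jump g x = jump g x"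
        by (intro eventually_sequentiallyI[of N]) (auto simp: a_def indicator_def)
    qed
  qed (use int in \<open>auto simp: indicator_def\<close>)
  have "hankel g b = (LINT s:{a n..}|lborel. jump g s) + vert g (a n) + 2 * pi * \<i> * residue g 0" for n
    using hankel_shift[OF g _ b, of "a n"] int integrable_mult_indicator[OF _ int, of "{a n..}"]
    by (simp add: hankel_def a_def set_integrable_def)
  moreover have "(\<lambda>n. (LINT s:{a n..}|lborel. jump g s) + vert g (a n) + 2 * pi * \<i> * residue g 0)
     \<longlonglongrightarrow> integral\<^sup>L lborel (jump g) + L + 2 * pi * \<i> * residue g 0"
    by (intro tendsto_intros 1 2)
  ultimately show ?thesis
    by (simp add: LIMSEQ_const_iff)
qed

section \<open>Hankel's integral for the reciprocal Gamma function\<close>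

text \<open>Euler's integral for Gamma(-z) on a logarithmic scale, by u = t e^x. The integrand is
  the modulus of the power kernel on the cut.\<close>

lemma Gamma_integral_exp:
  fixes t z :: real
  assumes t: "0 < t" and z: "z < 0"
  shows "has_bochner_integral lborel (\<lambda>x. exp (- t * exp x - z * x)) (Gamma (- z) * t powr z)"
proof -
  let ?f = "\<lambda>x. exp (- t * exp x - z * x)"
  have G: "((\<lambda>u. u powr (- z - 1) / exp u) has_integral Gamma (- z)) {0<..}"
  proof -
    have "((\<lambda>u. u powr (- z - 1) / exp u) has_integral Gamma (- z)) {0..}"
      using Gamma_integral_real[of "- z"] z by simp
    \<comment> \<open>The logarithmic substitution lives on the open half-line, so the endpoint 0 is
      dropped.\<close>
    moreover have "negligible (sym_diff {0..} {0<..} :: real set)"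
      by (rule negligible_subset[of "{0}"]) auto
    ultimately show ?thesis by (subst (asm) has_integral_spike_set_eq) (auto intro: negligible_subset)
  qed
  have "(\<lambda>u. u powr (- z - 1) / exp u) absolutely_integrable_on {0<..}"
    using G by (intro nonnegative_absolutely_integrable_1) (auto simp: has_integral_integrable)
  then have Gi: "set_integrable lborel {0<..} (\<lambda>u. u powr (- z - 1) / exp u)"
    unfolding set_integrable_def by (subst (asm) integrable_completion) auto
  have Gv: "(LINT u:{0<..}|lborel. u powr (- z - 1) / exp u) = Gamma (- z)"
    using set_borel_integral_eq_integral(2)[OF Gi] integral_unique[OF G] by simp
  have sub: "set_integrable lborel (einterval 0 \<infinity>) (\<lambda>u. ?f (ln (u / t)) * (1 / u))"
    and eq: "(LINT u:{0<..}|lborel. ?f (ln (u / t)) * (1 / u)) = t powr z * Gamma (- z)"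
  proof -
    have e: "?f (ln (u / t)) * (1 / u) = t powr z * (u powr (- z - 1) / exp u)" if "0 < u" for u
    proof -
      have "exp (- z * ln (u / t)) = t powr z * u powr (- z)"
        using that t by (simp add: powr_def ln_div exp_add[symmetric] algebra_simps)
      moreover have "?f (ln (u / t)) = exp (- u) * exp (- z * ln (u / t))"
        using that t by (simp add: exp_add[symmetric])
      ultimately have "?f (ln (u / t)) = exp (- u) * (t powr z * u powr (- z))" by (simp only:)
      then show ?thesis
        using that by (simp only: powr_diff exp_minus) (simp add: field_simps)
    qed
    have "set_integrable lborel {0<..} (\<lambda>u. ?f (ln (u / t)) * (1 / u)) \<longleftrightarrow>
       set_integrable lborel {0<..} (\<lambda>u. t powr z * (u powr (- z - 1) / exp u))"
      by (intro set_integrable_cong refl e) simp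
    moreover have "einterval 0 \<infinity> = {0<..}" by (auto simp: einterval_def)
    ultimately show "set_integrable lborel (einterval 0 \<infinity>) (\<lambda>u. ?f (ln (u / t)) * (1 / u))"
      using set_integrable_mult_right[OF Gi, of "t powr z"] by simp
    have "(LINT u:{0<..}|lborel. ?f (ln (u / t)) * (1 / u)) =
       (LINT u:{0<..}|lborel. t powr z * (u powr (- z - 1) / exp u))"
      by (intro set_lebesgue_integral_cong) (use e in auto)
    moreover have "(LINT u:{0<..}|lborel. t powr z * (u powr (- z - 1) / exp u))
       = t powr z * (LINT u:{0<..}|lborel. u powr (- z - 1) / exp u)"
      unfolding set_lebesgue_integral_def
      by (subst integral_mult_right_zero[symmetric]) (auto intro!: Bochner_Integration.integral_cong)
    ultimately show "(LINT u:{0<..}|lborel. ?f (ln (u / t)) * (1 / u)) = t powr z * Gamma (- z)"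
      unfolding Gv by (rule trans)
  qed
  have lim: "((ereal \<circ> (\<lambda>u. ln (u / t)) \<circ> real_of_ereal) \<longlongrightarrow> -\<infinity>) (at_right 0)"
    "((ereal \<circ> (\<lambda>u. ln (u / t)) \<circ> real_of_ereal) \<longlongrightarrow> \<infinity>) (at_left \<infinity>)"
  proof -
    have "filterlim (\<lambda>u. ln (u / t)) at_bot (at_right 0)" using t by real_asymp
    then show "((ereal \<circ> (\<lambda>u. ln (u / t)) \<circ> real_of_ereal) \<longlongrightarrow> -\<infinity>) (at_right 0)"
      by (simp add: zero_ereal_def ereal_tendsto_simps)
    have "filterlim (\<lambda>u. ln (u / t)) at_top at_top" using t by real_asymp
    then show "((ereal \<circ> (\<lambda>u. ln (u / t)) \<circ> real_of_ereal) \<longlongrightarrow> \<infinity>) (at_left \<infinity>)"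
      by (simp add: ereal_tendsto_simps)
  qed
  have d: "((\<lambda>u. ln (u / t)) has_real_derivative 1 / u) (at u)" if "0 < u" for u
    using that t by (auto intro!: derivative_eq_intros)
  have p1: "((\<lambda>u. ln (u / t)) has_real_derivative 1 / u) (at u)" if "0 < ereal u" for u
    using that d by (simp add: zero_ereal_def)
  have p2: "isCont ?f (ln (u / t))" for u
    by (intro continuous_intros)
  have p3: "isCont (\<lambda>u. 1 / u) u" if "0 < ereal u" for u :: real
    using that by (intro continuous_intros) (auto simp: zero_ereal_def)
  have p4: "0 \<le> 1 / u" if "0 \<le> ereal u" for u :: real
    using that by (simp add: zero_ereal_def)
  have "0 < (\<infinity>::ereal)" by simp
  note S = interval_integral_substitution_nonneg[where f = ?f, OF this p1 p2 p3 _ p4 lim sub]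
  have "set_integrable lborel (einterval (-\<infinity>) \<infinity>) ?f"
    by (rule S(1)) auto
  moreover have "(LBINT x=-\<infinity>..\<infinity>. ?f x) = (LBINT x=0..\<infinity>. ?f (ln (x / t)) * (1 / x))"
    by (rule S(2)) auto
  moreover have "(LBINT x=0..\<infinity>. ?f (ln (x / t)) * (1 / x)) = t powr z * Gamma (- z)"
    using eq by (simp add: interval_lebesgue_integral_def einterval_def zero_ereal_def
        greaterThan_def[symmetric])
  ultimately show ?thesis
    by (simp add: has_bochner_integral_iff set_integrable_def interval_lebesgue_integral_def
        set_lebesgue_integral_def mult_ac)
qed

text \<open>This is e^(ts) s^(-z) with s = e^\<zeta>: the integrand e^(ts) s^(-z-1) of Hankel's
  formula, with the factor s from ds = s d\<zeta> absorbed.\<close>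

definition pow_kernel :: "real \<Rightarrow> real \<Rightarrow> complex \<Rightarrow> complex" where
  "pow_kernel t z \<zeta> = exp (of_real t * exp \<zeta> - of_real z * \<zeta>)"

text \<open>This is e^(ts) s^(\<alpha>-1)/(s^\<alpha>-1), the inverse Laplace integrand for
  E_\<alpha>(t^\<alpha>), with ds = s d\<zeta> absorbed. The form 1/(1 - s^(-\<alpha>)) is chosen
  for its geometric expansion.\<close>

definition ml_kernel :: "real \<Rightarrow> real \<Rightarrow> complex \<Rightarrow> complex" where
  "ml_kernel t \<alpha> \<zeta> = exp (of_real t * exp \<zeta>) / (1 - exp (- (of_real \<alpha> * \<zeta>)))"

text \<open>The spectral density (sin(pi \<alpha>)/pi) r^(\<alpha>-1)/(r^(2\<alpha>) - 2 r^\<alpha>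
  cos(pi \<alpha>) + 1) dr of the Mittag-Leffler function, in r = e^x. The completed square makes
  positivity visible and points to an arctangent primitive.\<close>

definition ml_density :: "real \<Rightarrow> real \<Rightarrow> real" where
  "ml_density \<alpha> x = sin (pi * \<alpha>) / pi * exp (\<alpha> * x) /
     ((sin (pi * \<alpha>))\<^sup>2 + (exp (\<alpha> * x) - cos (pi * \<alpha>))\<^sup>2)"

lemma exp_Complex_pi: "exp (Complex x pi) = - of_real (exp x)" "exp (Complex x (- pi)) = - of_real (exp x)"
  by (simp_all add: exp_eq_polar complex_eq_iff)

lemma exp_mult_Complex: "exp (of_real z * Complex x y) = of_real (exp (z * x)) * cis (z * y)"
  by (simp add: exp_eq_polar)

text \<open>Both sides of the cut have s = -e^x; only the phases e^(-i pi z) and e^(i pi z) differ,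
  and their difference is a sine.\<close>

lemma jump_pow_kernel:
  "jump (pow_kernel t z) x = - 2 * \<i> * of_real (sin (pi * z)) * of_real (exp (- t * exp x - z * x))"
proof -
  have "pow_kernel t z (Complex x y) = of_real (exp (- t * exp x - z * x)) * cis (- z * y)"
    if "\<bar>y\<bar> = pi" for y
  proof -
    have "y = pi \<or> y = - pi" using that by linarith
    then have "exp (Complex x y) = - of_real (exp x)" using exp_Complex_pi by auto
    then have "of_real t * exp (Complex x y) - of_real z * Complex x y
        = of_real (- t * exp x - z * x) + \<i> * of_real (- z * y)"
      by (simp add: complex_eq_iff)
    then show ?thesis
      unfolding pow_kernel_def by (simp only: exp_add exp_of_real cis_conv_exp)
  qed
  then have "jump (pow_kernel t z) x = of_real (exp (- t * exp x - z * x)) * (cis (- (pi * z)) - cis (pi * z))"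
    by (simp add: jump_def mult_ac left_diff_distrib)
  moreover have "cis (- (pi * z)) - cis (pi * z) = - 2 * \<i> * of_real (sin (pi * z))"
    by (simp add: complex_eq_iff)
  ultimately show ?thesis by (simp only: mult_ac)
qed

lemma norm_pow_kernel: "norm (pow_kernel t z (Complex x y)) = exp (t * (exp x * cos y) - z * x)"
  by (simp add: pow_kernel_def Re_exp)

lemma holomorphic_pow_kernel: "pow_kernel t z holomorphic_on S"
  unfolding pow_kernel_def[abs_def] by (intro holomorphic_intros)

lemma continuous_on_Complex:
  "continuous_on S f \<Longrightarrow> continuous_on S g \<Longrightarrow> continuous_on S (\<lambda>x. Complex (f x) (g x))"
  unfolding Complex_eq by (intro continuous_intros)

lemma continuous_on_strip_line:
  assumes g: "g holomorphic_on strip - {0}" and b: "0 < b"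
  shows "\<bar>y\<bar> \<le> pi \<Longrightarrow> continuous_on {b..} (\<lambda>x. g (Complex x y))"
    and "continuous_on {-pi..pi} (\<lambda>y. g (Complex b y))"
proof -
  have c: "continuous_on (strip - {0}) g" using g by (rule holomorphic_on_imp_continuous_on)
  have m: "Complex x y \<in> strip - {0}" if "b \<le> x" "\<bar>y\<bar> \<le> pi" for x y
    using that b pi_less_4 by (auto simp: strip_def complex_eq_iff)
  show "continuous_on {b..} (\<lambda>x. g (Complex x y))" if "\<bar>y\<bar> \<le> pi"
  proof (rule continuous_on_compose2[OF c, where f = "\<lambda>x. Complex x y"])
    show "continuous_on {b..} (\<lambda>x. Complex x y)"
      by (intro continuous_on_Complex continuous_on_id continuous_on_const)
    show "(\<lambda>x. Complex x y) ` {b..} \<subseteq> strip - {0}"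
      by (intro image_subsetI m that) simp
  qed
  show "continuous_on {-pi..pi} (\<lambda>y. g (Complex b y))"
  proof (rule continuous_on_compose2[OF c, where f = "\<lambda>y. Complex b y"])
    show "continuous_on {-pi..pi} (\<lambda>y. Complex b y)"
      by (intro continuous_on_Complex continuous_on_id continuous_on_const)
    show "(\<lambda>y. Complex b y) ` {-pi..pi} \<subseteq> strip - {0}"
      by (intro image_subsetI m) auto
  qed
qed

lemma continuous_on_jump:
  assumes "g holomorphic_on strip - {0}" "0 < b"
  shows "continuous_on {b..} (jump g)"
  unfolding jump_def[abs_def]
  using continuous_on_strip_line(1)[OF assms, of pi] continuous_on_strip_line(1)[OF assms, of "- pi"]
  by (intro continuous_on_diff) auto

text \<open>One constant C controls the whole contour. On the cut, e^(ts) decays like exp(-t e^x),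
  and the extra factor e^x admits power kernels with exponents down to z = -1, which the recurrence
  in z requires.\<close>

definition admissible :: "real \<Rightarrow> real \<Rightarrow> (complex \<Rightarrow> complex) \<Rightarrow> real \<Rightarrow> bool" where
  "admissible t b g C \<longleftrightarrow> g holomorphic_on strip - {0} \<and>
     (\<forall>x\<ge>b. norm (g (Complex x pi)) \<le> C * exp (x - t * exp x) \<and>
            norm (g (Complex x (- pi))) \<le> C * exp (x - t * exp x)) \<and>
     (\<forall>y. \<bar>y\<bar> \<le> pi \<longrightarrow> norm (g (Complex b y)) \<le> C * exp (b + t * exp b))"

lemma integrable_majorant:
  fixes t :: real
  assumes "0 < t" shows "integrable lborel (\<lambda>x. exp (x - t * exp x))"
  using Gamma_integral_exp[of t "-1"] assms by (simp add: has_bochner_integral_iff)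

context
  fixes t b :: real
  assumes t: "0 < t" and b: "0 < b"
begin

lemma admissible_jump_bound:
  assumes "admissible t b g C" "b \<le> x"
  shows "norm (jump g x) \<le> 2 * C * exp (x - t * exp x)"
proof -
  have "norm (jump g x) \<le> norm (g (Complex x pi)) + norm (g (Complex x (- pi)))"
    unfolding jump_def by (rule norm_triangle_ineq4)
  with assms show ?thesis unfolding admissible_def by fastforce
qed

lemma admissible_nonneg:
  assumes "admissible t b g C"
  shows "0 \<le> C"
proof -
  have "0 \<le> C * exp (b - t * exp b)"
    using assms norm_ge_zero order_trans unfolding admissible_def by blast
  then show ?thesis by (simp add: zero_le_mult_iff)
qed

lemma admissible_integrable:
  assumes "admissible t b g C"
  shows "set_integrable lborel {b..} (jump g)"
  unfolding set_integrable_def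
proof (rule Bochner_Integration.integrable_bound)
  show "integrable lborel (\<lambda>x. 2 * C * exp (x - t * exp x))"
    using integrable_majorant[OF t] by simp
  have "continuous_on {b..} (jump g)"
    using assms b by (intro continuous_on_jump) (auto simp: admissible_def)
  then show "(\<lambda>x. indicat_real {b..} x *\<^sub>R jump g x) \<in> borel_measurable lborel"
    using borel_measurable_continuous_on_indicator[of "{b..}" "jump g"] by simp
  note C = admissible_nonneg[OF assms]
  show "AE x in lborel. norm (indicat_real {b..} x *\<^sub>R jump g x) \<le> norm (2 * C * exp (x - t * exp x))"
    using admissible_jump_bound[OF assms] C by (auto simp: indicator_def)
qed

lemma admissible_vert:
  assumes "admissible t b g C"
  shows "(\<lambda>y. g (Complex b y)) integrable_on {-pi..pi}"
  using assms b by (intro integrable_continuous_real continuous_on_strip_line(2)) (auto simp: admissible_def)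

lemma hankel_diff:
  assumes "admissible t b f C" "admissible t b g D"
  shows "hankel (\<lambda>\<zeta>. f \<zeta> - g \<zeta>) b = hankel f b - hankel g b"
proof -
  have "jump (\<lambda>\<zeta>. f \<zeta> - g \<zeta>) = (\<lambda>x. jump f x - jump g x)" by (simp add: jump_def fun_eq_iff)
  moreover have "vert (\<lambda>\<zeta>. f \<zeta> - g \<zeta>) b = vert f b - vert g b"
    using integral_diff[OF admissible_vert[OF assms(1)] admissible_vert[OF assms(2)]]
    by (simp add: vert_def right_diff_distrib)
  ultimately show ?thesis
    using set_integral_diff(2)[OF admissible_integrable[OF assms(1)] admissible_integrable[OF assms(2)]]
    by (simp add: hankel_def)
qed

text \<open>The bracket depends on t and b only, so functions whose constants C tend to 0 have
  Hankel integrals tending to 0. This disposes of the remainder of the geometric series.\<close>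

lemma hankel_bound:
  assumes "admissible t b g C"
  shows "norm (hankel g b) \<le> C * (2 * (LINT x|lborel. exp (x - t * exp x)) + 2 * pi * exp (b + t * exp b))"
proof -
  have i: "integrable lborel (\<lambda>x. indicat_real {b..} x *\<^sub>R jump g x)"
    using admissible_integrable[OF assms] by (simp add: set_integrable_def)
  note C = admissible_nonneg[OF assms]
  have "norm (LINT s:{b..}|lborel. jump g s) \<le> (LINT x|lborel. norm (indicat_real {b..} x *\<^sub>R jump g x))"
    unfolding set_lebesgue_integral_def by (rule integral_norm_bound)
  also have "\<dots> \<le> (LINT x|lborel. 2 * C * exp (x - t * exp x))"
    using admissible_jump_bound[OF assms] C integrable_majorant[OF t] i
    by (intro integral_mono integrable_norm) (auto simp: indicator_def)
  finally have 1: "norm (LINT s:{b..}|lborel. jump g s) \<le> 2 * C * (LINT x|lborel. exp (x - t * exp x))"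
    by simp
  have "norm (integral {-pi..pi} (\<lambda>y. g (Complex b y))) \<le> integral {-pi..pi} (\<lambda>y. C * exp (b + t * exp b))"
    using assms by (intro integral_norm_bound_integral admissible_vert[OF assms]) (auto simp: admissible_def)
  then have 2: "norm (vert g b) \<le> 2 * pi * C * exp (b + t * exp b)"
    by (simp add: vert_def norm_mult mult_ac)
  have "norm (hankel g b) \<le> norm (LINT s:{b..}|lborel. jump g s) + norm (vert g b)"
    unfolding hankel_def by (rule norm_triangle_ineq)
  with 1 2 show ?thesis by (simp add: algebra_simps)
qed

end

lemma norm_exp_minus_1_le: "cmod (exp w - 1) \<le> exp (cmod w) * cmod w"
proof -
  have "cmod (exp w - exp 0) \<le> exp (cmod w) * cmod (w - 0)"
  proof (rule field_differentiable_bound[of "cball 0 (cmod w)"])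
    show "(exp has_field_derivative exp z) (at z within cball 0 (cmod w))" for z :: complex
      by (rule has_field_derivative_at_within[OF DERIV_exp])
    show "cmod (exp z) \<le> exp (cmod w)" if "z \<in> cball 0 (cmod w)" for z
      using that norm_exp[of z] by (auto intro: order_trans)
  qed auto
  then show ?thesis by simp
qed

lemma admissible_pow_kernel:
  assumes t: "0 < t" and b: "0 < b" and z: "- 1 \<le> z"
  shows "admissible t b (pow_kernel t z) 1"
  unfolding admissible_def
proof (intro conjI allI impI holomorphic_pow_kernel)
  have x: "- (z * x) \<le> x" if "b \<le> x" for x
    using mult_right_mono[of "- z" 1 x] z b that by simp
  show "norm (pow_kernel t z (Complex x pi)) \<le> 1 * exp (x - t * exp x)"
       "norm (pow_kernel t z (Complex x (- pi))) \<le> 1 * exp (x - t * exp x)" if "b \<le> x" for x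
    using x[OF that] by (simp_all add: norm_pow_kernel)
  fix y :: real
  have "t * (exp b * cos y) \<le> t * (exp b * 1)"
    using t by (intro mult_left_mono) auto
  then show "norm (pow_kernel t z (Complex b y)) \<le> 1 * exp (b + t * exp b)"
    using x[of b] by (simp add: norm_pow_kernel)
qed

lemma residue_pow_kernel: "residue (pow_kernel t z) 0 = 0"
  by (rule residue_holo[OF open_UNIV UNIV_I holomorphic_pow_kernel])

text \<open>The reflection formula at -z. It converts the factor sin(pi z) Gamma(-z) produced by the
  cut into a reciprocal Gamma value.\<close>

lemma Gamma_reflection_real_neg:
  fixes z :: real
  assumes "- 1 < z" "z < 0"
  shows "- sin (pi * z) * Gamma (- z) = pi * rGamma (1 + z)"
proof -
  have "rGamma (complex_of_real (- z)) * rGamma (1 - complex_of_real (- z)) = sin (of_real pi * of_real (- z)) / of_real pi"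
    by (rule rGamma_reflection_complex)
  then have "complex_of_real (rGamma (- z) * rGamma (1 + z)) = complex_of_real (- sin (pi * z) / pi)"
    by (simp add: rGamma_complex_of_real[symmetric] sin_of_real[symmetric] del: of_real_mult)
       (simp add: rGamma_complex_of_real[symmetric] sin_of_real[symmetric])
  then have "rGamma (- z) * rGamma (1 + z) = - sin (pi * z) / pi"
    by (simp only: of_real_eq_iff)
  moreover have "rGamma (- z) = 1 / Gamma (- z)"
    by (simp add: Gamma_def field_simps)
  moreover have "Gamma (- z) \<noteq> 0"
    using assms Gamma_real_pos[of "- z"] by linarith
  ultimately show ?thesis
    by (simp add: field_simps)
qed

text \<open>In this range the contour can be collapsed. For z < 0 the small circle contributes
  nothing and the cut gives a Gamma integral; for z = 0 there is no jump and the small circle alone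
  gives 2 pi i.\<close>

lemma hankel_pow_base:
  assumes t: "0 < t" and b: "0 < b" and z: "- 1 < z" "z \<le> 0"
  shows "hankel (pow_kernel t z) b = 2 * pi * \<i> * of_real (t powr z * rGamma (1 + z))"
proof (cases "z = 0")
  case True
  have j: "jump (pow_kernel t 0) = (\<lambda>_. 0)"
    by (simp add: jump_pow_kernel fun_eq_iff)
  have "(vert (pow_kernel t 0) \<longlongrightarrow> 2 * pi * \<i> * 1) at_bot"
  proof (rule vert_tendsto)
    show "continuous_on {-pi..pi} (\<lambda>y. pow_kernel t 0 (Complex x y))" for x
      unfolding pow_kernel_def by (intro continuous_intros continuous_on_Complex)
    show "norm (pow_kernel t 0 (Complex x y) - 1) \<le> exp (t * exp x) * (t * exp x)" for x y
      using norm_exp_minus_1_le[of "of_real t * exp (Complex x y)"] t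
      by (simp add: pow_kernel_def norm_mult)
    show "((\<lambda>x. exp (t * exp x) * (t * exp x)) \<longlongrightarrow> 0) at_bot"
      by real_asymp
  qed
  then have "hankel (pow_kernel t 0) b = integral\<^sup>L lborel (jump (pow_kernel t 0)) + 2 * pi * \<i> * 1
      + 2 * pi * \<i> * residue (pow_kernel t 0) 0"
    by (intro hankel_eq_limit b holomorphic_pow_kernel) (simp add: j)
  then show ?thesis using True t by (simp add: j residue_pow_kernel)
next
  case False
  with z have z': "z < 0" by simp
  have "(vert (pow_kernel t z) \<longlongrightarrow> 2 * pi * \<i> * 0) at_bot"
  proof (rule vert_tendsto)
    show "continuous_on {-pi..pi} (\<lambda>y. pow_kernel t z (Complex x y))" for x
      unfolding pow_kernel_def by (intro continuous_intros continuous_on_Complex)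
    show "norm (pow_kernel t z (Complex x y) - 0) \<le> exp (t * exp x - z * x)" for x y
      using t mult_left_mono[of "exp x * cos y" "exp x" t] by (simp add: norm_pow_kernel)
    have "((\<lambda>x. exp (t * exp x + (- z) * x)) \<longlongrightarrow> 0) at_bot"
      using z' t by real_asymp
    then show "((\<lambda>x. exp (t * exp x - z * x)) \<longlongrightarrow> 0) at_bot"
      by simp
  qed
  moreover have hb: "has_bochner_integral lborel (jump (pow_kernel t z))
      (- 2 * \<i> * of_real (sin (pi * z)) * of_real (Gamma (- z) * t powr z))"
    unfolding jump_pow_kernel
    by (intro has_bochner_integral_mult_right has_bochner_integral_of_real Gamma_integral_exp t z')
  ultimately have "hankel (pow_kernel t z) b =
      - 2 * \<i> * of_real (sin (pi * z)) * of_real (Gamma (- z) * t powr z) + 2 * pi * \<i> * 0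
      + 2 * pi * \<i> * residue (pow_kernel t z) 0"
    by (subst hankel_eq_limit[OF holomorphic_pow_kernel b, of _ _ "2 * pi * \<i> * 0"])
       (auto simp: has_bochner_integral_iff)
  also have "\<dots> = 2 * \<i> * of_real (- sin (pi * z) * Gamma (- z)) * of_real (t powr z)"
    by (simp add: residue_pow_kernel)
  also have "\<dots> = 2 * pi * \<i> * of_real (t powr z * rGamma (1 + z))"
    unfolding Gamma_reflection_real_neg[OF z(1) z'] by simp
  finally show ?thesis .
qed

lemma has_vector_derivative_Complex:
  "((\<lambda>x. Complex x y) has_vector_derivative 1) (at x within S)"
  "((\<lambda>y. Complex x y) has_vector_derivative \<i>) (at y within S)"
  unfolding Complex_eq by (auto intro!: derivative_eq_intros)

text \<open>\<open>(t e\<^sup>\<zeta> - z)\<close> times the kernel is the derivative of the kernel, which vanishes at both ends of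
  the Hankel contour.\<close>

lemma hankel_pow_recurrence:
  assumes t: "0 < t" and b: "0 < b" and z: "0 < z"
  shows "of_real z * hankel (pow_kernel t z) b = of_real t * hankel (pow_kernel t (z - 1)) b"
proof -
  let ?F = "pow_kernel t z"
  define G where "G \<zeta> = of_real t * pow_kernel t (z - 1) \<zeta> - of_real z * ?F \<zeta>" for \<zeta>
  have dF: "(?F has_field_derivative G \<zeta>) (at \<zeta>)" for \<zeta>
  proof -
    have "(?F has_field_derivative ?F \<zeta> * (of_real t * exp \<zeta> - of_real z)) (at \<zeta>)"
      unfolding pow_kernel_def[abs_def]
      by (rule derivative_eq_intros refl | simp)+
    moreover have "?F \<zeta> * exp \<zeta> = pow_kernel t (z - 1) \<zeta>"
      by (simp add: pow_kernel_def exp_add[symmetric] algebra_simps)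
    ultimately show ?thesis by (simp add: G_def algebra_simps)
  qed
  have dx: "((\<lambda>x. ?F (Complex x y)) has_vector_derivative G (Complex x y)) (at x)" for x y
    using field_vector_diff_chain_at[OF has_vector_derivative_Complex(1) dF] by (simp add: o_def)
  have dy: "((\<lambda>y. ?F (Complex x y)) has_vector_derivative \<i> * G (Complex x y)) (at y within S)" for x y S
    by (rule has_vector_derivative_at_within)
      (use field_vector_diff_chain_at[OF has_vector_derivative_Complex(2) dF] in \<open>simp add: o_def\<close>)
  have a1: "admissible t b (pow_kernel t (z - 1)) 1" "admissible t b (pow_kernel t z) 1"
    using z by (auto intro!: admissible_pow_kernel t b)
  have jG: "jump G = (\<lambda>x. of_real t * jump (pow_kernel t (z - 1)) x - of_real z * jump (pow_kernel t z) x)"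
    by (simp add: G_def jump_def fun_eq_iff algebra_simps)
  have iG: "set_integrable lborel {b..} (jump G)"
    unfolding jG using admissible_integrable[OF t b a1(1)] admissible_integrable[OF t b a1(2)]
    by (intro set_integral_diff(1) set_integrable_mult_right)
  have "(LBINT x=ereal b..\<infinity>. jump G x) = 0 - jump ?F b"
  proof (rule interval_integral_FTC_integrable)
    show "(jump ?F has_vector_derivative jump G x) (at x)" for x
      unfolding jump_def[abs_def] by (intro derivative_intros dx)
    show "isCont (jump G) x" for x
      unfolding jG jump_pow_kernel by (intro continuous_intros)
    show "set_integrable lborel (einterval (ereal b) \<infinity>) (jump G)"
      by (rule set_integrable_subset[OF iG]) (auto simp: einterval_def)
    have "isCont (jump ?F) b" unfolding jump_pow_kernel by (intro continuous_intros)
    then have "((\<lambda>x. jump ?F x) \<longlongrightarrow> jump ?F b) (at_right b)"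
      by (auto simp: isCont_def intro: filterlim_mono[OF _ order_refl at_le])
    then show "((jump ?F \<circ> real_of_ereal) \<longlongrightarrow> jump ?F b) (at_right (ereal b))"
      by (simp add: ereal_tendsto_simps)
    have "((\<lambda>x. exp (- t * exp x - z * x)) \<longlongrightarrow> 0) at_top"
      using t z by real_asymp
    then have "((\<lambda>x. - 2 * \<i> * of_real (sin (pi * z)) * of_real (exp (- t * exp x - z * x))) \<longlongrightarrow>
       - 2 * \<i> * of_real (sin (pi * z)) * of_real 0) at_top"
      by (intro tendsto_mult_left tendsto_of_real)
    then have "(jump ?F \<longlongrightarrow> 0) at_top" by (simp add: jump_pow_kernel[abs_def])
    then show "((jump ?F \<circ> real_of_ereal) \<longlongrightarrow> 0) (at_left \<infinity>)"
      by (simp add: ereal_tendsto_simps)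
  qed simp
  moreover have "(LBINT x=ereal b..\<infinity>. jump G x) = (LINT x:{b..}|lborel. jump G x)"
  proof -
    have "einterval (ereal b) \<infinity> = {b<..}" by (auto simp: einterval_def)
    moreover have "(LINT x:{b<..}|lborel. jump G x) = (LINT x:{b..}|lborel. jump G x)"
      unfolding set_lebesgue_integral_def
    proof (rule integral_cong_AE)
      have "set_integrable lborel {b<..} (jump G)" by (rule set_integrable_subset[OF iG]) auto
      then show "(\<lambda>x. indicat_real {b<..} x *\<^sub>R jump G x) \<in> borel_measurable lborel"
        unfolding set_integrable_def by (rule borel_measurable_integrable)
      show "(\<lambda>x. indicat_real {b..} x *\<^sub>R jump G x) \<in> borel_measurable lborel"
        using iG unfolding set_integrable_def by (rule borel_measurable_integrable)
      show "AE x in lborel. indicat_real {b<..} x *\<^sub>R jump G x = indicat_real {b..} x *\<^sub>R jump G x"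
        using AE_lborel_singleton[of b] by eventually_elim (auto simp: indicator_def)
    qed
    ultimately show ?thesis by (simp add: interval_lebesgue_integral_def)
  qed
  moreover have "vert G b = jump ?F b"
  proof -
    have "((\<lambda>y. \<i> * G (Complex b y)) has_integral (?F (Complex b pi) - ?F (Complex b (- pi)))) {-pi..pi}"
      by (intro fundamental_theorem_of_calculus dy) auto
    then have "integral {-pi..pi} (\<lambda>y. \<i> * G (Complex b y)) = jump ?F b"
      unfolding jump_def by (rule integral_unique)
    then show ?thesis by (simp add: vert_def)
  qed
  \<comment> \<open>The values at the corners b + i pi and b - i pi cancel: the horizontal lines
    contribute \<open>- jump ?F b\<close>, the segment contributes \<open>jump ?F b\<close>.\<close>
  ultimately have "hankel G b = 0" by (simp add: hankel_def)
  moreover have "hankel G b = of_real t * hankel (pow_kernel t (z - 1)) b - of_real z * hankel ?F b"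
  proof -
    have 1: "(LINT x:{b..}|lborel. jump G x) = of_real t * (LINT x:{b..}|lborel. jump (pow_kernel t (z - 1)) x)
        - of_real z * (LINT x:{b..}|lborel. jump ?F x)"
      unfolding jG using admissible_integrable[OF t b a1(1)] admissible_integrable[OF t b a1(2)]
      by (subst set_integral_diff(2)) auto
    have 2: "vert G b = of_real t * vert (pow_kernel t (z - 1)) b - of_real z * vert ?F b"
      unfolding G_def vert_def
      using integrable_on_mult_right[OF admissible_vert[OF t b a1(1)], of "of_real t"]
        integrable_on_mult_right[OF admissible_vert[OF t b a1(2)], of "of_real z"]
      by (simp add: integral_diff right_diff_distrib mult_ac)
    from 1 2 show ?thesis by (simp add: hankel_def algebra_simps)
  qed
  ultimately show ?thesis by simp
qed

text \<open>The recurrence of the Hankel integrals matches rGamma(v) = v rGamma(v + 1), so the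
  formula climbs by integer steps from the base range.\<close>

lemma hankel_pow_shift:
  assumes t: "0 < t" and b: "0 < b" and z: "- 1 < z" "z \<le> 0"
  shows "hankel (pow_kernel t (z + real m)) b
    = 2 * pi * \<i> * of_real (t powr (z + real m) * rGamma (1 + (z + real m)))"
proof (induction m)
  case 0
  then show ?case using hankel_pow_base[OF t b z] by simp
next
  case (Suc m)
  define v where "v = z + real (Suc m)"
  have v: "0 < v" using z by (simp add: v_def)
  have v1: "v - 1 = z + real m" by (simp add: v_def)
  have "of_real v * hankel (pow_kernel t v) b
      = of_real t * (2 * pi * \<i> * of_real (t powr (v - 1) * rGamma (1 + (v - 1))))"
    using hankel_pow_recurrence[OF t b v] Suc.IH unfolding v1 by simp
  also have "\<dots> = 2 * pi * \<i> * of_real (t * t powr (v - 1) * rGamma v)" by simp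
  also have "t * t powr (v - 1) = t powr v" using t by (simp add: powr_diff)
  also have "rGamma v = v * rGamma (v + 1)" by (simp add: rGamma_plus1)
  also have "2 * pi * \<i> * complex_of_real (t powr v * (v * rGamma (v + 1)))
     = of_real v * (2 * pi * \<i> * complex_of_real (t powr v * rGamma (1 + v)))"
    by (simp add: add.commute)
  finally show ?case using v unfolding v_def[symmetric] by simp
qed

text \<open>Subtracting the ceiling of z lands in the base range (-1, 0], from where the shift
  returns to z.\<close>

lemma hankel_pow_kernel:
  assumes t: "0 < t" and b: "0 < b" and z: "0 \<le> z"
  shows "hankel (pow_kernel t z) b = 2 * pi * \<i> * of_real (t powr z / Gamma (z + 1))"
proof -
  define m where "m = nat \<lceil>z\<rceil>"
  have "real m = of_int \<lceil>z\<rceil>" using z by (simp add: m_def)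
  then have "- 1 < z - real m" "z - real m \<le> 0" by linarith+
  from hankel_pow_shift[OF t b this, of m] show ?thesis
    by (simp add: Gamma_def field_simps)
qed

section \<open>Integral representation of the Mittag-Leffler function\<close>

lemma ml_kernel_denominator:
  assumes "0 < \<alpha>" "\<alpha> < 1" "\<zeta> \<in> strip - {0}"
  shows "1 - exp (- (of_real \<alpha> * \<zeta>)) \<noteq> 0"
proof
  assume "1 - exp (- (of_real \<alpha> * \<zeta>)) = 0"
  then obtain n :: int where n: "Re (- (of_real \<alpha> * \<zeta>)) = 0" "Im (- (of_real \<alpha> * \<zeta>)) = of_int (2 * n) * pi"
    using exp_eq_1[of "- (of_real \<alpha> * \<zeta>)"] by auto
  have "\<bar>\<alpha> * Im \<zeta>\<bar> < 1 * 4"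
    using assms unfolding abs_mult by (intro mult_strict_mono) (auto simp: strip_def)
  then have "\<bar>of_int (2 * n) * pi\<bar> < 4" using n(2) by simp
  moreover have "\<bar>of_int (2 * n) * pi\<bar> \<ge> 6" if "n \<noteq> 0"
  proof -
    have "1 \<le> \<bar>n\<bar>" using that by simp
    then have "(1::real) \<le> \<bar>of_int n\<bar>" by linarith
    then have "1 * 3 \<le> \<bar>of_int n\<bar> * pi" using pi_gt3 by (intro mult_mono) auto
    then show ?thesis by (simp add: abs_mult mult.commute)
  qed
  ultimately have "n = 0" by fastforce
  with n assms(1) have "Re \<zeta> = 0" "Im \<zeta> = 0" by auto
  with assms(3) show False by (auto simp: complex_eq_iff)
qed

lemma holomorphic_ml_kernel:
  assumes "0 < \<alpha>" "\<alpha> < 1"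
  shows "ml_kernel t \<alpha> holomorphic_on strip - {0}"
  unfolding ml_kernel_def[abs_def]
  by (intro holomorphic_intros) (use ml_kernel_denominator[OF assms] in auto)

text \<open>At \<zeta> = 0, that is s = 1, the denominator has a simple zero with derivative
  \<alpha> and the numerator equals e^t. This is the source of the exponential term in the
  representation.\<close>

lemma residue_ml_kernel:
  assumes "0 < \<alpha>" "\<alpha> < 1"
  shows "residue (ml_kernel t \<alpha>) 0 = of_real (exp t / \<alpha>)"
proof (rule residue_simple'[OF open_strip _ holomorphic_ml_kernel[OF assms]])
  show "0 \<in> strip" by (simp add: strip_def)
  have "((\<lambda>w. - exp (- (of_real \<alpha> * w))) has_field_derivative of_real \<alpha>) (at (0::complex))"
    by (auto intro!: derivative_eq_intros)
  then have "((\<lambda>w. (- exp (- (of_real \<alpha> * w)) - (- 1)) / w) \<longlongrightarrow> of_real \<alpha>) (at (0::complex))"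
    by (simp add: has_field_derivative_iff)
  then have "((\<lambda>w. (1 - exp (- (of_real \<alpha> * w))) / w) \<longlongrightarrow> of_real \<alpha>) (at (0::complex))"
    by simp
  moreover have "((\<lambda>w. exp (of_real t * exp w)) \<longlongrightarrow> exp (of_real t * exp 0)) (at (0::complex))"
    by (intro tendsto_intros)
  ultimately have "((\<lambda>w. exp (of_real t * exp w) / ((1 - exp (- (of_real \<alpha> * w))) / w))
      \<longlongrightarrow> exp (of_real t * exp 0) / of_real \<alpha>) (at (0::complex))"
    using assms by (intro tendsto_divide) auto
  then show "((\<lambda>w. ml_kernel t \<alpha> w * (w - 0)) \<longlongrightarrow> of_real (exp t / \<alpha>)) (at 0)"
    by (simp add: ml_kernel_def exp_of_real)
qed

section \<open>The density on the cut, its mass and its Laplace transform\<close>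

lemma sin_pi_pos: "0 < \<alpha> \<Longrightarrow> \<alpha> < 1 \<Longrightarrow> 0 < sin (pi * \<alpha>)"
  by (intro sin_gt_zero) auto

lemma ml_density_denominator:
  assumes "0 < \<alpha>" "\<alpha> < 1"
  shows "0 < (sin (pi * \<alpha>))\<^sup>2 + (exp (\<alpha> * x) - cos (pi * \<alpha>))\<^sup>2"
  using sin_pi_pos[OF assms] by (intro add_pos_nonneg) auto

lemma ml_density_nonneg: "0 < \<alpha> \<Longrightarrow> \<alpha> < 1 \<Longrightarrow> 0 \<le> ml_density \<alpha> x"
  unfolding ml_density_def using sin_pi_pos[of \<alpha>] ml_density_denominator[of \<alpha> x] by simp

text \<open>On the two sides of the cut the kernel takes conjugate values, so the jump is 2i times
  an imaginary part.\<close>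

lemma jump_ml_kernel:
  assumes "0 < \<alpha>" "\<alpha> < 1"
  shows "jump (ml_kernel t \<alpha>) x = - 2 * pi * \<i> * of_real (exp (- t * exp x) * ml_density \<alpha> x)"
proof -
  define v where "v = exp (\<alpha> * x)"
  define c where "c = cos (pi * \<alpha>)"
  define s where "s = sin (pi * \<alpha>)"
  have v: "v > 0" by (simp add: v_def)
  have sc: "s\<^sup>2 + c\<^sup>2 = 1" by (simp add: s_def c_def)
  have s: "s > 0" using sin_pi_pos[OF assms] by (simp add: s_def)
  \<comment> \<open>A = e^(\<alpha>x) - e^(-i pi \<alpha>), the denominator on the upper side after
    multiplication by e^(\<alpha>x); the lower side gives its conjugate.\<close>
  define A where "A = Complex (v - c) s"
  have A: "A \<noteq> 0" "cnj A \<noteq> 0" using s by (auto simp: A_def complex_eq_iff)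
  have AA: "A * cnj A = of_real (s\<^sup>2 + (v - c)\<^sup>2)"
    by (simp add: A_def complex_mult_cnj add.commute)
  have vv: "exp (- (\<alpha> * x)) = 1 / v" by (simp add: v_def exp_minus field_simps)
  have e1: "exp (- (of_real \<alpha> * Complex x pi)) = (c - \<i> * s) / v"
    using exp_mult_Complex[of "- \<alpha>" x pi]
    by (simp add: vv c_def s_def cis.ctr complex_eq_iff mult.commute)
  have e2: "exp (- (of_real \<alpha> * Complex x (- pi))) = (c + \<i> * s) / v"
    using exp_mult_Complex[of "- \<alpha>" x "- pi"]
    by (simp add: vv c_def s_def cis.ctr complex_eq_iff mult.commute)
  have k1: "ml_kernel t \<alpha> (Complex x pi) = of_real (exp (- t * exp x)) * (v / A)"
  proof -
    have "1 - (c - \<i> * s) / v = A / v" using v by (simp add: A_def complex_eq_iff field_simps)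
    then show ?thesis
      unfolding ml_kernel_def e1 exp_Complex_pi
      by (simp add: exp_of_real[symmetric])
  qed
  have k2: "ml_kernel t \<alpha> (Complex x (- pi)) = of_real (exp (- t * exp x)) * (v / cnj A)"
  proof -
    have "1 - (c + \<i> * s) / v = cnj A / v" using v by (simp add: A_def complex_eq_iff field_simps)
    then show ?thesis
      unfolding ml_kernel_def e2 exp_Complex_pi
      by (simp add: exp_of_real[symmetric])
  qed
  have "v / A - v / cnj A = v * (cnj A - A) / (A * cnj A)"
    using A by (simp add: field_simps)
  also have "cnj A - A = - 2 * \<i> * s" by (simp add: A_def complex_eq_iff)
  finally have "v / A - v / cnj A = - 2 * \<i> * of_real (s * v / (s\<^sup>2 + (v - c)\<^sup>2))"
    by (simp add: AA)
  moreover have "s * v / (s\<^sup>2 + (v - c)\<^sup>2) = pi * ml_density \<alpha> x"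
    by (simp add: ml_density_def s_def v_def c_def)
  ultimately have "v / A - v / cnj A = - 2 * \<i> * of_real (pi * ml_density \<alpha> x)"
    by (simp only:)
  then show ?thesis
    unfolding jump_def k1 k2 right_diff_distrib[symmetric] by simp
qed

text \<open>A primitive is arctan((e^(\<alpha>x) - cos(pi \<alpha>))/sin(pi \<alpha>))/(pi
  \<alpha>), and the arctangent runs from pi \<alpha> - pi/2 to pi/2.\<close>

lemma has_bochner_integral_ml_density:
  assumes \<alpha>: "0 < \<alpha>" "\<alpha> < 1"
  shows "has_bochner_integral lborel (ml_density \<alpha>) (1 / \<alpha> - 1)"
proof -
  define c where "c = cos (pi * \<alpha>)"
  define s where "s = sin (pi * \<alpha>)"
  have s: "s > 0" using sin_pi_pos[OF \<alpha>] by (simp add: s_def)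
  let ?F = "\<lambda>x. arctan ((exp (\<alpha> * x) - c) / s) / (pi * \<alpha>)"
  have d: "DERIV ?F x :> ml_density \<alpha> x" for x
  proof -
    have "DERIV ?F x :> (exp (\<alpha> * x) * \<alpha> / s) * inverse (1 + ((exp (\<alpha> * x) - c) / s)\<^sup>2) / (pi * \<alpha>)"
    proof (rule DERIV_cdivide)
      have "DERIV (\<lambda>x. (exp (\<alpha> * x) - c) / s) x :> exp (\<alpha> * x) * \<alpha> / s"
        using s by (auto intro!: derivative_eq_intros)
      from DERIV_chain2[OF DERIV_arctan this]
      show "DERIV (\<lambda>x. arctan ((exp (\<alpha> * x) - c) / s)) x :>
        (exp (\<alpha> * x) * \<alpha> / s) * inverse (1 + ((exp (\<alpha> * x) - c) / s)\<^sup>2)"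
        by (simp only: mult.commute)
    qed
    moreover have "1 + ((exp (\<alpha> * x) - c) / s)\<^sup>2 = (s\<^sup>2 + (exp (\<alpha> * x) - c)\<^sup>2) / s\<^sup>2"
      using s by (simp add: field_simps)
    moreover have "(exp (\<alpha> * x) * \<alpha> / s) * inverse ((s\<^sup>2 + (exp (\<alpha> * x) - c)\<^sup>2) / s\<^sup>2) / (pi * \<alpha>) = ml_density \<alpha> x"
    proof -
      have "(e * \<alpha> / s) * inverse (q / s\<^sup>2) / (pi * \<alpha>) = s / pi * e / q" if "0 < q" for e q :: real
        using that s \<alpha> by (simp add: field_simps power2_eq_square)
      from this[of "s\<^sup>2 + (exp (\<alpha> * x) - c)\<^sup>2" "exp (\<alpha> * x)"] show ?thesis
        using ml_density_denominator[OF \<alpha>, of x] by (simp add: ml_density_def c_def s_def)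
    qed
    ultimately show ?thesis by (simp only:)
  qed
  have cd: "isCont (ml_density \<alpha>) x" for x
    unfolding ml_density_def[abs_def] using ml_density_denominator[OF \<alpha>, of x]
    by (intro continuous_intros) auto
  have top: "((?F \<circ> real_of_ereal) \<longlongrightarrow> (pi / 2) / (pi * \<alpha>)) (at_left \<infinity>)"
  proof -
    have "filterlim (\<lambda>x. (exp (\<alpha> * x) - c) / s) at_top at_top" using \<alpha> s by real_asymp
    then have "((\<lambda>x. arctan ((exp (\<alpha> * x) - c) / s)) \<longlongrightarrow> pi / 2) at_top"
      by (rule filterlim_compose[OF tendsto_arctan_at_top])
    then have "(?F \<longlongrightarrow> (pi / 2) / (pi * \<alpha>)) at_top"
      by (rule tendsto_divide) (use \<alpha> in auto)
    then show ?thesis by (simp add: ereal_tendsto_simps)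
  qed
  have bot: "((?F \<circ> real_of_ereal) \<longlongrightarrow> (pi * \<alpha> - pi / 2) / (pi * \<alpha>)) (at_right (- \<infinity>))"
  proof -
    \<comment> \<open>Here -cot(pi \<alpha>) = tan(pi \<alpha> - pi/2), and 0 < \<alpha> < 1 puts
      this angle on the principal branch.\<close>
    have "arctan (- c / s) = pi * \<alpha> - pi / 2"
    proof (rule arctan_unique)
      have "pi * \<alpha> < pi * 1" using \<alpha> by (intro mult_strict_left_mono) auto
      then show "- (pi / 2) < pi * \<alpha> - pi / 2" "pi * \<alpha> - pi / 2 < pi / 2" using \<alpha> by auto
      show "tan (pi * \<alpha> - pi / 2) = - c / s"
        by (simp add: tan_def sin_diff cos_diff c_def s_def)
    qed
    moreover have "((\<lambda>x. arctan ((exp (\<alpha> * x) - c) / s)) \<longlongrightarrow> arctan ((0 - c) / s)) at_bot"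
    proof (intro tendsto_intros)
      show "((\<lambda>x. exp (\<alpha> * x)) \<longlongrightarrow> 0) at_bot" using \<alpha> by real_asymp
    qed (use s in auto)
    ultimately have "((\<lambda>x. arctan ((exp (\<alpha> * x) - c) / s)) \<longlongrightarrow> pi * \<alpha> - pi / 2) at_bot" by simp
    then have "(?F \<longlongrightarrow> (pi * \<alpha> - pi / 2) / (pi * \<alpha>)) at_bot"
      by (rule tendsto_divide) (use \<alpha> in auto)
    then show ?thesis by (simp add: ereal_tendsto_simps)
  qed
  have lt: "- \<infinity> < (\<infinity>::ereal)" by simp
  have nn: "AE x in lborel. - \<infinity> < ereal x \<longrightarrow> ereal x < \<infinity> \<longrightarrow> 0 \<le> ml_density \<alpha> x"
    using ml_density_nonneg[OF \<alpha>] by simp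
  note FTC = interval_integral_FTC_nonneg[OF lt d cd nn bot top]
  have "integrable lborel (ml_density \<alpha>)"
    using FTC(1) by (simp add: set_integrable_def einterval_def)
  moreover have "integral\<^sup>L lborel (ml_density \<alpha>) = (pi / 2) / (pi * \<alpha>) - (pi * \<alpha> - pi / 2) / (pi * \<alpha>)"
    using FTC(2) by (simp add: interval_lebesgue_integral_def set_lebesgue_integral_def einterval_def)
  moreover have "(pi / 2) / (pi * \<alpha>) - (pi * \<alpha> - pi / 2) / (pi * \<alpha>) = 1 / \<alpha> - 1"
    using \<alpha> by (simp add: field_simps)
  ultimately show ?thesis by (simp add: has_bochner_integral_iff)
qed

text \<open>In r = e^x this is the Laplace transform of a finite positive measure, so its modulus on
  Re w \<ge> 0 is at most the total mass.\<close>

definition ml_laplace :: "real \<Rightarrow> complex \<Rightarrow> complex" where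
  "ml_laplace \<alpha> w = (LINT x|lborel. exp (- w * of_real (exp x)) * of_real (ml_density \<alpha> x))"

lemma norm_ml_integrand:
  assumes "0 < \<alpha>" "\<alpha> < 1" "0 \<le> Re w"
  shows "norm (exp (- w * of_real (exp x)) * of_real (ml_density \<alpha> x)) \<le> ml_density \<alpha> x"
proof -
  have "norm (exp (- w * of_real (exp x))) \<le> 1" using assms by simp
  from mult_right_mono[OF this ml_density_nonneg[OF assms(1,2), of x]] show ?thesis
    using ml_density_nonneg[OF assms(1,2), of x] by (simp add: norm_mult)
qed

lemma integrable_ml_laplace:
  assumes "0 < \<alpha>" "\<alpha> < 1" "0 \<le> Re w"
  shows "integrable lborel (\<lambda>x. exp (- w * of_real (exp x)) * of_real (ml_density \<alpha> x))"
proof (rule Bochner_Integration.integrable_bound)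
  show i: "integrable lborel (ml_density \<alpha>)"
    using has_bochner_integral_ml_density[OF assms(1,2)] by (simp add: has_bochner_integral_iff)
  have [measurable]: "ml_density \<alpha> \<in> borel_measurable borel"
    using borel_measurable_integrable[OF i] by simp
  show "(\<lambda>x. exp (- w * of_real (exp x)) * of_real (ml_density \<alpha> x)) \<in> borel_measurable lborel"
    by measurable
  show "AE x in lborel. norm (exp (- w * of_real (exp x)) * of_real (ml_density \<alpha> x)) \<le> norm (ml_density \<alpha> x)"
    using norm_ml_integrand[OF assms] ml_density_nonneg[OF assms(1,2)] by simp
qed

lemma norm_ml_laplace_le:
  assumes "0 < \<alpha>" "\<alpha> < 1" "0 \<le> Re w"
  shows "norm (ml_laplace \<alpha> w) \<le> 1 / \<alpha> - 1"
proof -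
  have "norm (ml_laplace \<alpha> w) \<le> (LINT x|lborel. norm (exp (- w * of_real (exp x)) * of_real (ml_density \<alpha> x)))"
    unfolding ml_laplace_def by (rule integral_norm_bound)
  also have "\<dots> \<le> integral\<^sup>L lborel (ml_density \<alpha>)"
    using has_bochner_integral_ml_density[OF assms(1,2)]
    by (intro integral_mono integrable_norm integrable_ml_laplace assms norm_ml_integrand)
       (simp add: has_bochner_integral_iff)
  also have "\<dots> = 1 / \<alpha> - 1"
    using has_bochner_integral_ml_density[OF assms(1,2)] by (simp add: has_bochner_integral_iff)
  finally show ?thesis .
qed

text \<open>After the collapse three contributions remain: the pole gives the exponential, the cut
  gives minus the Laplace transform of the density, and the small circle gives 0.\<close>

lemma hankel_ml_kernel:
  assumes \<alpha>: "0 < \<alpha>" "\<alpha> < 1" and t: "0 < t" and b: "0 < b"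
  shows "hankel (ml_kernel t \<alpha>) b = 2 * pi * \<i> * (of_real (exp t / \<alpha>) - ml_laplace \<alpha> (of_real t))"
proof -
  have j: "jump (ml_kernel t \<alpha>) = (\<lambda>x. - 2 * pi * \<i> *
      (exp (- of_real t * of_real (exp x)) * of_real (ml_density \<alpha> x)))"
    by (simp add: jump_ml_kernel[OF \<alpha>] fun_eq_iff exp_of_real[symmetric] mult_ac)
  have hol: "ml_kernel t \<alpha> holomorphic_on strip - {0}" by (rule holomorphic_ml_kernel[OF \<alpha>])
  have int: "integrable lborel (\<lambda>x. exp (- of_real t * of_real (exp x)) * complex_of_real (ml_density \<alpha> x))"
    using integrable_ml_laplace[OF \<alpha>, of "of_real t"] t by simp
  have "(vert (ml_kernel t \<alpha>) \<longlongrightarrow> 2 * pi * \<i> * 0) at_bot"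
  proof (rule vert_tendsto)
    fix x :: real assume x: "x < 0"
    show "continuous_on {-pi..pi} (\<lambda>y. ml_kernel t \<alpha> (Complex x y))"
    proof (rule continuous_on_compose2[OF holomorphic_on_imp_continuous_on[OF hol], where f = "\<lambda>y. Complex x y"])
      show "continuous_on {-pi..pi} (\<lambda>y. Complex x y)"
        by (intro continuous_on_Complex continuous_on_id continuous_on_const)
      show "(\<lambda>y. Complex x y) ` {-pi..pi} \<subseteq> strip - {0}"
        using x pi_less_4 by (auto simp: strip_def complex_eq_iff)
    qed
    fix y :: real
    \<comment> \<open>Far to the left e^(-\<alpha>\<zeta>) dominates the 1 in the denominator, which
      makes the kernel small on the whole segment.\<close>
    have p: "0 < exp (- (\<alpha> * x)) - 1" using x \<alpha> by (simp add: mult_pos_neg)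
    have "exp (- (\<alpha> * x)) - 1 = norm (exp (- (of_real \<alpha> * Complex x y))) - norm (1::complex)"
      by simp
    also have "\<dots> \<le> norm (exp (- (of_real \<alpha> * Complex x y)) - 1)" by (rule norm_triangle_ineq2)
    also have "\<dots> = norm (1 - exp (- (of_real \<alpha> * Complex x y)))" by (rule norm_minus_commute)
    finally have 1: "exp (- (\<alpha> * x)) - 1 \<le> norm (1 - exp (- (of_real \<alpha> * Complex x y)))" .
    have 2: "norm (exp (of_real t * exp (Complex x y))) \<le> exp (t * exp x)"
      using t mult_left_mono[of "exp x * cos y" "exp x" t] by (simp add: Re_exp)
    show "norm (ml_kernel t \<alpha> (Complex x y) - 0) \<le> exp (t * exp x) / (exp (- (\<alpha> * x)) - 1)"
      unfolding ml_kernel_def diff_zero norm_divide using 1 2 p by (intro frac_le) auto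
  next
    have "((\<lambda>x. exp (t * exp x) / (exp ((- \<alpha>) * x) - 1)) \<longlongrightarrow> 0) at_bot"
      using \<alpha> t by real_asymp
    then show "((\<lambda>x. exp (t * exp x) / (exp (- (\<alpha> * x)) - 1)) \<longlongrightarrow> 0) at_bot" by simp
  qed
  then have "hankel (ml_kernel t \<alpha>) b = integral\<^sup>L lborel (jump (ml_kernel t \<alpha>)) + 2 * pi * \<i> * 0
     + 2 * pi * \<i> * residue (ml_kernel t \<alpha>) 0"
    by (intro hankel_eq_limit hol b) (use int in \<open>simp add: j\<close>)
  also have "integral\<^sup>L lborel (jump (ml_kernel t \<alpha>)) = - 2 * pi * \<i> * ml_laplace \<alpha> (of_real t)"
    unfolding j ml_laplace_def by (rule integral_mult_right_zero)
  finally show ?thesis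
    by (simp add: residue_ml_kernel[OF \<alpha>] algebra_simps)
qed

text \<open>Away from the origin \<open>1 / (1 - e\<^bsup>-\<alpha>\<zeta>\<^esup>)\<close> is a geometric series, whose terms have the Hankel
  integrals \<open>t\<^bsup>\<alpha>k\<^esup> / \<Gamma>(\<alpha>k + 1)\<close>.\<close>

lemma mittag_leffler_eq_hankel:
  assumes \<alpha>: "0 < \<alpha>" "\<alpha> < 1" and t: "0 < t"
  shows "hankel (ml_kernel t \<alpha>) 1 = 2 * pi * \<i> * mittag_leffler \<alpha> (of_real (t powr \<alpha>))"
proof -
  \<comment> \<open>\<open>r N\<close> is the remainder of the geometric series after N terms, times
    e^(ts).\<close>
  define r where "r N \<zeta> = exp (- (of_real (\<alpha> * real N) * \<zeta>)) * ml_kernel t \<alpha> \<zeta>" for N \<zeta>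
  \<comment> \<open>For Re \<zeta> \<ge> 1 one has |e^(-\<alpha>N\<zeta>)| \<le> e^(-\<alpha>N) and
    |1 - e^(-\<alpha>\<zeta>)| \<ge> 1 - e^(-\<alpha>); this is why the contour is placed at
    1.\<close>
  define K where "K N = exp (- (\<alpha> * real N)) / (1 - exp (- \<alpha>))" for N
  have p: "0 < 1 - exp (- \<alpha>)" using \<alpha> by simp
  have adm: "admissible t 1 (r N) (K N)" for N
    unfolding admissible_def
  proof (intro conjI allI impI)
    show "r N holomorphic_on strip - {0}"
      unfolding r_def[abs_def] by (intro holomorphic_intros holomorphic_ml_kernel[OF \<alpha>])
    have bnd: "norm (r N (Complex x y)) \<le> K N * exp (t * (exp x * cos y))" if "1 \<le> x" for x y
    proof -
      have "\<alpha> * 1 \<le> \<alpha> * x" using that \<alpha> by (intro mult_left_mono) auto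
      then have "1 - exp (- \<alpha>) \<le> norm (1::complex) - norm (exp (- (of_real \<alpha> * Complex x y)))"
        by simp
      also have "\<dots> \<le> norm (1 - exp (- (of_real \<alpha> * Complex x y)))" by (rule norm_triangle_ineq2)
      finally have 1: "1 - exp (- \<alpha>) \<le> norm (1 - exp (- (of_real \<alpha> * Complex x y)))" .
      have "\<alpha> * real N * 1 \<le> \<alpha> * real N * x" using that \<alpha> by (intro mult_left_mono) auto
      then have 2: "norm (exp (- (of_real (\<alpha> * real N) * Complex x y))) \<le> exp (- (\<alpha> * real N))"
        by simp
      have "norm (r N (Complex x y)) = norm (exp (- (of_real (\<alpha> * real N) * Complex x y))) *
          (exp (t * (exp x * cos y)) / norm (1 - exp (- (of_real \<alpha> * Complex x y))))"
        by (simp add: r_def ml_kernel_def norm_mult norm_divide Re_exp)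
      also have "\<dots> \<le> exp (- (\<alpha> * real N)) * (exp (t * (exp x * cos y)) / (1 - exp (- \<alpha>)))"
        using 1 2 p by (intro mult_mono frac_le) (auto intro!: divide_nonneg_nonneg)
      finally show ?thesis by (simp add: K_def)
    qed
    have K: "0 \<le> K N" using p by (simp add: K_def)
    show "norm (r N (Complex x pi)) \<le> K N * exp (x - t * exp x)"
      "norm (r N (Complex x (- pi))) \<le> K N * exp (x - t * exp x)" if "1 \<le> x" for x
      using bnd[of x pi] bnd[of x "- pi"] that mult_left_mono[OF _ K, of "exp (- (t * exp x))" "exp (x - t * exp x)"]
      by (auto intro: order_trans)
    fix y :: real
    have "t * (exp 1 * cos y) \<le> t * (exp 1 * 1)"
      using t by (intro mult_left_mono) auto
    then have "K N * exp (t * (exp 1 * cos y)) \<le> K N * exp (1 + t * exp 1)"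
      by (intro mult_left_mono K) auto
    then show "norm (r N (Complex 1 y)) \<le> K N * exp (1 + t * exp 1)"
      using bnd[of 1 y] by simp
  qed
  have step: "hankel (r (Suc N)) 1 = hankel (r N) 1 - hankel (pow_kernel t (\<alpha> * real N)) 1" for N
  proof -
    have eq: "r (Suc N) \<zeta> = r N \<zeta> - pow_kernel t (\<alpha> * real N) \<zeta>" if "\<zeta> \<in> strip - {0}" for \<zeta>
    proof -
      have "r (Suc N) \<zeta> = exp (- (of_real (\<alpha> * real N) * \<zeta>)) * exp (- (of_real \<alpha> * \<zeta>)) * ml_kernel t \<alpha> \<zeta>"
        by (simp add: r_def exp_add[symmetric] algebra_simps)
      moreover have "exp (- (of_real \<alpha> * \<zeta>)) * ml_kernel t \<alpha> \<zeta> = ml_kernel t \<alpha> \<zeta> - exp (of_real t * exp \<zeta>)"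
        using ml_kernel_denominator[OF \<alpha> that] by (simp add: ml_kernel_def field_simps)
      moreover have "exp (- (of_real (\<alpha> * real N) * \<zeta>)) * exp (of_real t * exp \<zeta>) = pow_kernel t (\<alpha> * real N) \<zeta>"
        by (simp add: pow_kernel_def exp_add[symmetric])
      ultimately show ?thesis by (simp add: r_def right_diff_distrib mult.assoc)
    qed
    have "hankel (r (Suc N)) 1 = hankel (\<lambda>\<zeta>. r N \<zeta> - pow_kernel t (\<alpha> * real N) \<zeta>) 1"
    proof -
      have m: "Complex x y \<in> strip - {0}" if "1 \<le> x" "\<bar>y\<bar> \<le> pi" for x y
        using that pi_less_4 by (auto simp: strip_def complex_eq_iff)
      have "(LINT s:{1..}|lborel. jump (r (Suc N)) s) =
         (LINT s:{1..}|lborel. jump (\<lambda>\<zeta>. r N \<zeta> - pow_kernel t (\<alpha> * real N) \<zeta>) s)"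
        by (intro set_lebesgue_integral_cong) (auto simp: jump_def eq[OF m])
      moreover have "vert (r (Suc N)) 1 = vert (\<lambda>\<zeta>. r N \<zeta> - pow_kernel t (\<alpha> * real N) \<zeta>) 1"
        unfolding vert_def by (intro arg_cong2[where f = "(*)"] integral_cong refl eq m) auto
      ultimately show ?thesis by (simp add: hankel_def)
    qed
    also have "\<dots> = hankel (r N) 1 - hankel (pow_kernel t (\<alpha> * real N)) 1"
      using \<alpha> by (intro hankel_diff[OF t _ adm admissible_pow_kernel]) (auto intro: t order_trans[of _ 0])
    finally show ?thesis .
  qed
  let ?J = "\<lambda>k. hankel (pow_kernel t (\<alpha> * real k)) 1"
  have r0: "r 0 = ml_kernel t \<alpha>" by (simp add: r_def fun_eq_iff)
  have partial: "hankel (ml_kernel t \<alpha>) 1 - (\<Sum>k<N. ?J k) = hankel (r N) 1" for N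
    by (induction N) (simp_all add: r0 step algebra_simps)
  have "(\<lambda>N. hankel (r N) 1) \<longlonglongrightarrow> 0"
  proof (rule Lim_null_comparison)
    let ?B = "2 * (LINT x|lborel. exp (x - t * exp x)) + 2 * pi * exp (1 + t * exp 1)"
    show "\<forall>\<^sub>F N in sequentially. norm (hankel (r N) 1) \<le> K N * ?B"
      by (intro always_eventually allI hankel_bound[OF t _ adm]) simp
    have "(\<lambda>N. exp (- (\<alpha> * real N))) \<longlonglongrightarrow> 0" using \<alpha> by real_asymp
    then have "(\<lambda>N. exp (- (\<alpha> * real N)) / (1 - exp (- \<alpha>)) * ?B) \<longlonglongrightarrow> 0 / (1 - exp (- \<alpha>)) * ?B"
      using p by (intro tendsto_intros) auto
    then show "(\<lambda>N. K N * ?B) \<longlonglongrightarrow> 0" by (simp add: K_def)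
  qed
  then have "(\<lambda>N. hankel (ml_kernel t \<alpha>) 1 - (\<Sum>k<N. ?J k)) \<longlonglongrightarrow> 0"
    by (simp add: partial)
  then have "(\<lambda>k. ?J k) sums hankel (ml_kernel t \<alpha>) 1"
    unfolding sums_def using tendsto_diff[OF tendsto_const[of "hankel (ml_kernel t \<alpha>) 1"]] by fastforce
  moreover have "(\<lambda>k. ?J k) sums (2 * pi * \<i> * mittag_leffler \<alpha> (of_real (t powr \<alpha>)))"
  proof -
    have "?J k =
        2 * pi * \<i> * (of_real (t powr \<alpha>) ^ k / of_real (Gamma (\<alpha> * real k + 1)))" for k
    proof -
      have "t powr (\<alpha> * real k) = (t powr \<alpha>) ^ k"
        using t by (simp add: powr_realpow[symmetric] powr_powr)
      then show ?thesis using \<alpha> by (subst hankel_pow_kernel[OF t]) simp_all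
    qed
    then show ?thesis using sums_mult[OF mittag_leffler_sums[OF \<alpha>]] by simp
  qed
  ultimately show ?thesis by (rule sums_unique2)
qed

text \<open>Two evaluations of one contour integral: expanded into a series at Re \<zeta> \<ge> 1,
  and collapsed onto the cut.\<close>

lemma mittag_leffler_eq_laplace:
  assumes "0 < \<alpha>" "\<alpha> < 1" "0 < t"
  shows "mittag_leffler \<alpha> (of_real (t powr \<alpha>)) = exp (of_real t) / of_real \<alpha> - ml_laplace \<alpha> (of_real t)"
  using mittag_leffler_eq_hankel[OF assms] hankel_ml_kernel[OF assms, of 1]
  by (simp add: exp_of_real)

section \<open>Continuation from the positive axis to the right half-plane\<close>

text \<open>Truncation to [-n, n] gives holomorphic functions by differentiation under the integral.
  The error is at most the mass of the density outside [-n, n], whatever w is, so the convergence is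
  uniform on the half-plane.\<close>

lemma holomorphic_ml_laplace:
  assumes \<alpha>: "0 < \<alpha>" "\<alpha> < 1"
  shows "ml_laplace \<alpha> holomorphic_on {w. 0 < Re w}"
proof -
  define S where "S = {w::complex. 0 < Re w}"
  have opS: "open S" unfolding S_def by (rule open_halfspace_Re_gt)
  define h where "h w x = exp (- w * of_real (exp x)) * of_real (ml_density \<alpha> x)" for w :: complex and x
  define f where "f n w = integral (cbox (- real n) (real n)) (h w)" for n w
  have cd: "continuous_on A (ml_density \<alpha>)" for A
    unfolding ml_density_def[abs_def]
    by (intro continuous_intros ballI) (use ml_density_denominator[OF \<alpha>] in \<open>auto simp: less_le\<close>)
  have ch: "continuous_on A (h w)" for w A
    unfolding h_def[abs_def] by (intro continuous_intros cd)
  have hol: "f n holomorphic_on S" for n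
    unfolding f_def
  proof (rule leibniz_rule_holomorphic)
    let ?h' = "\<lambda>w x. - of_real (exp x) * exp (- w * of_real (exp x)) * complex_of_real (ml_density \<alpha> x)"
    show "((\<lambda>w. h w x) has_field_derivative ?h' w x) (at w within S)" for w x
      unfolding h_def by (auto intro!: derivative_eq_intros)
    show "h w integrable_on cbox (- real n) (real n)" for w
      by (intro integrable_continuous ch)
    have "continuous_on (S \<times> cbox (- real n) (real n)) (\<lambda>z. ml_density \<alpha> (snd z))"
      by (rule continuous_on_compose2[OF cd[of UNIV] continuous_on_snd[OF continuous_on_id]]) auto
    then show "continuous_on (S \<times> cbox (- real n) (real n)) (\<lambda>(w, x). ?h' w x)"
      unfolding case_prod_beta by (intro continuous_intros)
    show "convex S" unfolding S_def by (rule convex_halfspace_Re_gt)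
  qed
  define tail where "tail n = (LINT x|lborel. indicat_real (- {- real n..real n}) x * ml_density \<alpha> x)" for n
  have di: "integrable lborel (ml_density \<alpha>)"
    using has_bochner_integral_ml_density[OF \<alpha>] by (simp add: has_bochner_integral_iff)
  have [measurable]: "ml_density \<alpha> \<in> borel_measurable borel"
    using borel_measurable_integrable[OF di] by simp
  have "tail \<longlonglongrightarrow> integral\<^sup>L lborel (\<lambda>x::real. 0 :: real)"
    unfolding tail_def
  proof (rule integral_dominated_convergence[where w = "ml_density \<alpha>"])
    show "AE x in lborel. (\<lambda>n. indicat_real (- {- real n..real n}) x * ml_density \<alpha> x) \<longlonglongrightarrow> 0"
    proof (intro AE_I2 tendsto_eventually)
      fix x :: real
      obtain N where "\<bar>x\<bar> \<le> real N" using real_arch_simple by blast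
      then show "\<forall>\<^sub>F n in sequentially. indicat_real (- {- real n..real n}) x * ml_density \<alpha> x = 0"
        by (intro eventually_sequentiallyI[of N]) (auto simp: indicator_def)
    qed
    show "AE x in lborel. norm (indicat_real (- {- real n..real n}) x * ml_density \<alpha> x) \<le> ml_density \<alpha> x" for n
      using ml_density_nonneg[OF \<alpha>] by (auto simp: indicator_def)
    show "integrable lborel (ml_density \<alpha>)" by (rule di)
  qed measurable
  then have tail: "tail \<longlonglongrightarrow> 0" by simp
  have bound: "norm (f n w - ml_laplace \<alpha> w) \<le> tail n" if "w \<in> S" for n w
  proof -
    have w: "0 \<le> Re w" using that by (simp add: S_def)
    have ih: "integrable lborel (h w)"
      unfolding h_def by (rule integrable_ml_laplace[OF \<alpha> w])
    have ish: "set_integrable lborel {- real n..real n} (h w)"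
      using ih unfolding set_integrable_def by (intro integrable_mult_indicator) auto
    have "f n w = (LINT x|lborel. indicat_real {- real n..real n} x *\<^sub>R h w x)"
      unfolding f_def using set_borel_integral_eq_integral(2)[OF ish]
      by (simp add: set_lebesgue_integral_def)
    then have "ml_laplace \<alpha> w - f n w = (LINT x|lborel. h w x - indicat_real {- real n..real n} x *\<^sub>R h w x)"
      using ish ih unfolding set_integrable_def ml_laplace_def h_def by simp
    also have "\<dots> = (LINT x|lborel. indicat_real (- {- real n..real n}) x *\<^sub>R h w x)"
      by (intro Bochner_Integration.integral_cong) (auto simp: indicator_def)
    also have "norm \<dots> \<le> (LINT x|lborel. norm (indicat_real (- {- real n..real n}) x *\<^sub>R h w x))"
      by (rule integral_norm_bound)
    also have "\<dots> \<le> tail n"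
      unfolding tail_def
    proof (rule integral_mono)
      show "integrable lborel (\<lambda>x. norm (indicat_real (- {- real n..real n}) x *\<^sub>R h w x))"
        using ih by (intro integrable_norm integrable_mult_indicator) auto
      show "integrable lborel (\<lambda>x. indicat_real (- {- real n..real n}) x * ml_density \<alpha> x)"
        using integrable_mult_indicator[OF _ di, of "- {- real n..real n}"] by simp
      show "norm (indicat_real (- {- real n..real n}) x *\<^sub>R h w x)
          \<le> indicat_real (- {- real n..real n}) x * ml_density \<alpha> x" for x
        using norm_ml_integrand[OF \<alpha> w, of x] by (simp add: h_def indicator_def)
    qed
    finally show ?thesis by (simp add: norm_minus_commute)
  qed
  have unif: "uniform_limit S f (ml_laplace \<alpha>) sequentially"
  proof (rule uniform_limitI)
    fix e :: real assume "0 < e"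
    with tail have "\<forall>\<^sub>F n in sequentially. tail n < e" by (rule order_tendstoD)
    then show "\<forall>\<^sub>F n in sequentially. \<forall>w\<in>S. dist (f n w) (ml_laplace \<alpha> w) < e"
      by eventually_elim (use bound in \<open>auto simp: dist_norm intro: le_less_trans\<close>)
  qed
  have "ml_laplace \<alpha> holomorphic_on S"
  proof (rule holomorphic_uniform_sequence[OF opS hol])
    fix w assume "w \<in> S"
    with opS obtain d where "0 < d" "cball w d \<subseteq> S" using open_contains_cball by blast
    then show "\<exists>d>0. cball w d \<subseteq> S \<and> uniform_limit (cball w d) f (ml_laplace \<alpha>) sequentially"
      using uniform_limit_on_subset[OF unif] by blast
  qed
  then show ?thesis by (simp add: S_def)
qed

text \<open>Both sides are holomorphic on the right half-plane, where the principal power has no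
  cut, and they agree on the positive axis, which accumulates at 1.\<close>

lemma mittag_leffler_eq_laplace_complex:
  assumes \<alpha>: "0 < \<alpha>" "\<alpha> < 1" and w: "0 < Re w"
  shows "mittag_leffler \<alpha> (w powr of_real \<alpha>) = exp w / of_real \<alpha> - ml_laplace \<alpha> w"
proof -
  define S where "S = {w::complex. 0 < Re w}"
  define d where "d w = mittag_leffler \<alpha> (w powr of_real \<alpha>) - (exp w / of_real \<alpha> - ml_laplace \<alpha> w)" for w
  have opS: "open S" unfolding S_def by (rule open_halfspace_Re_gt)
  have np: "z \<notin> \<real>\<^sub>\<le>\<^sub>0" if "z \<in> S" for z
    using that by (auto simp: S_def complex_nonpos_Reals_iff)
  have hol: "d holomorphic_on S"
    unfolding d_def[abs_def]
  proof (intro holomorphic_intros)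
    have "(mittag_leffler \<alpha> \<circ> (\<lambda>w. w powr of_real \<alpha>)) holomorphic_on S"
      by (rule holomorphic_on_compose_gen[where t = UNIV])
         (auto intro!: holomorphic_intros holomorphic_mittag_leffler[OF \<alpha>] np)
    then show "(\<lambda>w. mittag_leffler \<alpha> (w powr of_real \<alpha>)) holomorphic_on S" by (simp add: o_def)
    show "ml_laplace \<alpha> holomorphic_on S" unfolding S_def by (rule holomorphic_ml_laplace[OF \<alpha>])
  qed (use \<alpha> in auto)
  define U where "U = complex_of_real ` {0<..}"
  have "d w = 0"
  proof (rule analytic_continuation[OF hol opS, of U 1])
    show "connected S" unfolding S_def by (intro convex_connected convex_halfspace_Re_gt)
    show "U \<subseteq> S" by (auto simp: U_def S_def)
    show "(1::complex) \<in> S" by (simp add: S_def)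
    show "w \<in> S" using w by (simp add: S_def)
    show "1 islimpt U"
      unfolding islimpt_approachable
    proof (intro allI impI)
      fix e :: real assume e: "0 < e"
      have "of_real (1 + e / 2) \<in> U" unfolding U_def using e by (intro imageI) simp
      moreover have "of_real (1 + e / 2) \<noteq> (1::complex)" "dist (of_real (1 + e / 2)) (1::complex) < e"
        using e by (simp_all add: dist_norm norm_divide)
      ultimately show "\<exists>x'\<in>U. x' \<noteq> 1 \<and> dist x' 1 < e" by blast
    qed
    show "d z = 0" if "z \<in> U" for z
    proof -
      obtain t where t: "z = of_real t" "0 < t" using \<open>z \<in> U\<close> by (auto simp: U_def)
      have "z powr of_real \<alpha> = of_real (t powr \<alpha>)" using t by (simp add: powr_of_real)
      then show ?thesis
        using mittag_leffler_eq_laplace[OF \<alpha> t(2)] by (simp add: d_def t(1))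
    qed
  qed
  then show ?thesis by (simp add: d_def)
qed

section \<open>Two-sided bounds on the ray of the multipliers\<close>

definition ray_dir :: "real \<Rightarrow> complex" where
  "ray_dir \<alpha> = exp (- (\<i> * of_real (pi * \<alpha> / 2)))"

text \<open>The representation is at hand only for Re w > 0, so the imaginary point is approached
  from the right. Along the approach the triangle inequality gives both bounds with e^(1/(n+1)) in
  place of 1.\<close>

lemma mittag_leffler_ray_bounds:
  assumes \<alpha>: "0 < \<alpha>" "\<alpha> < 1" and x: "0 \<le> x"
  shows "1 \<le> norm (mittag_leffler \<alpha> (ray_dir \<alpha> * of_real x))"
    and "norm (mittag_leffler \<alpha> (ray_dir \<alpha> * of_real x)) \<le> 2 / \<alpha> - 1"
proof -
  let ?N = "norm (mittag_leffler \<alpha> (ray_dir \<alpha> * of_real x))"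
  have "1 \<le> ?N \<and>
    ?N \<le> 2 / \<alpha> - 1"
  proof (cases "x = 0")
    case True
    have "1 \<le> 1 / \<alpha>" using \<alpha> by simp
    then have "1 \<le> 2 / \<alpha> - 1" by simp
    with True show ?thesis by simp
  next
    case False
    \<comment> \<open>With this \<tau> the point -i\<tau> has principal \<alpha>-th power
      i^(-\<alpha>) x. It is off the branch cut, so the power is continuous there; x = 0 was split
      off because it would give the branch point.\<close>
    define \<tau> where "\<tau> = x powr (1 / \<alpha>)"
    have \<tau>: "0 < \<tau>" using False x by (simp add: \<tau>_def)
    define w0 where "w0 = - \<i> * of_real \<tau>"
    define w where "w n = w0 + of_real (1 / real (Suc n))" for n
    have np: "w0 \<notin> \<real>\<^sub>\<le>\<^sub>0" using \<tau> by (simp add: w0_def complex_nonpos_Reals_iff)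
    have "(\<lambda>n. 1 / real (Suc n)) \<longlonglongrightarrow> 0" by real_asymp
    then have wlim: "w \<longlonglongrightarrow> w0 + of_real 0"
      unfolding w_def[abs_def] by (intro tendsto_add tendsto_const tendsto_of_real)
    have "Ln w0 = of_real (ln \<tau>) - \<i> * of_real (pi / 2)"
    proof (rule Ln_unique)
      show "exp (of_real (ln \<tau>) - \<i> * of_real (pi / 2)) = w0"
        using \<tau> by (simp add: w0_def exp_diff exp_of_real field_simps) (simp add: exp_eq_polar complex_eq_iff)
    qed (simp_all, use pi_gt_zero in linarith)
    then have "w0 powr of_real \<alpha> = exp (of_real \<alpha> * (of_real (ln \<tau>) - \<i> * of_real (pi / 2)))"
      using \<tau> by (simp add: powr_def w0_def)
    also have "\<dots> = exp (of_real (\<alpha> * ln \<tau>)) * ray_dir \<alpha>"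
      by (simp add: ray_dir_def exp_add[symmetric] algebra_simps)
    also have "exp (of_real (\<alpha> * ln \<tau>)) = complex_of_real x"
      using False x \<alpha> by (simp add: exp_of_real \<tau>_def ln_powr)
    finally have w0p: "w0 powr of_real \<alpha> = ray_dir \<alpha> * of_real x" by (simp add: mult.commute)
    have lim: "(\<lambda>n. norm (mittag_leffler \<alpha> (w n powr of_real \<alpha>)))
       \<longlonglongrightarrow> ?N"
    proof -
      have "(\<lambda>n. w n powr of_real \<alpha>) \<longlonglongrightarrow> ray_dir \<alpha> * of_real x"
        unfolding w0p[symmetric] using wlim np by (intro tendsto_powr_complex) auto
      moreover have "isCont (mittag_leffler \<alpha>) z" for z
        using continuous_mittag_leffler[OF \<alpha>, of UNIV] by (simp add: continuous_on_eq_continuous_at)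
      ultimately show ?thesis
        by (intro tendsto_norm) (rule isCont_tendsto_compose)
    qed
    have lim2: "(\<lambda>n. exp (1 / real (Suc n))) \<longlonglongrightarrow> 1" by real_asymp
    have b: "exp (1 / real (Suc n)) / \<alpha> - (1 / \<alpha> - 1) \<le> norm (mittag_leffler \<alpha> (w n powr of_real \<alpha>))"
      "norm (mittag_leffler \<alpha> (w n powr of_real \<alpha>)) \<le> exp (1 / real (Suc n)) / \<alpha> + (1 / \<alpha> - 1)" for n
    proof -
      have r: "0 < Re (w n)" by (simp add: w_def w0_def)
      have e: "norm (exp (w n) / of_real \<alpha>) = exp (1 / real (Suc n)) / \<alpha>"
        using \<alpha> by (simp add: norm_divide w_def w0_def)
      have l: "norm (ml_laplace \<alpha> (w n)) \<le> 1 / \<alpha> - 1"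
        using r by (intro norm_ml_laplace_le \<alpha>) simp
      show "exp (1 / real (Suc n)) / \<alpha> - (1 / \<alpha> - 1) \<le> norm (mittag_leffler \<alpha> (w n powr of_real \<alpha>))"
        using norm_triangle_ineq2[of "exp (w n) / of_real \<alpha>" "ml_laplace \<alpha> (w n)"] e l
        unfolding mittag_leffler_eq_laplace_complex[OF \<alpha> r] by linarith
      show "norm (mittag_leffler \<alpha> (w n powr of_real \<alpha>)) \<le> exp (1 / real (Suc n)) / \<alpha> + (1 / \<alpha> - 1)"
        using norm_triangle_ineq4[of "exp (w n) / of_real \<alpha>" "ml_laplace \<alpha> (w n)"] e l
        unfolding mittag_leffler_eq_laplace_complex[OF \<alpha> r] by linarith
    qed
    have l1: "(\<lambda>n. exp (1 / real (Suc n)) / \<alpha> - (1 / \<alpha> - 1)) \<longlonglongrightarrow> 1 / \<alpha> - (1 / \<alpha> - 1)"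
      and l2: "(\<lambda>n. exp (1 / real (Suc n)) / \<alpha> + (1 / \<alpha> - 1)) \<longlonglongrightarrow> 1 / \<alpha> + (1 / \<alpha> - 1)"
      using \<alpha> by (intro tendsto_intros lim2; simp)+
    have "1 / \<alpha> - (1 / \<alpha> - 1) \<le> ?N"
      by (rule LIMSEQ_le[OF l1 lim]) (use b(1) in blast)
    moreover have "?N \<le> 1 / \<alpha> + (1 / \<alpha> - 1)"
      by (rule LIMSEQ_le[OF lim l2]) (use b(2) in blast)
    ultimately show ?thesis by (simp add: field_simps)
  qed
  then show "1 \<le> ?N"
    and "?N \<le> 2 / \<alpha> - 1" by auto
qed

section \<open>Absolutely continuous functions\<close>

text \<open>Used twice: U is the range of a truncated power function, and later an open set around a
  null set.\<close>

lemma disjoint_sum_le: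
  fixes a b :: "nat \<Rightarrow> real"
  assumes disj: "\<And>i j. i < m \<Longrightarrow> j < m \<Longrightarrow> i \<noteq> j \<Longrightarrow> {a i<..<b i} \<inter> {a j<..<b j} = {}"
    and le: "\<And>i. i < m \<Longrightarrow> a i \<le> b i"
    and sub: "\<And>i. i < m \<Longrightarrow> {a i<..<b i} \<subseteq> U" and U: "U \<in> lmeasurable"
  shows "(\<Sum>i<m. b i - a i) \<le> measure lebesgue U"
proof -
  have "measure lebesgue (\<Union>i\<in>{..<m}. {a i<..<b i}) = (\<Sum>i\<in>{..<m}. measure lebesgue {a i<..<b i})"
    by (rule measure_finite_Union) (use disj le in \<open>auto simp: disjoint_family_on_def\<close>)
  moreover have "(\<Sum>i\<in>{..<m}. measure lebesgue {a i<..<b i}) = (\<Sum>i<m. b i - a i)"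
    by (rule sum.cong) (use le in auto)
  moreover have "measure lebesgue (\<Union>i\<in>{..<m}. {a i<..<b i}) \<le> measure lebesgue U"
    by (rule measure_mono_fmeasurable) (use sub U in auto)
  ultimately show ?thesis by simp
qed

text \<open>The derivative \<alpha> u^(\<alpha>-1) is decreasing since \<alpha> < 1, so its value at
  \<eta> bounds it to the right of \<eta>.\<close>

lemma powr_diff_le:
  fixes \<alpha> \<eta> x y :: real
  assumes "0 < \<alpha>" "\<alpha> < 1" "0 < \<eta>" "\<eta> \<le> x" "x \<le> y"
  shows "y powr \<alpha> - x powr \<alpha> \<le> \<alpha> * \<eta> powr (\<alpha> - 1) * (y - x)"
proof (cases "x = y")
  case False
  then obtain z where z: "x < z" "z < y" "y powr \<alpha> - x powr \<alpha> = (y - x) * (\<alpha> * z powr (\<alpha> - 1))"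
    using MVT2[of x y "\<lambda>u. u powr \<alpha>" "\<lambda>u. \<alpha> * u powr (\<alpha> - 1)"] assms
    by (force intro!: derivative_eq_intros)
  have "z powr (\<alpha> - 1) \<le> \<eta> powr (\<alpha> - 1)"
    using assms z by (intro powr_mono2') auto
  then have "(y - x) * (\<alpha> * z powr (\<alpha> - 1)) \<le> (y - x) * (\<alpha> * \<eta> powr (\<alpha> - 1))"
    using assms by (intro mult_left_mono) auto
  with z(3) show ?thesis by (simp add: mult_ac)
qed simp

text \<open>Below the threshold \<open>\<eta>\<close> the total increment of \<open>s\<^sup>\<alpha>\<close> is at most \<open>\<eta>\<^sup>\<alpha>\<close>, above it the function is
  Lipschitz.\<close>

lemma absolutely_continuous_on_powr_comp:
  fixes G :: "real \<Rightarrow> complex"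
  assumes \<alpha>: "0 < \<alpha>" "\<alpha> < 1" and T: "0 \<le> T" and L: "0 < L"
    and lip: "\<And>x y. 0 \<le> x \<Longrightarrow> x \<le> y \<Longrightarrow> y \<le> T \<Longrightarrow> cmod (G y - G x) \<le> L * (y powr \<alpha> - x powr \<alpha>)"
  shows "absolutely_continuous_on 0 T G"
  unfolding absolutely_continuous_on_def
proof (intro allI impI)
  fix \<epsilon> :: real assume \<epsilon>: "0 < \<epsilon>"
  \<comment> \<open>\<eta> and \<delta> each take half of \<epsilon>: L \<eta>^\<alpha> =
    \<epsilon>/2 for the part below the threshold, and L times the Lipschitz constant times \<delta>
    is \<epsilon>/2 above it.\<close>
  define \<eta> where "\<eta> = (\<epsilon> / (2 * L)) powr (1 / \<alpha>)"
  have \<eta>: "0 < \<eta>" "\<eta> powr \<alpha> = \<epsilon> / (2 * L)" using \<epsilon> L \<alpha> by (auto simp: \<eta>_def powr_powr)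
  define \<delta> where "\<delta> = \<epsilon> / (2 * L * (\<alpha> * \<eta> powr (\<alpha> - 1)))"
  have \<delta>: "0 < \<delta>" using \<epsilon> L \<alpha> \<eta> by (simp add: \<delta>_def)
  define p where "p x = min x \<eta> powr \<alpha>" for x
  have mono: "p x \<le> p y" if "0 \<le> x" "x \<le> y" for x y
    unfolding p_def using that \<alpha> \<eta> by (intro powr_mono2) auto
  have split: "y powr \<alpha> - x powr \<alpha> \<le> (p y - p x) + \<alpha> * \<eta> powr (\<alpha> - 1) * (y - x)"
    if "0 \<le> x" "x \<le> y" for x y
  proof -
    consider "y \<le> \<eta>" | "\<eta> \<le> x" | "x < \<eta>" "\<eta> < y" by linarith
    then show ?thesis
    proof cases
      case 1
      then show ?thesis using that \<alpha> by (simp add: p_def)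
    next
      case 2
      then show ?thesis using that powr_diff_le[OF \<alpha> \<eta>(1) 2 that(2)] by (simp add: p_def)
    next
      case 3
      have "y powr \<alpha> - \<eta> powr \<alpha> \<le> \<alpha> * \<eta> powr (\<alpha> - 1) * (y - \<eta>)"
        using powr_diff_le[OF \<alpha> \<eta>(1), of \<eta> y] 3 by simp
      also have "\<dots> \<le> \<alpha> * \<eta> powr (\<alpha> - 1) * (y - x)"
        using 3 \<alpha> by (intro mult_left_mono) auto
      finally show ?thesis using 3 by (simp add: p_def)
    qed
  qed
  show "\<exists>\<delta>>0. \<forall>(m::nat) x y. (\<forall>i<m. 0 \<le> x i \<and> x i \<le> y i \<and> y i \<le> T) \<and>
      (\<forall>i<m. \<forall>j<m. i \<noteq> j \<longrightarrow> {x i<..<y i} \<inter> {x j<..<y j} = {}) \<and> (\<Sum>i<m. y i - x i) < \<delta> \<longrightarrow>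
      (\<Sum>i<m. cmod (G (y i) - G (x i))) < \<epsilon>"
  proof (intro exI[of _ \<delta>] conjI \<delta> allI impI; elim conjE)
    fix m :: nat and x y :: "nat \<Rightarrow> real"
    assume r: "\<forall>i<m. 0 \<le> x i \<and> x i \<le> y i \<and> y i \<le> T"
      and d: "\<forall>i<m. \<forall>j<m. i \<noteq> j \<longrightarrow> {x i<..<y i} \<inter> {x j<..<y j} = {}"
      and s: "(\<Sum>i<m. y i - x i) < \<delta>"
    \<comment> \<open>The monotone function \<open>p\<close> maps disjoint intervals to disjoint
      intervals inside [0, \<eta>^\<alpha>], whose lengths cannot add up to more.\<close>
    have "(\<Sum>i<m. p (y i) - p (x i)) \<le> measure lebesgue {0..\<eta> powr \<alpha>}"
    proof (rule disjoint_sum_le)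
      show "p (x i) \<le> p (y i)" if "i < m" for i using r that by (intro mono) auto
      show "{p (x i)<..<p (y i)} \<subseteq> {0..\<eta> powr \<alpha>}" if "i < m" for i
      proof -
        have "p (y i) \<le> \<eta> powr \<alpha>" "0 \<le> p (x i)"
          unfolding p_def using r that \<alpha> \<eta>(1) by (auto intro!: powr_mono2 intro: order_trans)
        then show ?thesis by auto
      qed
      show "{p (x i)<..<p (y i)} \<inter> {p (x j)<..<p (y j)} = {}" if ij: "i < m" "j < m" "i \<noteq> j" for i j
      proof -
        have "{x i<..<y i} \<inter> {x j<..<y j} = {}" using d ij by blast
        \<comment> \<open>Degenerate intervals are empty and may lie anywhere, hence the last two
          alternatives.\<close>
        then have "y i \<le> x j \<or> y j \<le> x i \<or> x i = y i \<or> x j = y j"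
          using r ij dense[of "max (x i) (x j)" "min (y i) (y j)"]
          by (fastforce simp: not_less disjoint_iff)
        then show ?thesis
        proof (elim disjE)
          assume "y i \<le> x j"
          then have "p (y i) \<le> p (x j)" using r ij by (intro mono) (auto intro: order_trans)
          then show ?thesis by auto
        next
          assume "y j \<le> x i"
          then have "p (y j) \<le> p (x i)" using r ij by (intro mono) (auto intro: order_trans)
          then show ?thesis by auto
        qed auto
      qed
    qed simp
    then have 1: "(\<Sum>i<m. p (y i) - p (x i)) \<le> \<epsilon> / (2 * L)" using \<eta> \<epsilon> L by (simp split: if_splits)
    have c: "0 < \<alpha> * \<eta> powr (\<alpha> - 1)" using \<alpha> \<eta> by simp
    have "(\<Sum>i<m. cmod (G (y i) - G (x i))) \<le>
        (\<Sum>i<m. L * ((p (y i) - p (x i)) + \<alpha> * \<eta> powr (\<alpha> - 1) * (y i - x i)))"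
    proof (rule sum_mono)
      fix i assume "i \<in> {..<m}"
      then have i: "0 \<le> x i" "x i \<le> y i" "y i \<le> T" using r by auto
      show "cmod (G (y i) - G (x i)) \<le> L * ((p (y i) - p (x i)) + \<alpha> * \<eta> powr (\<alpha> - 1) * (y i - x i))"
        using lip[OF i] mult_left_mono[OF split[OF i(1,2)], of L] L by linarith
    qed
    also have "\<dots> = L * ((\<Sum>i<m. p (y i) - p (x i)) + \<alpha> * \<eta> powr (\<alpha> - 1) * (\<Sum>i<m. y i - x i))"
      by (simp only: sum.distrib sum_distrib_left[symmetric])
    also have "\<dots> < L * (\<epsilon> / (2 * L) + \<alpha> * \<eta> powr (\<alpha> - 1) * \<delta>)"
      using 1 s c L by (intro mult_strict_left_mono add_le_less_mono) auto
    also have "\<dots> = \<epsilon>" using L c \<alpha> \<eta>(1) by (simp add: \<delta>_def field_simps)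
    finally show "(\<Sum>i<m. cmod (G (y i) - G (x i))) < \<epsilon>" .
  qed
qed

text \<open>E_\<alpha> is Lipschitz on the disc of radius |b| T^\<alpha>, so the increments are
  controlled by those of s^\<alpha>.\<close>

lemma absolutely_continuous_on_mittag_leffler:
  assumes \<alpha>: "0 < \<alpha>" "\<alpha> < 1" and T: "0 \<le> T"
  shows "absolutely_continuous_on 0 T (\<lambda>s. a * mittag_leffler \<alpha> (b * of_real (s powr \<alpha>)))"
proof -
  define R where "R = cmod b * T powr \<alpha>"
  have "continuous_on (cball 0 R) (deriv (mittag_leffler \<alpha>))"
    using holomorphic_deriv[OF holomorphic_mittag_leffler[OF \<alpha>] open_UNIV]
    by (meson holomorphic_on_imp_continuous_on continuous_on_subset subset_UNIV)
  then have "bounded (deriv (mittag_leffler \<alpha>) ` cball 0 R)"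
    by (intro compact_imp_bounded compact_continuous_image) auto
  then obtain B where B: "0 < B" "\<And>z. z \<in> cball 0 R \<Longrightarrow> cmod (deriv (mittag_leffler \<alpha>) z) \<le> B"
    unfolding bounded_pos by auto
  \<comment> \<open>The added 1 keeps L positive when a or b is 0.\<close>
  define L where "L = cmod a * (B * cmod b) + 1"
  have L: "0 < L" using B(1) by (simp add: L_def add_nonneg_pos)
  show ?thesis
  proof (rule absolutely_continuous_on_powr_comp[OF \<alpha> T L])
    fix x y :: real assume xy: "0 \<le> x" "x \<le> y" "y \<le> T"
    have le: "x powr \<alpha> \<le> y powr \<alpha>" "y powr \<alpha> \<le> T powr \<alpha>" using xy \<alpha> by (auto intro!: powr_mono2)
    have "cmod (mittag_leffler \<alpha> (b * of_real (y powr \<alpha>)) - mittag_leffler \<alpha> (b * of_real (x powr \<alpha>)))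
        \<le> B * cmod (b * of_real (y powr \<alpha>) - b * of_real (x powr \<alpha>))"
    proof (rule field_differentiable_bound[of "cball 0 R"])
      show "(mittag_leffler \<alpha> has_field_derivative deriv (mittag_leffler \<alpha>) z) (at z within cball 0 R)" for z
        using DERIV_imp_deriv mittag_leffler_has_field_derivative(1)[OF \<alpha>, of z]
        by (metis has_field_derivative_at_within)
      show "b * of_real (y powr \<alpha>) \<in> cball 0 R" "b * of_real (x powr \<alpha>) \<in> cball 0 R"
        using le by (auto simp: R_def norm_mult intro!: mult_left_mono)
    qed (use B in auto)
    also have "cmod (b * of_real (y powr \<alpha>) - b * of_real (x powr \<alpha>)) = cmod b * (y powr \<alpha> - x powr \<alpha>)"
      using le by (simp add: right_diff_distrib[symmetric] of_real_diff[symmetric] norm_mult del: of_real_diff)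
    finally have "cmod a * cmod (mittag_leffler \<alpha> (b * of_real (y powr \<alpha>)) - mittag_leffler \<alpha> (b * of_real (x powr \<alpha>)))
        \<le> cmod a * (B * (cmod b * (y powr \<alpha> - x powr \<alpha>)))"
      by (intro mult_left_mono) auto
    also have "\<dots> \<le> L * (y powr \<alpha> - x powr \<alpha>)" using le by (simp add: L_def algebra_simps)
    finally show "cmod (a * mittag_leffler \<alpha> (b * of_real (y powr \<alpha>)) - a * mittag_leffler \<alpha> (b * of_real (x powr \<alpha>)))
       \<le> L * (y powr \<alpha> - x powr \<alpha>)"
      by (simp add: right_diff_distrib[symmetric] norm_mult)
  qed
qed

text \<open>The tags outside the exceptional null set are controlled by differentiability; the intervals
  whose tags lie in it fit into an open set of small measure, on which absolute continuity bounds
  the increments.\<close>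

lemma absolutely_continuous_has_integral:
  assumes ac: "absolutely_continuous_on 0 T g" and t: "0 \<le> t" "t \<le> T"
    and ae: "AE s in lebesgue. 0 < s \<and> s < t \<longrightarrow> (g has_vector_derivative h s) (at s)"
  shows "(h has_integral (g t - g 0)) {0..t}"
proof -
  \<comment> \<open>The endpoints are put into the exceptional set, since the derivative is given
    only inside the interval.\<close>
  define N where "N = {s \<in> {0..t}. \<not> (0 < s \<and> s < t \<and> (g has_vector_derivative h s) (at s))}"
  have negN: "negligible N"
  proof -
    from ae obtain N' where N': "N' \<in> null_sets lebesgue"
        "{s \<in> space lebesgue. \<not> (0 < s \<and> s < t \<longrightarrow> (g has_vector_derivative h s) (at s))} \<subseteq> N'"
      unfolding eventually_ae_filter by blast
    have "N \<subseteq> N' \<union> {0, t}"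
    proof
      fix s assume s: "s \<in> N"
      show "s \<in> N' \<union> {0, t}"
      proof (cases "s = 0 \<or> s = t")
        case False
        with s have "\<not> (0 < s \<and> s < t \<longrightarrow> (g has_vector_derivative h s) (at s))"
          unfolding N_def by auto
        then show ?thesis using N'(2) by simp blast
      qed auto
    qed
    moreover have "negligible (N' \<union> {0, t})"
      using N'(1) by (auto simp: negligible_iff_null_sets[symmetric])
    ultimately show ?thesis using negligible_subset by blast
  qed
  \<comment> \<open>With the derivative set to 0 on the null set, tags in \<open>N\<close> leave
    nothing but increments of g to estimate.\<close>
  define h' where "h' s = (if s \<in> N then 0 else h s)" for s
  have "(h' has_integral (g t - g 0)) (cbox 0 t)"
    unfolding has_integral
  proof (intro allI impI)
    fix e :: real assume e: "0 < e"
    \<comment> \<open>t + 1 rather than t, because t = 0 is allowed.\<close>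
    define e' where "e' = e / (2 * (t + 1))"
    have e': "0 < e'" "e' * t < e / 2" using e t by (auto simp: e'_def field_simps)
    have "0 < e / 2" using e by simp
    let ?B = "\<lambda>\<delta> (m::nat) x y. (\<forall>i<m. 0 \<le> x i \<and> x i \<le> y i \<and> y i \<le> T) \<and>
        (\<forall>i<m. \<forall>j<m. i \<noteq> j \<longrightarrow> {x i<..<y i} \<inter> {x j<..<y j} = {}) \<and> (\<Sum>i<m. y i - x i) < \<delta> \<longrightarrow>
        (\<Sum>i<m. cmod (g (y i) - g (x i))) < e / 2"
    from \<open>0 < e / 2\<close> ac have "\<exists>\<delta>>0. \<forall>m x y. ?B \<delta> m x y"
      unfolding absolutely_continuous_on_def by (elim allE impE)
    then obtain \<delta> where \<delta>: "0 < \<delta>" "\<forall>m x y. ?B \<delta> m x y"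
      by (elim exE conjE)
    have N: "N \<in> lmeasurable" "measure lebesgue N = 0"
      using negN by (simp_all add: negligible_imp_measurable negligible_imp_measure0)
    obtain U where U: "open U" "N \<subseteq> U" "U - N \<in> lmeasurable" "emeasure lebesgue (U - N) < ennreal \<delta>"
      by (rule sets_lebesgue_outer_open[of N \<delta>]) (use N \<delta>(1) in \<open>auto dest: fmeasurableD\<close>)
    have Ueq: "U = N \<union> (U - N)" using U(2) by auto
    have Um: "U \<in> lmeasurable" by (subst Ueq, rule fmeasurable.Un) (use N U in auto)
    have "measure lebesgue U \<le> measure lebesgue N + measure lebesgue (U - N)"
      by (subst Ueq, rule measure_Un_le) (use N U in \<open>auto dest: fmeasurableD\<close>)
    moreover have "measure lebesgue (U - N) < \<delta>"
      using U(4) \<delta>(1) emeasure_eq_measure2[OF U(3)] by (simp add: ennreal_less_iff)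
    ultimately have U\<delta>: "measure lebesgue U < \<delta>" using N by simp
    have "\<exists>d>0. \<forall>y. \<bar>y - x\<bar> < d \<longrightarrow> norm (g y - g x - (y - x) *\<^sub>R h x) \<le> e' * \<bar>y - x\<bar>"
      if "x \<in> {0..t} - N" for x
    proof -
      have "(g has_vector_derivative h x) (at x)" using that by (auto simp: N_def)
      then have "\<forall>e>0. \<exists>d>0. \<forall>y. norm (y - x) < d \<longrightarrow>
          norm (g y - g x - (y - x) *\<^sub>R h x) \<le> e * norm (y - x)"
        unfolding has_vector_derivative_def has_derivative_at_alt by (rule conjunct2)
      then show ?thesis using e'(1) by (simp only: real_norm_def)
    qed
    then have "\<forall>x\<in>{0..t} - N. \<exists>d. 0 < d \<and> (\<forall>y. \<bar>y - x\<bar> < d \<longrightarrow> norm (g y - g x - (y - x) *\<^sub>R h x) \<le> e' * \<bar>y - x\<bar>)"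
      by (intro ballI)
    from bchoice[OF this] obtain d where d0: "\<forall>x\<in>{0..t} - N. 0 < d x \<and>
        (\<forall>y. \<bar>y - x\<bar> < d x \<longrightarrow> norm (g y - g x - (y - x) *\<^sub>R h x) \<le> e' * \<bar>y - x\<bar>)" ..
    have d: "0 < d x" "\<bar>y - x\<bar> < d x \<Longrightarrow> norm (g y - g x - (y - x) *\<^sub>R h x) \<le> e' * \<bar>y - x\<bar>"
      if "x \<in> {0..t} - N" for x y
      using bspec[OF d0 that] by simp_all
    define \<gamma> where "\<gamma> x = (if x \<in> N then U else if x \<in> {0..t} then ball x (d x) else UNIV)" for x
    have "gauge \<gamma>" using U d(1) by (auto simp: gauge_def \<gamma>_def)
    moreover have "norm ((\<Sum>(x, k)\<in>\<D>. measure lborel k *\<^sub>R h' x) - (g t - g 0)) < e"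
      if D: "\<D> tagged_division_of cbox 0 t" and fine: "\<gamma> fine \<D>" for \<D>
    proof -
      have fin: "finite \<D>" using D by blast
      have K: "x \<in> K \<and> K = {Inf K..Sup K} \<and> 0 \<le> Inf K \<and> Inf K \<le> x \<and> x \<le> Sup K \<and> Sup K \<le> t \<and> measure lborel K = Sup K - Inf K \<and> K \<subseteq> \<gamma> x"
        if xK: "(x, K) \<in> \<D>" for x K
      proof -
        obtain u v where uv: "K = cbox u v" using tagged_division_ofD(4)[OF D xK] by auto
        have x: "x \<in> K" "K \<subseteq> cbox 0 t" using tagged_division_ofD(2,3)[OF D xK] by auto
        then have "u \<le> v" using uv by auto
        then show ?thesis using uv x fine xK by (auto simp: fine_def)
      qed
      define F where "F = (\<lambda>(x :: real, K). g (Sup K) - g (Inf K))"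
      define D1 where "D1 = {p \<in> \<D>. fst p \<in> N}"
      define D2 where "D2 = {p \<in> \<D>. fst p \<notin> N}"
      have D12: "\<D> = D1 \<union> D2" "D1 \<inter> D2 = {}" "finite D1" "finite D2"
        using fin by (auto simp: D1_def D2_def)
      let ?d = "\<lambda>p. measure lborel (snd p) *\<^sub>R h' (fst p) - F p"
      have "g t - g 0 = sum F \<D>"
        using additive_tagged_division_1[of 0 t \<D> g] D t by (simp add: F_def)
      then have "(\<Sum>(x, k)\<in>\<D>. measure lborel k *\<^sub>R h' x) - (g t - g 0) = (\<Sum>p\<in>\<D>. ?d p)"
        by (simp add: sum_subtractf case_prod_beta)
      also have "\<dots> = (\<Sum>p\<in>D1. ?d p) + (\<Sum>p\<in>D2. ?d p)"
        unfolding D12(1) using D12 by (intro sum.union_disjoint)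
      also have "(\<Sum>p\<in>D1. ?d p) = - sum F D1"
        by (auto simp: D1_def h'_def sum_negf[symmetric] intro!: sum.cong)
      finally have eq: "(\<Sum>(x, k)\<in>\<D>. measure lborel k *\<^sub>R h' x) - (g t - g 0) =
         - sum F D1 + (\<Sum>p\<in>D2. ?d p)" .
      have "norm (\<Sum>p\<in>D2. ?d p) \<le> (\<Sum>p\<in>D2. e' * measure lborel (snd p))"
      proof (rule sum_norm_le)
        fix p assume p: "p \<in> D2"
        obtain x K where xK: "p = (x, K)" by fastforce
        have x: "x \<in> {0..t} - N" and KK: "(x, K) \<in> \<D>"
          using p xK K[of x K] by (auto simp: D2_def)
        note k = K[OF KK]
        have kb: "K \<subseteq> ball x (d x)" using k x by (auto simp: \<gamma>_def)
        have "Sup K \<in> K" "Inf K \<in> K" using k by (metis atLeastAtMost_iff order_refl order_trans)+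
        then have "\<bar>Sup K - x\<bar> < d x" "\<bar>Inf K - x\<bar> < d x"
          using kb by (auto simp: dist_real_def abs_minus_commute)
        from d(2)[OF x this(1)] d(2)[OF x this(2)]
        have 1: "norm (g (Sup K) - g x - (Sup K - x) *\<^sub>R h x) \<le> e' * (Sup K - x)"
          and 2: "norm (g (Inf K) - g x - (Inf K - x) *\<^sub>R h x) \<le> e' * (x - Inf K)"
          using k by (auto simp: abs_of_nonneg abs_of_nonpos)
        have kc: "measure lborel K = Sup K - Inf K" using k by simp
        \<comment> \<open>The straddle argument: the increment is split at the tag and each half is
          compared with the linear approximation there, so the errors add up to e' times the
          length.\<close>
        have "measure lborel K *\<^sub>R h x - (g (Sup K) - g (Inf K)) =
          (g (Inf K) - g x - (Inf K - x) *\<^sub>R h x) - (g (Sup K) - g x - (Sup K - x) *\<^sub>R h x)"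
          unfolding kc by (simp add: algebra_simps)
        also have "norm \<dots> \<le> e' * (x - Inf K) + e' * (Sup K - x)"
          using norm_triangle_ineq4 1 2 by (smt (verit))
        also have "\<dots> = e' * measure lborel K" unfolding kc by (simp add: algebra_simps)
        finally show "norm (?d p) \<le> e' * measure lborel (snd p)"
          using x by (simp add: xK F_def h'_def)
      qed
      also have "\<dots> \<le> (\<Sum>p\<in>\<D>. e' * measure lborel (snd p))"
        using e' fin by (intro sum_mono2) (auto simp: D2_def)
      also have "\<dots> = e' * t"
        using additive_content_tagged_division[OF D] t by (simp add: sum_distrib_left[symmetric] case_prod_beta)
      finally have b2: "norm (\<Sum>p\<in>D2. ?d p) < e / 2"
        using e' by simp
      \<comment> \<open>Absolute continuity speaks of finite families indexed by naturals, so the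
        pieces tagged in \<open>N\<close> are enumerated.\<close>
      obtain f where f: "bij_betw f {0..<card D1} D1"
        using ex_bij_betw_nat_finite[OF D12(3)] by blast
      define m where "m = card D1"
      have f: "bij_betw f {..<m} D1" using f by (simp add: m_def lessThan_atLeast0)
      define x where "x i = Inf (snd (f i))" for i
      define y where "y i = Sup (snd (f i))" for i
      have fi: "(fst (f i), snd (f i)) \<in> \<D> \<and> fst (f i) \<in> N" if "i < m" for i
        using bij_betwE[OF f] that by (auto simp: D1_def)
      have disj: "{x i<..<y i} \<inter> {x j<..<y j} = {}" if "i < m" "j < m" "i \<noteq> j" for i j
      proof -
        have "f i \<noteq> f j" using f that by (auto simp: bij_betw_def inj_on_def)
        then have "interior (snd (f i)) \<inter> interior (snd (f j)) = {}"
          using tagged_division_ofD(5)[OF D fi[OF that(1), THEN conjunct1] fi[OF that(2), THEN conjunct1]]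
          by (simp add: prod_eq_iff)
        moreover have "interior (snd (f i)) = {x i<..<y i}" if "i < m" for i
        proof -
          have "snd (f i) = {x i..y i}" using K fi[OF that] unfolding x_def y_def by blast
          then show ?thesis by (simp add: interior_atLeastAtMost_real)
        qed
        ultimately show ?thesis using that by simp
      qed
      have k: "0 \<le> x i \<and> x i \<le> y i \<and> y i \<le> T \<and> {x i<..<y i} \<subseteq> U" if "i < m" for i
      proof -
        have "fst (f i) \<in> N" "(fst (f i), snd (f i)) \<in> \<D>" using fi[OF that] by auto
        with K[OF this(2)] have "snd (f i) = {x i..y i}" "0 \<le> x i" "x i \<le> y i" "y i \<le> t" "snd (f i) \<subseteq> U"
          by (auto simp: x_def y_def \<gamma>_def)
        moreover from this(1,5) have "{x i<..<y i} \<subseteq> U" by auto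
        ultimately show ?thesis using t by auto
      qed
      have "(\<Sum>i<m. y i - x i) \<le> measure lebesgue U"
        by (rule disjoint_sum_le) (use disj k Um in auto)
      then have "(\<Sum>i<m. y i - x i) < \<delta>" using U\<delta> by simp
      then have "(\<Sum>i<m. cmod (g (y i) - g (x i))) < e / 2"
        using disj k by (intro mp[OF spec[OF spec[OF spec[OF \<delta>(2), of m], of x], of y]]) simp
      moreover have "sum F D1 = (\<Sum>i<m. g (y i) - g (x i))"
        using sum.reindex_bij_betw[OF f, of F] by (simp add: F_def x_def y_def case_prod_beta)
      ultimately have b1: "norm (sum F D1) < e / 2"
        using norm_sum[of "\<lambda>i. g (y i) - g (x i)" "{..<m}"] by simp
      show ?thesis
        unfolding eq using norm_triangle_ineq[of "- sum F D1" "\<Sum>p\<in>D2. ?d p"] b1 b2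
        by simp
    qed
    ultimately show "\<exists>\<gamma>. gauge \<gamma> \<and> (\<forall>\<D>. \<D> tagged_division_of cbox 0 t \<and> \<gamma> fine \<D> \<longrightarrow>
        norm ((\<Sum>(x, k)\<in>\<D>. measure lborel k *\<^sub>R h' x) - (g t - g 0)) < e)"
      by (intro exI[of _ \<gamma>] conjI allI impI) auto
  qed
  then have "(h' has_integral (g t - g 0)) {0..t}" by simp
  then show ?thesis
    by (rule has_integral_spike[OF negN, rotated]) (auto simp: h'_def)
qed

section \<open>Uniqueness for the scalar Caputo equation\<close>

text \<open>The Beta integral with a + b = 1, for which the power of the length t - r has exponent
  0. This independence of r is what makes Abel inversion work.\<close>

lemma has_bochner_integral_abel_kernel:
  fixes r t :: real
  assumes \<alpha>: "0 < \<alpha>" "\<alpha> < 1" and rt: "r < t"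
  shows "has_bochner_integral lborel
    (\<lambda>s. indicator {r..t} s * ((t - s) powr (\<alpha> - 1) * (s - r) powr (- \<alpha>))) (Gamma \<alpha> * Gamma (1 - \<alpha>))"
proof -
  let ?f = "\<lambda>s. indicator {0..t - r} s * ((t - r - s) powr (\<alpha> - 1) * s powr (1 - \<alpha> - 1))"
  have "has_bochner_integral lborel ?f (Gamma \<alpha> * Gamma (1 - \<alpha>) / Gamma (\<alpha> + (1 - \<alpha>)) * (t - r) powr (\<alpha> + (1 - \<alpha>) - 1))"
    using \<alpha> rt by (intro has_bochner_integral_Beta) auto
  then have "has_bochner_integral lborel ?f (Gamma \<alpha> * Gamma (1 - \<alpha>))" using rt by simp
  then have "has_bochner_integral lborel (\<lambda>s. ?f (- r + 1 * s)) (Gamma \<alpha> * Gamma (1 - \<alpha>) /\<^sub>R \<bar>1\<bar>)"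
    by (subst lborel_has_bochner_integral_real_affine_iff[symmetric]) auto
  moreover have "(\<lambda>s. ?f (- r + 1 * s)) =
      (\<lambda>s. indicator {r..t} s * ((t - s) powr (\<alpha> - 1) * (s - r) powr (- \<alpha>)))"
    by (auto simp: indicator_def algebra_simps)
  ultimately show ?thesis by (simp only: abs_one inverse_1 scaleR_one)
qed

text \<open>The Caputo derivative lives on the completed measure, whereas Fubini is applied on a
  product of Borel measures; changing the function on a null set bridges the two.\<close>

lemma integrable_lebesgue_borel_version:
  fixes f :: "real \<Rightarrow> complex"
  assumes "integrable lebesgue f"
  obtains g where "integrable lborel g" "AE x in lebesgue. g x = f x"
proof -
  have m: "(\<lambda>x. Re (f x)) \<in> borel_measurable lebesgue" "(\<lambda>x. Im (f x)) \<in> borel_measurable lebesgue"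
    using borel_measurable_integrable[OF assms] by measurable
  obtain u where u: "u \<in> borel_measurable lborel" "AE x in lborel. Re (f x) = u x"
    using completion_ex_borel_measurable_real[OF m(1)] by blast
  obtain v where v: "v \<in> borel_measurable lborel" "AE x in lborel. Im (f x) = v x"
    using completion_ex_borel_measurable_real[OF m(2)] by blast
  define g where "g x = complex_of_real (u x) + \<i> * complex_of_real (v x)" for x
  have gm: "g \<in> borel_measurable lborel"
    unfolding g_def using u(1) v(1) by measurable
  have ae: "AE x in lebesgue. g x = f x"
    using AE_completion[OF u(2)] AE_completion[OF v(2)]
    by eventually_elim (simp add: g_def complex_eq_iff)
  have "integrable lebesgue g"
    using assms ae measurable_completion[OF gm] borel_measurable_integrable[OF assms]
    by (subst integrable_cong_AE[of g _ f]) auto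
  then have "integrable lborel g"
    using integrable_completion[OF gm] by blast
  with ae show ?thesis using that by blast
qed

text \<open>Multiplying the weighted function by (t-s)^\<alpha>, which is at most t^\<alpha>,
  removes the weight.\<close>

lemma integrable_caputo_weight:
  fixes h :: "real \<Rightarrow> complex"
  assumes \<alpha>: "0 < \<alpha>" and t: "0 < t"
    and int: "set_integrable lebesgue {0..t} (\<lambda>s. (t - s) powr (- \<alpha>) *\<^sub>R h s)"
  shows "integrable lebesgue (\<lambda>s. indicator {0<..<t} s *\<^sub>R h s)"
proof -
  let ?k = "\<lambda>s. indicator {0..t} s *\<^sub>R ((t - s) powr (- \<alpha>) *\<^sub>R h s)"
  have k: "integrable lebesgue ?k" using int by (simp add: set_integrable_def)
  \<comment> \<open>The open interval matters: at s = t both powers are 0 and do not cancel.\<close>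
  have eq: "indicator {0<..<t} s *\<^sub>R h s = (indicator {0<..<t} s * (t - s) powr \<alpha>) *\<^sub>R ?k s" for s
    by (auto simp: indicator_def powr_minus field_simps)
  show ?thesis
  proof (rule Bochner_Integration.integrable_bound[OF integrable_scaleR_right[OF k, of "t powr \<alpha>"]])
    have "(\<lambda>s. indicat_real {0<..<t} s * (t - s) powr \<alpha>) \<in> borel_measurable lborel"
      by measurable
    then have "(\<lambda>s. indicat_real {0<..<t} s * (t - s) powr \<alpha>) \<in> borel_measurable lebesgue"
      by (rule measurable_completion)
    then show "(\<lambda>s. indicat_real {0<..<t} s *\<^sub>R h s) \<in> borel_measurable lebesgue"
      unfolding eq by (rule borel_measurable_scaleR[OF _ borel_measurable_integrable[OF k]])
    have "norm (indicat_real {0<..<t} s *\<^sub>R h s) \<le> norm (t powr \<alpha> *\<^sub>R ?k s)" for s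
    proof -
      have "indicat_real {0<..<t} s * (t - s) powr \<alpha> \<le> t powr \<alpha>"
        using \<alpha> by (auto simp: indicator_def intro!: powr_mono2)
      moreover have "0 \<le> indicat_real {0<..<t} s * (t - s) powr \<alpha>" by simp
      ultimately show ?thesis
        unfolding eq norm_scaleR[of "_ * _"] norm_scaleR[of "t powr \<alpha>"]
        by (intro mult_right_mono) auto
    qed
    then show "AE s in lebesgue. norm (indicat_real {0<..<t} s *\<^sub>R h s) \<le> norm (t powr \<alpha> *\<^sub>R ?k s)"
      by simp
  qed
qed

text \<open>Abel's inversion: integrating the Caputo equation against \<open>(t - s)\<^bsup>\<alpha> - 1\<^esup>\<close> and exchanging the
  integrals gives back \<open>w\<close>, because the inner integral over \<open>s\<close> is a constant.\<close>

lemma caputo_volterra_bound: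
  fixes w :: "real \<Rightarrow> complex"
  assumes \<alpha>: "0 < \<alpha>" "\<alpha> < 1" and t0: "0 < t0" "t0 \<le> T" and t: "0 < t" "t \<le> t0"
    and ac: "absolutely_continuous_on 0 T w" and w0: "w 0 = 0"
    and cap0: "has_caputo_derivative w \<alpha> c t0"
    and cap: "AE s in lebesgue. 0 < s \<and> s < t0 \<longrightarrow> has_caputo_derivative w \<alpha> (b * w s) s"
    and \<beta>: "\<And>s. 0 < s \<Longrightarrow> s \<le> t \<Longrightarrow> cmod (w s) \<le> \<beta> s"
    and B: "has_bochner_integral lborel (\<lambda>s. indicator {0..t} s * ((t - s) powr (\<alpha> - 1) * \<beta> s)) B"
  shows "cmod (w t) \<le> cmod b / Gamma \<alpha> * B"
proof -
  define C where "C = Gamma \<alpha> * Gamma (1 - \<alpha>)"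
  have C: "0 < Gamma \<alpha>" "0 < Gamma (1 - \<alpha>)" "0 < C" using \<alpha> by (auto simp: C_def)
  obtain h where h: "AE s in lebesgue. 0 < s \<and> s < t0 \<longrightarrow> (w has_vector_derivative h s) (at s)"
    "set_integrable lebesgue {0..t0} (\<lambda>s. (t0 - s) powr (- \<alpha>) *\<^sub>R h s)"
    using cap0 by (auto simp: has_caputo_derivative_def)
  \<comment> \<open>One Borel representative of the derivative on (0, t0) serves all times s < t0 at
    once.\<close>
  obtain H where H: "integrable lborel H" and Hh: "AE s in lebesgue. H s = indicator {0<..<t0} s *\<^sub>R h s"
    using integrable_lebesgue_borel_version[OF integrable_caputo_weight[OF \<alpha>(1) t0(1) h(2)]] .
  let ?J = "\<lambda>s r. indicator {0..s} r *\<^sub>R ((s - r) powr (- \<alpha>) *\<^sub>R H r)"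
  have Hm [measurable]: "H \<in> borel_measurable borel" using borel_measurable_integrable[OF H] by simp
  have dH: "AE s in lebesgue. 0 < s \<and> s < t0 \<longrightarrow> (w has_vector_derivative H s) (at s)"
    using h(1) Hh by eventually_elim auto
  have wH: "w s = (LINT r|lborel. indicator {0..s} r *\<^sub>R H r)" if s: "0 \<le> s" "s \<le> t0" for s
  proof -
    have "AE r in lebesgue. 0 < r \<and> r < s \<longrightarrow> (w has_vector_derivative H r) (at r)"
      using dH by eventually_elim (use s in auto)
    then have "(H has_integral (w s - w 0)) {0..s}"
      using s t0 by (intro absolutely_continuous_has_integral[OF ac]) auto
    moreover have "set_integrable lborel {0..s} H"
      unfolding set_integrable_def by (intro integrable_mult_indicator H) auto
    ultimately show ?thesis
      using set_borel_integral_eq_integral(2)[of "{0..s}" H] w0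
      by (simp add: set_lebesgue_integral_def integral_unique)
  qed
  have capH: "AE s in lborel. 0 < s \<and> s < t0 \<longrightarrow>
     (LINT r|lborel. ?J s r) = Gamma (1 - \<alpha>) *\<^sub>R (b * w s)"
  proof -
    have "AE s in lebesgue. 0 < s \<and> s < t0 \<longrightarrow>
     (LINT r|lborel. ?J s r) = Gamma (1 - \<alpha>) *\<^sub>R (b * w s)"
      using cap
    proof eventually_elim
      case (elim s)
      show ?case
      proof
        assume s: "0 < s \<and> s < t0"
        \<comment> \<open>The Caputo derivative at s brings its own derivative k; by uniqueness of
          derivatives it agrees with \<open>H\<close> almost everywhere on (0, s).\<close>
        with elim obtain k where k: "AE r in lebesgue. 0 < r \<and> r < s \<longrightarrow> (w has_vector_derivative k r) (at r)"
          "set_integrable lebesgue {0..s} (\<lambda>r. (s - r) powr (- \<alpha>) *\<^sub>R k r)"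
          "b * w s = (1 / Gamma (1 - \<alpha>)) *\<^sub>R (LINT r:{0..s}|lebesgue. (s - r) powr (- \<alpha>) *\<^sub>R k r)"
          by (auto simp: has_caputo_derivative_def)
        have m: "(\<lambda>r. ?J s r) \<in> borel_measurable lborel"
          by measurable
        have "AE r in lborel. r \<noteq> 0 \<and> r \<noteq> s"
          using AE_lborel_singleton[of 0] AE_lborel_singleton[of s] by eventually_elim auto
        then have "AE r in lebesgue. r \<noteq> 0 \<and> r \<noteq> s" by (rule AE_completion)
        with dH k(1) have "AE r in lebesgue. indicator {0..s} r *\<^sub>R ((s - r) powr (- \<alpha>) *\<^sub>R k r)
            = ?J s r"
        proof eventually_elim
          case (elim r)
          show ?case
          proof (cases "0 < r \<and> r < s")
            case True
            with elim s have "k r = H r" by (intro vector_derivative_unique_at[of w _ r]) auto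
            then show ?thesis by simp
          next
            case False
            with elim have "r \<notin> {0..s}" by auto
            then show ?thesis by simp
          qed
        qed
        then have "(LINT r|lebesgue. indicator {0..s} r *\<^sub>R ((s - r) powr (- \<alpha>) *\<^sub>R k r))
            = (LINT r|lebesgue. ?J s r)"
          using k(2) by (intro integral_cong_AE measurable_completion[OF m])
            (auto simp: set_integrable_def dest: borel_measurable_integrable)
        also have "\<dots> = (LINT r|lborel. ?J s r)"
          by (rule integral_completion[OF m])
        finally show "(LINT r|lborel. ?J s r) = Gamma (1 - \<alpha>) *\<^sub>R (b * w s)"
          using k(3) C by (simp add: set_lebesgue_integral_def)
      qed
    qed
    then show ?thesis by (simp add: AE_completion_iff)
  qed
  \<comment> \<open>The integrand on the triangle r \<le> s \<le> t. Over s it integrates to Abel's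
    constant times H(r); over r it gives the Caputo integral at s, weighted by
    (t-s)^(\<alpha>-1).\<close>
  define f where "f r s = (if 0 \<le> r \<and> r < t then
      (indicator {r..t} s * ((t - s) powr (\<alpha> - 1) * (s - r) powr (- \<alpha>))) *\<^sub>R H r else 0)" for r s
  have fint: "has_bochner_integral lborel (f r) (indicator {0..<t} r *\<^sub>R (C *\<^sub>R H r))" for r
  proof (cases "0 \<le> r \<and> r < t")
    case True
    then have "f r = (\<lambda>s. (indicator {r..t} s * ((t - s) powr (\<alpha> - 1) * (s - r) powr (- \<alpha>))) *\<^sub>R H r)"
      by (simp add: f_def fun_eq_iff)
    moreover have "has_bochner_integral lborel \<dots> (C *\<^sub>R H r)"
      unfolding C_def using conjunct2[OF True] \<alpha>
      by (intro has_bochner_integral_scaleR_left has_bochner_integral_abel_kernel)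
    ultimately show ?thesis using True by simp
  next
    case False
    then have "f r = (\<lambda>s. 0)" by (auto simp: f_def fun_eq_iff)
    then show ?thesis using False by (simp add: has_bochner_integral_zero)
  qed
  have fnorm: "(LINT s|lborel. norm (f r s)) = indicator {0..<t} r * (C * norm (H r))" for r
  proof (cases "0 \<le> r \<and> r < t")
    case True
    then have "norm (f r s) = (indicator {r..t} s * ((t - s) powr (\<alpha> - 1) * (s - r) powr (- \<alpha>))) * norm (H r)" for s
      by (simp add: f_def indicator_def)
    moreover have "has_bochner_integral lborel (\<lambda>s. (indicator {r..t} s * ((t - s) powr (\<alpha> - 1) * (s - r) powr (- \<alpha>))) * norm (H r)) (C * norm (H r))"
      unfolding C_def using conjunct2[OF True] \<alpha>
      by (intro has_bochner_integral_mult_left has_bochner_integral_abel_kernel)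
    ultimately show ?thesis using True by (simp add: has_bochner_integral_iff)
  next
    case False
    then have "f r s = 0" for s by (auto simp: f_def)
    then show ?thesis using False by simp
  qed
  have fpair: "integrable (lborel \<Otimes>\<^sub>M lborel) (case_prod f)"
  proof (rule lborel_pair.Fubini_integrable)
    have "(\<lambda>p. indicator {fst p..t} (snd p) :: real) \<in> borel_measurable (lborel \<Otimes>\<^sub>M lborel)"
    proof -
      have "(\<lambda>p. if fst p \<le> snd p \<and> snd p \<le> t then 1 else 0 :: real) \<in> borel_measurable (lborel \<Otimes>\<^sub>M lborel)"
        by measurable
      moreover have "(\<lambda>p. if fst p \<le> snd p \<and> snd p \<le> t then 1 else 0 :: real) = (\<lambda>p. indicator {fst p..t} (snd p))"
        by (auto simp: fun_eq_iff)
      ultimately show ?thesis by simp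
    qed
    note [measurable] = this
    show "case_prod f \<in> borel_measurable (lborel \<Otimes>\<^sub>M lborel)"
      unfolding f_def case_prod_beta by measurable
    have "integrable lborel (\<lambda>r. indicator {0..<t} r *\<^sub>R (C * norm (H r)))"
      using H by (intro integrable_mult_indicator integrable_mult_right integrable_norm) auto
    then show "integrable lborel (\<lambda>r. LINT s|lborel. norm (case_prod f (r, s)))"
      by (simp add: fnorm)
    show "AE r in lborel. integrable lborel (\<lambda>s. case_prod f (r, s))"
      using fint by (simp add: has_bochner_integral_iff)
  qed
  have swap: "(LINT s|lborel. LINT r|lborel. f r s) = (LINT r|lborel. LINT s|lborel. f r s)"
    by (rule lborel_pair.Fubini_integral[OF fpair])
  have rhs: "(LINT r|lborel. LINT s|lborel. f r s) = C *\<^sub>R w t"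
  proof -
    have "(LINT r|lborel. LINT s|lborel. f r s) = (LINT r|lborel. indicator {0..<t} r *\<^sub>R (C *\<^sub>R H r))"
      using fint by (simp add: has_bochner_integral_iff)
    also have "\<dots> = (LINT r|lborel. C *\<^sub>R (indicator {0..t} r *\<^sub>R H r))"
      by (rule integral_cong_AE) (use AE_lborel_singleton[of t] in \<open>auto elim!: eventually_mono simp: indicator_def\<close>)
    also have "\<dots> = C *\<^sub>R (LINT r|lborel. indicator {0..t} r *\<^sub>R H r)"
      by (rule integral_scaleR_right)
    also have "\<dots> = C *\<^sub>R w t" using wH[of t] t by simp
    finally show ?thesis .
  qed
  \<comment> \<open>Only the majorant \<beta> of |w| enters, so that the estimate can be fed back
    into itself.\<close>
  have inner: "AE s in lborel. norm (LINT r|lborel. f r s)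
      \<le> Gamma (1 - \<alpha>) * cmod b * (indicator {0..t} s * ((t - s) powr (\<alpha> - 1) * \<beta> s))"
    using capH AE_lborel_singleton[of 0] AE_lborel_singleton[of t]
  proof eventually_elim
    case (elim s)
    show ?case
    proof (cases "0 < s \<and> s < t")
      case True
      have "f r s = (t - s) powr (\<alpha> - 1) *\<^sub>R (?J s r)" for r
        using True by (auto simp: f_def indicator_def)
      then have "(LINT r|lborel. f r s) = (t - s) powr (\<alpha> - 1) *\<^sub>R
          (LINT r|lborel. ?J s r)"
        by (simp only: integral_scaleR_right)
      moreover have "0 < s \<and> s < t0" using True t by auto
      then have "(LINT r|lborel. ?J s r) = Gamma (1 - \<alpha>) *\<^sub>R (b * w s)"
        by (rule mp[OF elim(1)])
      ultimately have "(LINT r|lborel. f r s) = (t - s) powr (\<alpha> - 1) *\<^sub>R (Gamma (1 - \<alpha>) *\<^sub>R (b * w s))"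
        by (simp only:)
      then have "norm (LINT r|lborel. f r s) = Gamma (1 - \<alpha>) * cmod b * ((t - s) powr (\<alpha> - 1) * cmod (w s))"
        using C by (simp add: norm_mult)
      also have "\<dots> \<le> Gamma (1 - \<alpha>) * cmod b * ((t - s) powr (\<alpha> - 1) * \<beta> s)"
        using C \<beta>[of s] True by (intro mult_left_mono) auto
      finally show ?thesis using True by simp
    next
      case False
      with elim have s: "s < 0 \<or> t < s" by auto
      then have "f r s = 0" for r by (auto simp: f_def)
      then show ?thesis using s by (auto simp: indicator_def)
    qed
  qed
  have "C * cmod (w t) = norm (LINT s|lborel. LINT r|lborel. f r s)"
    using C by (simp add: swap rhs)
  also have "\<dots> \<le> (LINT s|lborel. norm (LINT r|lborel. f r s))" by (rule integral_norm_bound)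
  also have "\<dots> \<le> (LINT s|lborel. Gamma (1 - \<alpha>) * cmod b * (indicator {0..t} s * ((t - s) powr (\<alpha> - 1) * \<beta> s)))"
  proof (rule integral_mono_AE[OF _ _ inner])
    have "integrable lborel (\<lambda>s. LINT r|lborel. f r s)"
      using lborel_pair.integrable_snd[of f] fpair by simp
    then show "integrable lborel (\<lambda>s. norm (LINT r|lborel. f r s))" by (rule integrable_norm)
    show "integrable lborel (\<lambda>s. Gamma (1 - \<alpha>) * cmod b * (indicator {0..t} s * ((t - s) powr (\<alpha> - 1) * \<beta> s)))"
      using B by (intro integrable_mult_right) (simp add: has_bochner_integral_iff)
  qed
  also have "\<dots> = Gamma (1 - \<alpha>) * cmod b * B"
    using B by (simp add: has_bochner_integral_iff)
  finally show ?thesis using C by (simp add: C_def field_simps)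
qed

text \<open>An interval of positive length is not null. This supplies a time at which the Caputo
  derivative exists.\<close>

lemma AE_lebesgue_interval_ex:
  fixes a b :: real
  assumes "AE x in lebesgue. P x" "a < b"
  obtains x where "a < x" "x < b" "P x"
proof (rule ccontr)
  assume "\<not> thesis"
  with that have "\<And>x. a < x \<Longrightarrow> x < b \<Longrightarrow> \<not> P x" by blast
  with assms(1) have "AE x in lebesgue. x \<notin> {a<..<b}" by (auto elim: eventually_mono)
  then have "{a<..<b} \<in> null_sets lebesgue" by (subst AE_iff_null_sets) auto
  then have "emeasure lebesgue {a<..<b} = 0" by blast
  then show False using assms(2) by simp
qed

text \<open>Each use of the Volterra bound raises the power of t by \<alpha> through the Beta
  integral. Starting from |w| \<le> M, the k-th bound is M |b|^k t^(\<alpha>k)/Gamma(\<alpha>k + 1),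
  a multiple of a term of a convergent series, hence tends to 0.\<close>

lemma caputo_unique_zero:
  fixes w :: "real \<Rightarrow> complex"
  assumes \<alpha>: "0 < \<alpha>" "\<alpha> < 1" and T: "0 < T"
    and cont: "continuous_on {0..T} w"
    and ac: "absolutely_continuous_on 0 T w" and w0: "w 0 = 0"
    and cap: "AE t in lebesgue. 0 < t \<and> t < T \<longrightarrow> has_caputo_derivative w \<alpha> (b * w t) t"
  shows "w T = 0"
proof -
  obtain M where M: "\<And>s. s \<in> {0..T} \<Longrightarrow> cmod (w s) \<le> M"
    using compact_imp_bounded[OF compact_continuous_image[OF cont compact_Icc]] unfolding bounded_iff by blast
  have M0: "0 \<le> M" using M[of 0] T norm_ge_zero[of "w 0"] by (simp add: w0)
  have zero: "w t1 = 0" if t1: "0 < t1" "t1 < T" for t1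
  proof -
    \<comment> \<open>A Caputo derivative at some t0 beyond t1 guarantees that the derivative of w
      is integrable on (0, t0).\<close>
    obtain t0 where t0: "t1 < t0" "t0 < T" and c0: "0 < t0 \<and> t0 < T \<longrightarrow> has_caputo_derivative w \<alpha> (b * w t0) t0"
      using AE_lebesgue_interval_ex[OF cap t1(2)] .
    have capt0: "AE s in lebesgue. 0 < s \<and> s < t0 \<longrightarrow> has_caputo_derivative w \<alpha> (b * w s) s"
      using cap by eventually_elim (use t0 in auto)
    have bound: "cmod (w t) \<le> M * (cmod b ^ k * t powr (\<alpha> * real k) / Gamma (\<alpha> * real k + 1))"
      if "0 < t" "t \<le> t0" for t k
      using that
    proof (induction k arbitrary: t)
      case 0
      then show ?case using M[of t] t0 by simp
    next
      case (Suc k)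
      let ?b = "\<alpha> * real k + 1"
      have pb: "0 < ?b" using \<alpha> by (simp add: add_nonneg_pos)
      then have G: "0 < Gamma ?b" "0 < Gamma \<alpha>" using \<alpha> by auto
      let ?\<beta> = "\<lambda>s. M * (cmod b ^ k * s powr (\<alpha> * real k) / Gamma ?b)"
      have "has_bochner_integral lborel
          (\<lambda>s. M * cmod b ^ k / Gamma ?b * (indicator {0..t} s * ((t - s) powr (\<alpha> - 1) * s powr (?b - 1))))
          (M * cmod b ^ k / Gamma ?b * (Gamma \<alpha> * Gamma ?b / Gamma (\<alpha> + ?b) * t powr (\<alpha> + ?b - 1)))"
        using Suc.prems \<alpha> pb by (intro has_bochner_integral_mult_right has_bochner_integral_Beta)
      moreover have "(\<lambda>s. M * cmod b ^ k / Gamma ?b * (indicator {0..t} s * ((t - s) powr (\<alpha> - 1) * s powr (?b - 1))))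
         = (\<lambda>s. indicator {0..t} s * ((t - s) powr (\<alpha> - 1) * ?\<beta> s))"
        by (simp add: fun_eq_iff)
      ultimately have "has_bochner_integral lborel (\<lambda>s. indicator {0..t} s * ((t - s) powr (\<alpha> - 1) * ?\<beta> s))
          (M * cmod b ^ k / Gamma ?b * (Gamma \<alpha> * Gamma ?b / Gamma (\<alpha> + ?b) * t powr (\<alpha> + ?b - 1)))"
        by simp
      from caputo_volterra_bound[OF \<alpha> _ _ Suc.prems ac w0 _ capt0 _ this, of "b * w t0"] Suc
      have "cmod (w t) \<le> cmod b / Gamma \<alpha> *
          (M * cmod b ^ k / Gamma ?b * (Gamma \<alpha> * Gamma ?b / Gamma (\<alpha> + ?b) * t powr (\<alpha> + ?b - 1)))"
        using t0 t1 c0 by simp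
      also have "\<dots> = M * (cmod b ^ Suc k * t powr (\<alpha> * real (Suc k)) / Gamma (\<alpha> * real (Suc k) + 1))"
      proof -
        have ab: "\<alpha> + ?b = \<alpha> * real (Suc k) + 1" by (simp add: algebra_simps)
        have e: "Gamma (\<alpha> + ?b) = Gamma (\<alpha> * real (Suc k) + 1)" "\<alpha> + ?b - 1 = \<alpha> * real (Suc k)"
          unfolding ab by simp_all
        show ?thesis using G unfolding e by (simp del: of_nat_Suc)
      qed
      finally show ?case .
    qed
    have "(\<lambda>k. (cmod b * t1 powr \<alpha>) ^ k / Gamma (\<alpha> * real k + 1)) \<longlonglongrightarrow> 0"
      by (rule summable_LIMSEQ_zero[OF summable_mittag_leffler_real[OF \<alpha>]]) simp
    from tendsto_mult_left[OF this, of M]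
    have "(\<lambda>k. M * ((cmod b * t1 powr \<alpha>) ^ k / Gamma (\<alpha> * real k + 1))) \<longlonglongrightarrow> 0" by simp
    moreover have "(cmod b * t1 powr \<alpha>) ^ k = cmod b ^ k * t1 powr (\<alpha> * real k)" for k
      using t1 by (simp add: power_mult_distrib powr_realpow[symmetric] powr_powr)
    ultimately have "(\<lambda>k. M * (cmod b ^ k * t1 powr (\<alpha> * real k) / Gamma (\<alpha> * real k + 1))) \<longlonglongrightarrow> 0" by simp
    then have "cmod (w t1) \<le> 0"
      by (rule LIMSEQ_le_const) (use bound[of t1] t1 t0 in auto)
    then show ?thesis by simp
  qed
  \<comment> \<open>No time beyond T is available for the choice of t0, so T itself is reached by
    continuity.\<close>
  have "continuous (at T within {0..T}) w" using cont T by (auto simp: continuous_on_eq_continuous_within)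
  then have "(w \<longlongrightarrow> w T) (at T within {0..T})" by (simp add: continuous_within)
  then have "(w \<longlongrightarrow> w T) (at_left T)"
    by (rule filterlim_mono[OF _ order_refl]) (use T in \<open>simp add: at_within_Icc_at_left\<close>)
  moreover have "(w \<longlongrightarrow> 0) (at_left T)"
    by (rule tendsto_eventually, rule eventually_at_leftI[of 0 T]) (use T zero in auto)
  ultimately show ?thesis
    using tendsto_unique[of "at_left T"] by simp
qed

section \<open>Fourier expansions in a complex Hilbert space\<close>

lemma cinner_add_right: "cinner x (y + z) = cinner x y + cinner x z"
  by (metis cinner_add_left cinner_commute complex_cnj_add)

lemma cinner_scaleC_right: "cinner x (c *\<^sub>C y) = cnj c * cinner x y"
  by (metis cinner_commute cinner_scaleC_left complex_cnj_mult)

lemma scaleC_minus_one: "(- 1) *\<^sub>C x = - (x :: 'a::complex_inner)"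
  using scaleR_scaleC[of "- 1" x] by simp

lemma cinner_minus_left: "cinner (- x) y = - cinner x y"
  using cinner_scaleC_left[of "- 1" x y] by (simp add: scaleC_minus_one)

lemma cinner_minus_right: "cinner x (- y) = - cinner x y"
  using cinner_scaleC_right[of x "- 1" y] by (simp add: scaleC_minus_one)

lemma cinner_diff_left: "cinner (x - y) z = cinner x z - cinner y z"
  using cinner_add_left[of x "- y" z] by (simp add: cinner_minus_left)

lemma cinner_diff_right: "cinner x (y - z) = cinner x y - cinner x z"
  using cinner_add_right[of x y "- z"] by (simp add: cinner_minus_right)

lemma cinner_zero_left [simp]: "cinner 0 y = 0"
  using cinner_diff_left[of 0 0 y] by simp

lemma cinner_zero_right [simp]: "cinner x 0 = 0"
  using cinner_diff_right[of x 0 0] by simp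

lemma cinner_sum_left: "cinner (\<Sum>i\<in>I. f i) y = (\<Sum>i\<in>I. cinner (f i) y)"
  by (induction I rule: infinite_finite_induct) (auto simp: cinner_add_left)

text \<open>Nonnegativity of the real part is read off from the norm: \<open>sqrt\<close> of a
  negative real is negative, while norms are not.\<close>

lemma cinner_self: "cinner x x = of_real ((norm x)\<^sup>2)"
proof -
  have "Im (cinner x x) = 0"
    using arg_cong[OF cinner_commute[of x x], of Im] by simp
  moreover have "0 \<le> Re (cinner x x)"
    using norm_eq_sqrt_cinner[of x] norm_ge_zero[of x] by (metis real_sqrt_ge_0_iff)
  then have "Re (cinner x x) = (norm x)\<^sup>2"
    using norm_eq_sqrt_cinner[of x] by simp
  ultimately show ?thesis by (simp add: complex_eq_iff)
qed

lemma norm_scaleC: "norm (c *\<^sub>C x) = cmod c * norm (x :: 'a::complex_inner)"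
proof -
  have "complex_of_real ((norm (c *\<^sub>C x))\<^sup>2) = c * cnj c * cinner x x"
    unfolding cinner_self[symmetric] by (simp add: cinner_scaleC_left cinner_scaleC_right)
  also have "\<dots> = of_real ((cmod c * norm x)\<^sup>2)"
    by (simp only: cinner_self power_mult_distrib of_real_mult complex_norm_square)
  finally have "complex_of_real ((norm (c *\<^sub>C x))\<^sup>2) = of_real ((cmod c * norm x)\<^sup>2)" .
  then have "(norm (c *\<^sub>C x))\<^sup>2 = (cmod c * norm x)\<^sup>2" by (simp only: of_real_eq_iff)
  then show ?thesis by (simp add: power2_eq_iff_nonneg)
qed

lemma Cauchy_Schwarz_cinner: "cmod (cinner x y) \<le> norm x * norm y"
proof (cases "y = 0")
  case False
  then have y: "0 < (norm y)\<^sup>2" by simp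
  define c where "c = cinner x y / of_real ((norm y)\<^sup>2)"
  have "of_real ((norm (x - c *\<^sub>C y))\<^sup>2) = complex_of_real ((norm x)\<^sup>2 - (cmod (cinner x y))\<^sup>2 / (norm y)\<^sup>2)"
  proof -
    have "of_real ((norm (x - c *\<^sub>C y))\<^sup>2) = cinner x x - cnj c * cinner x y - c * cinner y x + c * cnj c * cinner y y"
      unfolding cinner_self[symmetric]
      by (simp add: cinner_diff_left cinner_diff_right cinner_scaleC_left cinner_scaleC_right algebra_simps)
    also have "c * cnj c * cinner y y = c * cinner y x"
      using y by (simp add: c_def cinner_self cinner_commute[of y x] field_simps)
    also have "cnj c * cinner x y = of_real ((cmod (cinner x y))\<^sup>2 / (norm y)\<^sup>2)"
      unfolding c_def by (simp add: complex_norm_square mult.commute del: of_real_power)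
    finally show ?thesis by (simp add: cinner_self)
  qed
  then have "(norm (x - c *\<^sub>C y))\<^sup>2 = (norm x)\<^sup>2 - (cmod (cinner x y))\<^sup>2 / (norm y)\<^sup>2"
    by (simp only: of_real_eq_iff)
  then have "(cmod (cinner x y))\<^sup>2 / (norm y)\<^sup>2 \<le> (norm x)\<^sup>2"
    using zero_le_power2[of "norm (x - c *\<^sub>C y)"] by linarith
  then have "(cmod (cinner x y))\<^sup>2 \<le> (norm x * norm y)\<^sup>2"
    using y by (simp add: power_mult_distrib field_simps)
  then show ?thesis by (rule power2_le_imp_le) simp
qed simp

lemma tendsto_cinner_left:
  assumes "(f \<longlongrightarrow> l) F"
  shows "((\<lambda>x. cinner (f x) y) \<longlongrightarrow> cinner l y) F"
proof (rule LIM_zero_cancel)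
  have lim: "((\<lambda>x. norm (f x - l) * norm y) \<longlongrightarrow> 0) F"
    using tendsto_mult_left_zero[OF tendsto_norm_zero[OF LIM_zero[OF assms]]] by simp
  show "((\<lambda>x. cinner (f x) y - cinner l y) \<longlongrightarrow> 0) F"
  proof (rule Lim_null_comparison[OF _ lim])
    show "\<forall>\<^sub>F x in F. norm (cinner (f x) y - cinner l y) \<le> norm (f x - l) * norm y"
      using Cauchy_Schwarz_cinner[of "f _ - l" y]
      by (intro always_eventually allI) (simp add: cinner_diff_left)
  qed
qed

section \<open>Partial sums, Parseval and Riesz-Fischer\<close>

definition fourier_sum :: "(nat \<Rightarrow> 'a::complex_inner) \<Rightarrow> (nat \<Rightarrow> complex) \<Rightarrow> nat \<Rightarrow> 'a" where
  "fourier_sum \<phi> c N = (\<Sum>n<N. c n *\<^sub>C \<phi> n)"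

context
  fixes \<phi> :: "nat \<Rightarrow> 'a::complex_inner"
  assumes basis: "orthonormal_basis \<phi>"
begin

lemma cinner_basis: "cinner (\<phi> m) (\<phi> n) = (if m = n then 1 else 0)"
  using basis by (simp add: orthonormal_basis_def)

lemma cinner_fourier_sum: "cinner (fourier_sum \<phi> c N) (\<phi> k) = (if k < N then c k else 0)"
  by (simp add: fourier_sum_def cinner_sum_left cinner_scaleC_left cinner_basis if_distrib cong: if_cong)

lemma cinner_fourier_sum_left: "cinner (fourier_sum \<phi> c N) x = (\<Sum>n<N. c n * cnj (cinner x (\<phi> n)))"
  by (simp add: fourier_sum_def cinner_sum_left cinner_scaleC_left cinner_commute[of "\<phi> _" x])

lemma norm_fourier_sum: "(norm (fourier_sum \<phi> c N))\<^sup>2 = (\<Sum>n<N. (cmod (c n))\<^sup>2)"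
proof -
  have "complex_of_real ((norm (fourier_sum \<phi> c N))\<^sup>2) = of_real (\<Sum>n<N. (cmod (c n))\<^sup>2)"
    unfolding cinner_self[symmetric] of_real_sum complex_norm_square cinner_fourier_sum_left[of c N "fourier_sum \<phi> c N"]
    by (intro sum.cong refl) (simp add: cinner_fourier_sum)
  then show ?thesis by (simp only: of_real_eq_iff)
qed

lemma fourier_sum_diff: "fourier_sum \<phi> (\<lambda>n. c n - d n) N = fourier_sum \<phi> c N - fourier_sum \<phi> d N"
  by (simp add: fourier_sum_def complex_vector.scale_left_diff_distrib sum_subtractf)

lemma norm_fourier_remainder:
  "(norm (u - fourier_sum \<phi> (\<lambda>n. cinner u (\<phi> n)) N))\<^sup>2 = (norm u)\<^sup>2 - (\<Sum>n<N. (cmod (cinner u (\<phi> n)))\<^sup>2)"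
proof -
  let ?P = "fourier_sum \<phi> (\<lambda>n. cinner u (\<phi> n)) N"
  define S where "S = (\<Sum>n<N. (cmod (cinner u (\<phi> n)))\<^sup>2)"
  have 1: "cinner ?P u = of_real S"
    unfolding S_def of_real_sum complex_norm_square by (rule cinner_fourier_sum_left)
  then have 2: "cinner u ?P = of_real S" using cinner_commute[of u ?P] by simp
  have 3: "cinner ?P ?P = of_real S" by (simp add: cinner_self norm_fourier_sum S_def)
  have "complex_of_real ((norm (u - ?P))\<^sup>2) = of_real ((norm u)\<^sup>2 - S)"
    unfolding cinner_self[symmetric] cinner_diff_left cinner_diff_right 1 2 3
    by (simp add: cinner_self)
  then show ?thesis unfolding S_def by (simp only: of_real_eq_iff)
qed

text \<open>A finite combination of basis vectors equals its partial sums from some index on.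
  Density extends this to u, because passing to the remainder does not increase the norm.\<close>

lemma fourier_sum_tendsto: "(\<lambda>N. fourier_sum \<phi> (\<lambda>n. cinner u (\<phi> n)) N) \<longlonglongrightarrow> u"
proof (rule LIMSEQ_I)
  fix e :: real assume e: "0 < e"
  let ?P = "\<lambda>v. fourier_sum \<phi> (\<lambda>n. cinner v (\<phi> n))"
  have "u \<in> closure (complex_vector.span (range \<phi>))" using basis by (simp add: orthonormal_basis_def)
  then obtain v where v: "v \<in> complex_vector.span (range \<phi>)" "dist v u < e"
    using e unfolding closure_approachable by blast
  have "\<exists>N. \<forall>M\<ge>N. ?P v M = v"
    using v(1)
  proof (induction rule: complex_vector.span_induct)
    case base
    show ?case
      unfolding complex_vector.subspace_def
    proof (intro conjI ballI allI)
      show "0 \<in> {v. \<exists>N. \<forall>M\<ge>N. ?P v M = v}" by (simp add: fourier_sum_def)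
      fix x y assume "x \<in> {v. \<exists>N. \<forall>M\<ge>N. ?P v M = v}" "y \<in> {v. \<exists>N. \<forall>M\<ge>N. ?P v M = v}"
      then obtain N1 N2 where "\<forall>M\<ge>N1. ?P x M = x" "\<forall>M\<ge>N2. ?P y M = y" by auto
      then have "\<forall>M\<ge>max N1 N2. ?P (x + y) M = x + y"
        by (auto simp: fourier_sum_def cinner_add_left complex_vector.scale_left_distrib sum.distrib)
      then show "x + y \<in> {v. \<exists>N. \<forall>M\<ge>N. ?P v M = v}" by blast
    next
      fix c x assume "x \<in> {v. \<exists>N. \<forall>M\<ge>N. ?P v M = v}"
      then obtain N where N: "\<forall>M\<ge>N. ?P x M = x" by auto
      have "?P (c *\<^sub>C x) M = c *\<^sub>C ?P x M" for M
        by (simp add: fourier_sum_def cinner_scaleC_left complex_vector.scale_sum_right)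
      with N have "\<forall>M\<ge>N. ?P (c *\<^sub>C x) M = c *\<^sub>C x" by simp
      then show "c *\<^sub>C x \<in> {v. \<exists>N. \<forall>M\<ge>N. ?P v M = v}" by blast
    qed
  next
    case (step x)
    then obtain k where k: "x = \<phi> k" by auto
    have "?P x M = x" if "k < M" for M
    proof -
      have "?P x M = (\<Sum>n<M. if n = k then \<phi> n else 0)"
        unfolding fourier_sum_def k by (intro sum.cong) (auto simp: cinner_basis)
      then show ?thesis using that k by simp
    qed
    then show ?case by (intro exI[of _ "Suc k"]) auto
  qed
  then obtain N where N: "\<And>M. M \<ge> N \<Longrightarrow> ?P v M = v" by blast
  show "\<exists>N. \<forall>M\<ge>N. norm (?P u M - u) < e"
  proof (intro exI[of _ N] allI impI)
    fix M assume M: "N \<le> M"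
    have "?P (u - v) M = ?P u M - v"
      using N[OF M] fourier_sum_diff[of "\<lambda>n. cinner u (\<phi> n)" "\<lambda>n. cinner v (\<phi> n)" M]
      by (simp add: cinner_diff_left)
    then have "u - ?P u M = (u - v) - ?P (u - v) M" by simp
    moreover have "(norm ((u - v) - ?P (u - v) M))\<^sup>2 \<le> (norm (u - v))\<^sup>2"
      unfolding norm_fourier_remainder by (simp add: sum_nonneg)
    then have "norm ((u - v) - ?P (u - v) M) \<le> norm (u - v)" by (rule power2_le_imp_le) simp
    ultimately have "norm (u - ?P u M) \<le> norm (u - v)" by (simp only:)
    then show "norm (?P u M - u) < e"
      using v(2) by (simp add: dist_norm norm_minus_commute)
  qed
qed

lemma Parseval: "(\<lambda>n. (cmod (cinner u (\<phi> n)))\<^sup>2) sums (norm u)\<^sup>2"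
proof -
  have "(\<lambda>N. (norm (fourier_sum \<phi> (\<lambda>n. cinner u (\<phi> n)) N))\<^sup>2) \<longlonglongrightarrow> (norm u)\<^sup>2"
    by (intro tendsto_intros fourier_sum_tendsto)
  then show ?thesis by (simp add: sums_def norm_fourier_sum)
qed

lemma Parseval_cinner: "(\<lambda>n. cinner u (\<phi> n) * cnj (cinner v (\<phi> n))) sums cinner u v"
  using tendsto_cinner_left[OF fourier_sum_tendsto[of u], of v]
  by (simp add: sums_def cinner_fourier_sum_left)

end

lemma Riesz_Fischer:
  fixes \<phi> :: "nat \<Rightarrow> 'a::complex_hilbert"
  assumes basis: "orthonormal_basis \<phi>" and c: "summable (\<lambda>n. (cmod (c n))\<^sup>2)"
  obtains v where "\<And>n. cinner v (\<phi> n) = c n"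
proof -
  have "Cauchy (fourier_sum \<phi> c)"
  proof (rule CauchyI)
    fix e :: real assume e: "0 < e"
    then have "0 < e\<^sup>2" by simp
    then obtain N where N: "\<And>m n. m \<ge> N \<Longrightarrow> norm (\<Sum>k=m..<n. (cmod (c k))\<^sup>2) < e\<^sup>2"
      using c unfolding summable_Cauchy by blast
    have step: "norm (fourier_sum \<phi> c n - fourier_sum \<phi> c m) < e" if "N \<le> m" "m \<le> n" for m n
    proof -
      \<comment> \<open>Zeroing the first m coefficients turns the block from m to n into an initial
        segment, whose norm is known.\<close>
      define d where "d k = (if k < m then 0 else c k)" for k
      have "fourier_sum \<phi> c n = fourier_sum \<phi> d n + fourier_sum \<phi> c m"
      proof -
        have "fourier_sum \<phi> c n = fourier_sum \<phi> c m + (\<Sum>k=m..<n. c k *\<^sub>C \<phi> k)"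
          unfolding fourier_sum_def lessThan_atLeast0 using that by (simp add: sum.atLeastLessThan_concat)
        moreover have "fourier_sum \<phi> d n = fourier_sum \<phi> d m + (\<Sum>k=m..<n. d k *\<^sub>C \<phi> k)"
          unfolding fourier_sum_def lessThan_atLeast0 using that by (simp add: sum.atLeastLessThan_concat)
        moreover have "fourier_sum \<phi> d m = 0" by (simp add: fourier_sum_def d_def)
        moreover have "(\<Sum>k=m..<n. d k *\<^sub>C \<phi> k) = (\<Sum>k=m..<n. c k *\<^sub>C \<phi> k)"
          by (intro sum.cong) (auto simp: d_def)
        ultimately show ?thesis by simp
      qed
      then have "(norm (fourier_sum \<phi> c n - fourier_sum \<phi> c m))\<^sup>2 = (\<Sum>k<n. (cmod (d k))\<^sup>2)"
        using norm_fourier_sum[OF basis, of d n] by simp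
      also have "\<dots> = (\<Sum>k<m. (cmod (d k))\<^sup>2) + (\<Sum>k=m..<n. (cmod (d k))\<^sup>2)"
        unfolding lessThan_atLeast0 using that by (simp add: sum.atLeastLessThan_concat)
      also have "(\<Sum>k<m. (cmod (d k))\<^sup>2) = 0" by (simp add: d_def)
      also have "(\<Sum>k=m..<n. (cmod (d k))\<^sup>2) = (\<Sum>k=m..<n. (cmod (c k))\<^sup>2)"
        by (intro sum.cong) (auto simp: d_def)
      finally have "(norm (fourier_sum \<phi> c n - fourier_sum \<phi> c m))\<^sup>2 < e\<^sup>2"
        using N[OF that(1), of n] by simp
      then show ?thesis by (rule power2_less_imp_less) (use e in simp)
    qed
    show "\<exists>M. \<forall>m\<ge>M. \<forall>n\<ge>M. norm (fourier_sum \<phi> c m - fourier_sum \<phi> c n) < e"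
    proof (intro exI[of _ N] allI impI)
      fix m n assume "N \<le> m" "N \<le> n"
      then show "norm (fourier_sum \<phi> c m - fourier_sum \<phi> c n) < e"
        using step[of m n] step[of n m] by (cases "m \<le> n") (auto simp: norm_minus_commute)
    qed
  qed
  then obtain v where v: "fourier_sum \<phi> c \<longlonglongrightarrow> v"
    using Cauchy_convergent convergent_def by blast
  have "cinner v (\<phi> n) = c n" for n
  proof -
    have "(\<lambda>N. cinner (fourier_sum \<phi> c N) (\<phi> n)) \<longlonglongrightarrow> cinner v (\<phi> n)"
      using v by (rule tendsto_cinner_left)
    moreover have "(\<lambda>N. cinner (fourier_sum \<phi> c N) (\<phi> n)) \<longlonglongrightarrow> c n"
      by (rule tendsto_eventually, rule eventually_sequentiallyI[of "Suc n"])
         (simp add: cinner_fourier_sum[OF basis])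
    ultimately show ?thesis by (rule LIMSEQ_unique)
  qed
  with that show ?thesis by blast
qed

text \<open>By Parseval the squared remainder is at most the tail of d, uniformly in t, so u is a
  uniform limit of continuous partial sums.\<close>

lemma continuous_on_fourier:
  fixes \<phi> :: "nat \<Rightarrow> 'a::complex_hilbert" and u :: "real \<Rightarrow> 'a"
  assumes basis: "orthonormal_basis \<phi>" and d: "summable d"
    and cont: "\<And>n. continuous_on S (\<lambda>t. cinner (u t) (\<phi> n))"
    and le: "\<And>n t. t \<in> S \<Longrightarrow> (cmod (cinner (u t) (\<phi> n)))\<^sup>2 \<le> d n"
  shows "continuous_on S u"
proof -
  let ?P = "\<lambda>N t. fourier_sum \<phi> (\<lambda>n. cinner (u t) (\<phi> n)) N"
  have "uniform_limit S ?P u sequentially"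
  proof (rule uniform_limitI)
    fix e :: real assume e: "0 < e"
    then have e2: "0 < e\<^sup>2" by simp
    have "(\<lambda>N. suminf d - sum d {..<N}) \<longlonglongrightarrow> suminf d - suminf d"
      by (intro tendsto_intros summable_LIMSEQ d)
    then have "(\<lambda>N. suminf d - sum d {..<N}) \<longlonglongrightarrow> 0" by simp
    from order_tendstoD(2)[OF this e2]
    have "\<forall>\<^sub>F N in sequentially. suminf d - sum d {..<N} < e\<^sup>2" .
    then show "\<forall>\<^sub>F N in sequentially. \<forall>t\<in>S. dist (?P N t) (u t) < e"
    proof eventually_elim
      case (elim N)
      show ?case
      proof
        fix t assume t: "t \<in> S"
        let ?c = "\<lambda>n. (cmod (cinner (u t) (\<phi> n)))\<^sup>2"
        note P = Parseval[OF basis, of "u t"]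
        have "(norm (u t - ?P N t))\<^sup>2 = suminf ?c - sum ?c {..<N}"
          using sums_unique[OF P] by (simp add: norm_fourier_remainder[OF basis])
        also have "\<dots> = (\<Sum>n. ?c (n + N))"
          using suminf_minus_initial_segment[OF sums_summable[OF P], of N] by simp
        also have "\<dots> \<le> (\<Sum>n. d (n + N))"
          using le[OF t] by (intro suminf_le summable_ignore_initial_segment[OF sums_summable[OF P]]
            summable_ignore_initial_segment[OF d]) auto
        also have "\<dots> = suminf d - sum d {..<N}"
          by (rule suminf_minus_initial_segment[OF d])
        also have "\<dots> < e\<^sup>2" by (rule elim)
        finally have "norm (u t - ?P N t) < e" by (rule power2_less_imp_less) (use e in simp)
        then show "dist (?P N t) (u t) < e" by (simp add: dist_norm norm_minus_commute)
      qed
    qed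
  qed
  moreover have "\<forall>\<^sub>F N in sequentially. continuous_on S (?P N)"
  proof (intro always_eventually allI)
    fix N
    have cc: "continuous_on S (\<lambda>t. c t *\<^sub>C \<phi> n)" if "continuous_on S c" for c :: "real \<Rightarrow> complex" and n
      unfolding continuous_on_def
    proof
      fix x assume "x \<in> S"
      then have "(c \<longlongrightarrow> c x) (at x within S)" using that by (simp add: continuous_on_def)
      then have "((\<lambda>t. norm ((c t - c x) *\<^sub>C \<phi> n)) \<longlongrightarrow> 0) (at x within S)"
        unfolding norm_scaleC by (intro tendsto_mult_left_zero tendsto_norm_zero LIM_zero)
      then have "((\<lambda>t. c t *\<^sub>C \<phi> n - c x *\<^sub>C \<phi> n) \<longlongrightarrow> 0) (at x within S)"
        by (simp add: tendsto_norm_zero_iff complex_vector.scale_left_diff_distrib)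
      then show "((\<lambda>t. c t *\<^sub>C \<phi> n) \<longlongrightarrow> c x *\<^sub>C \<phi> n) (at x within S)" by (rule LIM_zero_cancel)
    qed
    show "continuous_on S (?P N)"
      unfolding fourier_sum_def by (intro continuous_on_sum cc cont)
  qed
  ultimately show ?thesis by (intro uniform_limit_theorem[OF _ _ sequentially_bot])
qed

section \<open>Linearity and the solution formula for the scalar equation\<close>

lemma absolutely_continuous_on_diff:
  assumes "absolutely_continuous_on a b f" "absolutely_continuous_on a b g"
  shows "absolutely_continuous_on a b (\<lambda>t. f t - g t)"
  unfolding absolutely_continuous_on_def
proof (intro allI impI)
  fix \<epsilon> :: real assume "0 < \<epsilon>"
  then have e2: "0 < \<epsilon> / 2" by simp
  let ?A = "\<lambda>(m::nat) x y \<delta>. (\<forall>i<m. a \<le> x i \<and> x i \<le> y i \<and> y i \<le> b) \<and>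
     (\<forall>i<m. \<forall>j<m. i \<noteq> j \<longrightarrow> {x i<..<y i} \<inter> {x j<..<y j} = {}) \<and> (\<Sum>i<m. y i - x i) < \<delta>"
  obtain d1 where d1: "0 < d1" "\<forall>m x y. ?A m x y d1 \<longrightarrow> (\<Sum>i<m. cmod (f (y i) - f (x i))) < \<epsilon> / 2"
    using mp[OF spec[OF assms(1)[unfolded absolutely_continuous_on_def], of "\<epsilon> / 2"] e2] by (elim exE conjE)
  obtain d2 where d2: "0 < d2" "\<forall>m x y. ?A m x y d2 \<longrightarrow> (\<Sum>i<m. cmod (g (y i) - g (x i))) < \<epsilon> / 2"
    using mp[OF spec[OF assms(2)[unfolded absolutely_continuous_on_def], of "\<epsilon> / 2"] e2] by (elim exE conjE)
  have "\<forall>m x y. ?A m x y (min d1 d2) \<longrightarrow> (\<Sum>i<m. cmod (f (y i) - g (y i) - (f (x i) - g (x i)))) < \<epsilon>"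
  proof (intro allI impI)
    fix m :: nat and x y :: "nat \<Rightarrow> real" assume A: "?A m x y (min d1 d2)"
    have "(\<Sum>i<m. cmod (f (y i) - f (x i))) < \<epsilon> / 2"
      using A by (intro mp[OF spec[OF spec[OF spec[OF d1(2), of m], of x], of y]]) simp
    moreover have "(\<Sum>i<m. cmod (g (y i) - g (x i))) < \<epsilon> / 2"
      using A by (intro mp[OF spec[OF spec[OF spec[OF d2(2), of m], of x], of y]]) simp
    moreover have "(\<Sum>i<m. cmod (f (y i) - g (y i) - (f (x i) - g (x i)))) \<le>
        (\<Sum>i<m. cmod (f (y i) - f (x i)) + cmod (g (y i) - g (x i)))"
    proof (rule sum_mono)
      fix i
      have "f (y i) - g (y i) - (f (x i) - g (x i)) = (f (y i) - f (x i)) - (g (y i) - g (x i))" by simp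
      then show "cmod (f (y i) - g (y i) - (f (x i) - g (x i))) \<le> cmod (f (y i) - f (x i)) + cmod (g (y i) - g (x i))"
        by (simp only: norm_triangle_ineq4)
    qed
    ultimately show "(\<Sum>i<m. cmod (f (y i) - g (y i) - (f (x i) - g (x i)))) < \<epsilon>"
      by (simp add: sum.distrib)
  qed
  then show "\<exists>\<delta>>0. \<forall>m x y. ?A m x y \<delta> \<longrightarrow> (\<Sum>i<m. cmod (f (y i) - g (y i) - (f (x i) - g (x i)))) < \<epsilon>"
    using d1(1) d2(1) by (intro exI[of _ "min d1 d2"]) simp
qed

lemma has_caputo_derivative_diff:
  assumes "has_caputo_derivative f \<alpha> c t" "has_caputo_derivative g \<alpha> d t"
  shows "has_caputo_derivative (\<lambda>s. f s - g s) \<alpha> (c - d) t"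
proof -
  obtain h where h: "AE s in lebesgue. 0 < s \<and> s < t \<longrightarrow> (f has_vector_derivative h s) (at s)"
     "set_integrable lebesgue {0..t} (\<lambda>s. (t - s) powr (- \<alpha>) *\<^sub>R h s)"
     "c = (1 / Gamma (1 - \<alpha>)) *\<^sub>R (LINT s:{0..t}|lebesgue. (t - s) powr (- \<alpha>) *\<^sub>R h s)"
    using assms(1) by (auto simp: has_caputo_derivative_def)
  obtain k where k: "AE s in lebesgue. 0 < s \<and> s < t \<longrightarrow> (g has_vector_derivative k s) (at s)"
     "set_integrable lebesgue {0..t} (\<lambda>s. (t - s) powr (- \<alpha>) *\<^sub>R k s)"
     "d = (1 / Gamma (1 - \<alpha>)) *\<^sub>R (LINT s:{0..t}|lebesgue. (t - s) powr (- \<alpha>) *\<^sub>R k s)"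
    using assms(2) by (auto simp: has_caputo_derivative_def)
  show ?thesis
    unfolding has_caputo_derivative_def
  proof (intro exI[of _ "\<lambda>s. h s - k s"] conjI)
    show "AE s in lebesgue. 0 < s \<and> s < t \<longrightarrow> ((\<lambda>s. f s - g s) has_vector_derivative h s - k s) (at s)"
      using h(1) k(1) by eventually_elim (auto intro: has_vector_derivative_diff)
    show "set_integrable lebesgue {0..t} (\<lambda>s. (t - s) powr (- \<alpha>) *\<^sub>R (h s - k s))"
      unfolding scaleR_diff_right using h(2) k(2) by (rule set_integral_diff(1))
    show "c - d = (1 / Gamma (1 - \<alpha>)) *\<^sub>R (LINT s:{0..t}|lebesgue. (t - s) powr (- \<alpha>) *\<^sub>R (h s - k s))"
      unfolding scaleR_diff_right set_integral_diff(2)[OF h(2) k(2)] using h(3) k(3)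
      by (simp add: scaleR_diff_right)
  qed
qed

lemma has_caputo_derivative_cmult:
  assumes "has_caputo_derivative f \<alpha> c t"
  shows "has_caputo_derivative (\<lambda>s. a * f s) \<alpha> (a * c) t"
proof -
  obtain h where h: "AE s in lebesgue. 0 < s \<and> s < t \<longrightarrow> (f has_vector_derivative h s) (at s)"
     "set_integrable lebesgue {0..t} (\<lambda>s. (t - s) powr (- \<alpha>) *\<^sub>R h s)"
     "c = (1 / Gamma (1 - \<alpha>)) *\<^sub>R (LINT s:{0..t}|lebesgue. (t - s) powr (- \<alpha>) *\<^sub>R h s)"
    using assms(1) by (auto simp: has_caputo_derivative_def)
  have e: "(t - s) powr (- \<alpha>) *\<^sub>R (a * h s) = a * ((t - s) powr (- \<alpha>) *\<^sub>R h s)" for s by simp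
  have i: "(LINT s:{0..t}|lebesgue. a * ((t - s) powr (- \<alpha>) *\<^sub>R h s))
      = a * (LINT s:{0..t}|lebesgue. (t - s) powr (- \<alpha>) *\<^sub>R h s)"
    by (rule set_integral_mult_right)
  show ?thesis
    unfolding has_caputo_derivative_def
  proof (intro exI[of _ "\<lambda>s. a * h s"] conjI)
    show "AE s in lebesgue. 0 < s \<and> s < t \<longrightarrow> ((\<lambda>s. a * f s) has_vector_derivative a * h s) (at s)"
      using h(1) by eventually_elim (auto intro: has_vector_derivative_mult_right)
    show "set_integrable lebesgue {0..t} (\<lambda>s. (t - s) powr (- \<alpha>) *\<^sub>R (a * h s))"
      unfolding e using h(2) by (intro set_integrable_mult_right)
    show "a * c = (1 / Gamma (1 - \<alpha>)) *\<^sub>R (LINT s:{0..t}|lebesgue. (t - s) powr (- \<alpha>) *\<^sub>R (a * h s))"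
      unfolding e i h(3) by simp
  qed
qed

lemma continuous_on_mittag_leffler_powr:
  assumes "0 < \<alpha>" "\<alpha> < 1"
  shows "continuous_on {0..T} (\<lambda>t. mittag_leffler \<alpha> (b * of_real (t powr \<alpha>)))"
proof (rule continuous_on_compose2[OF continuous_mittag_leffler[OF assms, of UNIV]])
  have "continuous_on {0..T} (\<lambda>t. t powr \<alpha>)"
    using assms by (intro continuous_on_powr' continuous_intros) auto
  then show "continuous_on {0..T} (\<lambda>t. b * complex_of_real (t powr \<alpha>))"
    by (intro continuous_on_mult_left continuous_on_of_real)
qed simp

text \<open>Subtracting g(0) times the Mittag-Leffler solution leaves a solution of the same linear
  equation with initial value 0.\<close>

lemma caputo_eigenfunction_unique:
  assumes \<alpha>: "0 < \<alpha>" "\<alpha> < 1" and T: "0 < T"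
    and cont: "continuous_on {0..T} g" and ac: "absolutely_continuous_on 0 T g"
    and cap: "AE t in lebesgue. 0 < t \<and> t < T \<longrightarrow> has_caputo_derivative g \<alpha> (b * g t) t"
  shows "g T = g 0 * mittag_leffler \<alpha> (b * of_real (T powr \<alpha>))"
proof -
  let ?e = "\<lambda>t. g 0 * mittag_leffler \<alpha> (b * of_real (t powr \<alpha>))"
  have "g T - ?e T = 0"
  proof (rule caputo_unique_zero[OF \<alpha> T, where b = b])
    show "continuous_on {0..T} (\<lambda>t. g t - ?e t)"
      by (intro continuous_intros cont continuous_on_mittag_leffler_powr \<alpha>)
    show "absolutely_continuous_on 0 T (\<lambda>t. g t - ?e t)"
      using T by (intro absolutely_continuous_on_diff ac absolutely_continuous_on_mittag_leffler \<alpha>) simp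
    show "g 0 - ?e 0 = 0" by simp
    show "AE t in lebesgue. 0 < t \<and> t < T \<longrightarrow> has_caputo_derivative (\<lambda>t. g t - ?e t) \<alpha> (b * (g t - ?e t)) t"
      using cap
    proof eventually_elim
      case (elim t)
      show ?case
      proof
        assume t: "0 < t \<and> t < T"
        have "has_caputo_derivative (\<lambda>t. g t - ?e t) \<alpha>
            (b * g t - g 0 * (b * mittag_leffler \<alpha> (b * of_real (t powr \<alpha>)))) t"
          using elim t by (intro has_caputo_derivative_diff has_caputo_derivative_cmult
            has_caputo_derivative_mittag_leffler \<alpha>) auto
        then show "has_caputo_derivative (\<lambda>t. g t - ?e t) \<alpha> (b * (g t - ?e t)) t"
          by (simp add: algebra_simps)
      qed
    qed
  qed
  then show ?thesis by simp
qed

section \<open>Weak solutions\<close>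

context
  fixes D :: "'a::complex_hilbert set" and A :: "'a \<Rightarrow> 'a"
    and \<mu> :: "nat \<Rightarrow> real" and \<phi> :: "nat \<Rightarrow> 'a"
  assumes sa: "selfadjoint_operator D A" and eig: "eigenbasis D A \<mu> \<phi>"
begin

lemma eigenbasis_orthonormal: "orthonormal_basis \<phi>"
  and eigenvector_domain: "\<phi> n \<in> D"
  and eigenvalue_eq: "A (\<phi> n) = - (\<mu> n *\<^sub>R \<phi> n)"
  and eigenvalue_ge: "\<mu> 0 \<le> \<mu> n" and eigenvalue_0_pos: "0 < \<mu> 0"
  using eig by (auto simp: eigenbasis_def minus_equation_iff[of "A _"] dest: monoD)

lemma eigenvalue_pos: "0 < \<mu> n"
  using eigenvalue_ge[of n] eigenvalue_0_pos by linarith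

lemma cinner_eigenvector: "cinner u (A (\<phi> n)) = - (of_real (\<mu> n) * cinner u (\<phi> n))"
  by (simp add: eigenvalue_eq cinner_minus_right scaleR_scaleC cinner_scaleC_right)

lemma cinner_A_eigenvector:
  assumes "u \<in> D"
  shows "cinner (A u) (\<phi> n) = - (of_real (\<mu> n) * cinner u (\<phi> n))"
proof -
  have "\<forall>u\<in>D. cinner (A u) (\<phi> n) = cinner u (A (\<phi> n))"
    using sa eigenvector_domain[of n] unfolding selfadjoint_operator_def by blast
  then show ?thesis using assms by (simp add: cinner_eigenvector)
qed

section \<open>The scale of spaces and the domain of the operator\<close>

lemma H_sp_add:
  assumes "v \<in> H_sp \<mu> \<phi> s" "w \<in> H_sp \<mu> \<phi> s"
  shows "v + w \<in> H_sp \<mu> \<phi> s"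
proof -
  let ?q = "\<lambda>v n. \<mu> n powr (2 * s) * (cmod (cinner v (\<phi> n)))\<^sup>2"
  have "summable (\<lambda>n. 2 * (?q v n) + 2 * (?q w n))"
    using assms unfolding H_sp_def by (intro summable_add summable_mult) auto
  then have "summable (\<lambda>n. ?q (v + w) n)"
  proof (rule summable_comparison_test_ev[rotated])
    have "?q (v + w) n
        \<le> 2 * (?q v n) + 2 * (?q w n)" for n
    proof -
      define a where "a = cmod (cinner v (\<phi> n))"
      define b where "b = cmod (cinner w (\<phi> n))"
      have "(cmod (cinner (v + w) (\<phi> n)))\<^sup>2 \<le> (a + b)\<^sup>2"
        unfolding a_def b_def cinner_add_left by (intro power_mono norm_triangle_ineq) simp
      also have "\<dots> \<le> 2 * a\<^sup>2 + 2 * b\<^sup>2"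
        using zero_le_power2[of "a - b"] by (simp add: power2_eq_square algebra_simps)
      finally have "?q (v + w) n \<le> \<mu> n powr (2 * s) * (2 * a\<^sup>2 + 2 * b\<^sup>2)"
        by (rule mult_left_mono) simp
      then show ?thesis by (simp add: a_def b_def algebra_simps)
    qed
    then show "\<forall>\<^sub>F n in sequentially. norm (?q (v + w) n)
        \<le> 2 * (?q v n) + 2 * (?q w n)"
      by simp
  qed
  then show ?thesis by (simp add: H_sp_def)
qed

lemma H_sp_scaleC:
  assumes "v \<in> H_sp \<mu> \<phi> s"
  shows "c *\<^sub>C v \<in> H_sp \<mu> \<phi> s"
proof -
  have "summable (\<lambda>n. (cmod c)\<^sup>2 * (\<mu> n powr (2 * s) * (cmod (cinner v (\<phi> n)))\<^sup>2))"
    using assms unfolding H_sp_def by (intro summable_mult) simp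
  then show ?thesis
    by (simp add: H_sp_def cinner_scaleC_left norm_mult power_mult_distrib mult_ac)
qed

lemma eigenvector_H_sp: "\<phi> k \<in> H_sp \<mu> \<phi> s"
  unfolding H_sp_def mem_Collect_eq
  by (rule summable_finite[of "{k}"]) (auto simp: cinner_basis[OF eigenbasis_orthonormal])

text \<open>Riesz-Fischer produces the vector w with coefficients -\<lambda>_n v_n, and Parseval
  shows that it represents the adjoint at v. Since the graph of the adjoint is the graph of A, v is
  in the domain and A v = w.\<close>

lemma H_sp_1_domain:
  assumes v: "v \<in> H_sp \<mu> \<phi> 1"
  shows "v \<in> D" and "(norm (A v))\<^sup>2 = (\<Sum>n. (\<mu> n)\<^sup>2 * (cmod (cinner v (\<phi> n)))\<^sup>2)"
proof -
  note on = eigenbasis_orthonormal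
  have sq: "\<mu> n powr (2 * 1) = (\<mu> n)\<^sup>2" for n
    using eigenvalue_pos[of n] by simp
  have nrm: "(cmod (- (of_real (\<mu> n) * cinner v (\<phi> n))))\<^sup>2 = (\<mu> n)\<^sup>2 * (cmod (cinner v (\<phi> n)))\<^sup>2" for n
    by (simp add: norm_mult power_mult_distrib)
  have "summable (\<lambda>n. (cmod (- (of_real (\<mu> n) * cinner v (\<phi> n))))\<^sup>2)"
    using v unfolding H_sp_def sq nrm by simp
  from Riesz_Fischer[OF on this]
  obtain w where w: "\<And>n. cinner w (\<phi> n) = - (of_real (\<mu> n) * cinner v (\<phi> n))" by blast
  have "cinner (A u) v = cinner u w" if "u \<in> D" for u
  proof -
    have "(\<lambda>n. cinner (A u) (\<phi> n) * cnj (cinner v (\<phi> n))) sums cinner (A u) v"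
      by (rule Parseval_cinner[OF on])
    moreover have "(\<lambda>n. cinner u (\<phi> n) * cnj (cinner w (\<phi> n))) sums cinner u w"
      by (rule Parseval_cinner[OF on])
    then have "(\<lambda>n. cinner (A u) (\<phi> n) * cnj (cinner v (\<phi> n))) sums cinner u w"
      by (simp add: w cinner_A_eigenvector[OF that] mult_ac)
    ultimately show ?thesis by (rule sums_unique2)
  qed
  then have vw: "v \<in> D \<and> A v = w"
    using sa unfolding selfadjoint_operator_def by blast
  then show "v \<in> D" by simp
  show "(norm (A v))\<^sup>2 = (\<Sum>n. (\<mu> n)\<^sup>2 * (cmod (cinner v (\<phi> n)))\<^sup>2)"
    using sums_unique[OF Parseval[OF on, of "A v"]] unfolding conjunct2[OF vw] w nrm .
qed

lemma powr_eigenvalue_le: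
  assumes "1 \<le> s"
  shows "(\<mu> n)\<^sup>2 \<le> \<mu> 0 powr (2 - 2 * s) * \<mu> n powr (2 * s)"
proof -
  have "\<mu> n powr (2 - 2 * s) \<le> \<mu> 0 powr (2 - 2 * s)"
    using assms eigenvalue_ge[of n] eigenvalue_0_pos by (intro powr_mono2') auto
  then have "\<mu> n powr (2 - 2 * s) * \<mu> n powr (2 * s) \<le> \<mu> 0 powr (2 - 2 * s) * \<mu> n powr (2 * s)"
    by (rule mult_right_mono) simp
  moreover have "\<mu> n powr (2 - 2 * s) * \<mu> n powr (2 * s) = (\<mu> n)\<^sup>2"
    using eigenvalue_pos[of n] by (simp add: powr_add[symmetric])
  ultimately show ?thesis by simp
qed

lemma H_sp_domain:
  assumes s: "1 \<le> s" and v: "v \<in> H_sp \<mu> \<phi> s"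
  shows "v \<in> D" and "norm (A v) \<le> sqrt (\<mu> 0 powr (2 - 2 * s)) * H_norm \<mu> \<phi> s v"
proof -
  let ?q = "\<lambda>n. \<mu> n powr (2 * s) * (cmod (cinner v (\<phi> n)))\<^sup>2"
  let ?K = "\<mu> 0 powr (2 - 2 * s)"
  have sm: "summable (\<lambda>n. ?K * (?q n))"
    using v unfolding H_sp_def by (intro summable_mult) simp
  have le: "(\<mu> n)\<^sup>2 * (cmod (cinner v (\<phi> n)))\<^sup>2 \<le> ?K * (?q n)" for n
    using mult_right_mono[OF powr_eigenvalue_le[OF s, of n], of "(cmod (cinner v (\<phi> n)))\<^sup>2"] by (simp add: mult_ac)
  have sm1: "summable (\<lambda>n. (\<mu> n)\<^sup>2 * (cmod (cinner v (\<phi> n)))\<^sup>2)"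
    by (rule summable_comparison_test_ev[OF _ sm]) (use le in simp)
  have "\<mu> n powr (2 * 1) = (\<mu> n)\<^sup>2" for n
    using eigenvalue_pos[of n] by simp
  with sm1 have v1: "v \<in> H_sp \<mu> \<phi> 1" unfolding H_sp_def by simp
  show "v \<in> D" by (rule H_sp_1_domain(1)[OF v1])
  have "(norm (A v))\<^sup>2 \<le> (\<Sum>n. ?K * (?q n))"
    unfolding H_sp_1_domain(2)[OF v1] by (intro suminf_le le sm sm1)
  also have "\<dots> = ?K * (\<Sum>n. ?q n)"
    using v by (intro suminf_mult) (simp add: H_sp_def)
  finally have "norm (A v) \<le> sqrt (?K * (\<Sum>n. ?q n))"
    by (rule real_le_rsqrt)
  then show "norm (A v) \<le> sqrt ?K * H_norm \<mu> \<phi> s v"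
    by (simp add: H_norm_def real_sqrt_mult)
qed

text \<open>For s \<ge> 1 the norm of A v is at most a constant times the s-norm of v, so
  Cauchy-Schwarz bounds the functional for every u in H. The factor c covers both A u and its
  multiple that serves as Caputo derivative.\<close>

lemma A_dual_cmult_H_dual:
  assumes s: "1 \<le> s"
  shows "(\<lambda>v. c * A_dual \<mu> \<phi> s A u v) \<in> H_dual \<mu> \<phi> s"
  unfolding H_dual_def
proof (intro CollectI conjI ballI allI impI)
  have lin: "A (v + w) = A v + A w" "A (k *\<^sub>C v) = k *\<^sub>C A v" if "v \<in> D" "w \<in> D" for v w k
    using sa that unfolding selfadjoint_operator_def linear_operator_on_def by auto
  fix v assume v: "v \<in> H_sp \<mu> \<phi> s"
  note vD = H_sp_domain(1)[OF s v]
  show "c * A_dual \<mu> \<phi> s A u (v + w) = c * A_dual \<mu> \<phi> s A u v + c * A_dual \<mu> \<phi> s A u w"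
    if w: "w \<in> H_sp \<mu> \<phi> s" for w
    using v w H_sp_add[OF v w] lin(1)[OF vD H_sp_domain(1)[OF s w]]
    by (simp add: A_dual_def cinner_add_right algebra_simps)
  show "c * A_dual \<mu> \<phi> s A u (k *\<^sub>C v) = cnj k * (c * A_dual \<mu> \<phi> s A u v)" for k
    using v H_sp_scaleC[OF v] lin(2)[OF vD vD]
    by (simp add: A_dual_def cinner_scaleC_right)
next
  show "\<exists>C. \<forall>v\<in>H_sp \<mu> \<phi> s. cmod (c * A_dual \<mu> \<phi> s A u v) \<le> C * H_norm \<mu> \<phi> s v"
  proof (intro exI ballI)
    fix v assume v: "v \<in> H_sp \<mu> \<phi> s"
    have "cmod (c * A_dual \<mu> \<phi> s A u v) \<le> cmod c * (norm u * norm (A v))"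
      using v Cauchy_Schwarz_cinner[of u "A v"] by (simp add: A_dual_def norm_mult mult_left_mono)
    also have "\<dots> \<le> cmod c * (norm u * (sqrt (\<mu> 0 powr (2 - 2 * s)) * H_norm \<mu> \<phi> s v))"
      by (intro mult_left_mono H_sp_domain(2)[OF s v]) auto
    finally show "cmod (c * A_dual \<mu> \<phi> s A u v) \<le> cmod c * norm u * sqrt (\<mu> 0 powr (2 - 2 * s)) * H_norm \<mu> \<phi> s v"
      by (simp add: mult_ac)
  qed
next
  show "c * A_dual \<mu> \<phi> s A u v = 0" if "v \<notin> H_sp \<mu> \<phi> s" for v
    using that by (simp add: A_dual_def)
qed

section \<open>Coefficients, stability and existence of weak solutions\<close>

lemma ray_dir_mult:
  "ray_dir \<alpha> * exp (\<i> * of_real (pi * \<alpha> / 2)) = 1"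
  by (simp add: ray_dir_def exp_add[symmetric])

text \<open>Testing the equation with the eigenvector, an element of every space of the scale, gives
  the scalar Caputo equation with factor i^(-\<alpha>) \<lambda>_n.\<close>

lemma weak_solution_coefficient:
  assumes \<alpha>: "0 < \<alpha>" "\<alpha> < 1" and T: "0 < T" and u: "weak_solution A \<mu> \<phi> \<alpha> T u\<^sub>0 u"
  shows "cinner (u T) (\<phi> n) = cinner (u 0) (\<phi> n) *
    mittag_leffler \<alpha> (ray_dir \<alpha> * of_real (\<mu> n * T powr \<alpha>))"
proof -
  let ?b = "ray_dir \<alpha> * of_real (\<mu> n)"
  have "cinner (u T) (\<phi> n) = cinner (u 0) (\<phi> n) * mittag_leffler \<alpha> (?b * of_real (T powr \<alpha>))"
  proof (rule caputo_eigenfunction_unique[OF \<alpha> T])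
    have "continuous_on {0..T} u" using u by (simp add: weak_solution_def)
    then show "continuous_on {0..T} (\<lambda>t. cinner (u t) (\<phi> n))"
      unfolding continuous_on_def by (auto intro: tendsto_cinner_left)
    show "absolutely_continuous_on 0 T (\<lambda>t. cinner (u t) (\<phi> n))" using u by (simp add: weak_solution_def)
    from u[unfolded weak_solution_def, THEN conjunct2, THEN conjunct2, THEN conjunct1]
    show "AE t in lebesgue. 0 < t \<and> t < T \<longrightarrow>
        has_caputo_derivative (\<lambda>t. cinner (u t) (\<phi> n)) \<alpha> (?b * cinner (u t) (\<phi> n)) t"
    proof eventually_elim
      case (elim t)
      show ?case
      proof
        assume "0 < t \<and> t < T"
        with elim obtain f where f: "has_caputo_derivative_dual \<mu> \<phi> (1 / \<alpha>) u \<alpha> f t"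
          and eq: "\<forall>v\<in>H_sp \<mu> \<phi> (1 / \<alpha>).
                exp (\<i> * of_real (pi * \<alpha> / 2)) * f v + A_dual \<mu> \<phi> (1 / \<alpha>) A (u t) v = 0" by blast
        have "exp (\<i> * of_real (pi * \<alpha> / 2)) * f (\<phi> n) + cinner (u t) (A (\<phi> n)) = 0"
          using bspec[OF eq eigenvector_H_sp[of n]] eigenvector_H_sp[of n] by (simp add: A_dual_def)
        then have "exp (\<i> * of_real (pi * \<alpha> / 2)) * f (\<phi> n) = of_real (\<mu> n) * cinner (u t) (\<phi> n)"
          by (simp add: cinner_eigenvector)
        then have "ray_dir \<alpha> * (exp (\<i> * of_real (pi * \<alpha> / 2)) * f (\<phi> n)) = ?b * cinner (u t) (\<phi> n)"
          by (simp add: mult.assoc)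
        then have "f (\<phi> n) = ?b * cinner (u t) (\<phi> n)"
          unfolding mult.assoc[symmetric] ray_dir_mult by simp
        then show "has_caputo_derivative (\<lambda>t. cinner (u t) (\<phi> n)) \<alpha> (?b * cinner (u t) (\<phi> n)) t"
          using f unfolding has_caputo_derivative_dual_def by metis
      qed
    qed
  qed
  then show ?thesis by (simp add: mult.assoc)
qed

text \<open>All eigenvalues are at least the smallest one; this is the source of the stability
  constant.\<close>

lemma norm_le_H_norm_1:
  assumes "v \<in> H_sp \<mu> \<phi> 1"
  shows "norm v \<le> 1 / \<mu> 0 * H_norm \<mu> \<phi> 1 v"
proof -
  note on = eigenbasis_orthonormal
  have sm: "summable (\<lambda>n. \<mu> n powr (2 * 1) * (cmod (cinner v (\<phi> n)))\<^sup>2)"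
    using assms by (simp add: H_sp_def)
  have le: "(\<mu> 0)\<^sup>2 * (cmod (cinner v (\<phi> n)))\<^sup>2 \<le> \<mu> n powr (2 * 1) * (cmod (cinner v (\<phi> n)))\<^sup>2" for n
    using eigenvalue_pos[of n] eigenvalue_ge[of n] eigenvalue_0_pos
    by (intro mult_right_mono) (auto intro: power_mono)
  have "(\<mu> 0 * norm v)\<^sup>2 = (\<Sum>n. (\<mu> 0)\<^sup>2 * (cmod (cinner v (\<phi> n)))\<^sup>2)"
    using sums_unique[OF sums_mult[OF Parseval[OF on, of v], of "(\<mu> 0)\<^sup>2"]] by (simp add: power_mult_distrib)
  also have "\<dots> \<le> (\<Sum>n. \<mu> n powr (2 * 1) * (cmod (cinner v (\<phi> n)))\<^sup>2)"
    by (intro suminf_le le sm sums_summable[OF sums_mult[OF Parseval[OF on]]])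
  finally have "\<mu> 0 * norm v \<le> H_norm \<mu> \<phi> 1 v"
    unfolding H_norm_def by (rule real_le_rsqrt)
  then show ?thesis using eigenvalue_0_pos by (simp add: field_simps)
qed

lemma weak_solution_norm_le:
  assumes \<alpha>: "0 < \<alpha>" "\<alpha> < 1" and T: "0 < T" and u: "weak_solution A \<mu> \<phi> \<alpha> T u\<^sub>0 u"
  shows "norm (u 0) \<le> norm (u T)"
proof -
  note on = eigenbasis_orthonormal
  have "(cmod (cinner (u 0) (\<phi> n)))\<^sup>2 \<le> (cmod (cinner (u T) (\<phi> n)))\<^sup>2" for n
  proof (rule power_mono)
    have "1 \<le> norm (mittag_leffler \<alpha> (ray_dir \<alpha> * of_real (\<mu> n * T powr \<alpha>)))"
      using eigenvalue_pos[of n] by (intro mittag_leffler_ray_bounds(1) \<alpha>) simp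
    from mult_left_mono[OF this, of "cmod (cinner (u 0) (\<phi> n))"]
    show "cmod (cinner (u 0) (\<phi> n)) \<le> cmod (cinner (u T) (\<phi> n))"
      unfolding weak_solution_coefficient[OF assms, of n] norm_mult by simp
  qed simp
  then have "(norm (u 0))\<^sup>2 \<le> (norm (u T))\<^sup>2"
    by (rule sums_le[OF _ Parseval[OF on] Parseval[OF on]])
  then show ?thesis by (rule power2_le_imp_le) simp
qed

text \<open>The initial coefficients are those of the target divided by the multipliers at T. The
  lower bound keeps them square summable, and the upper bound gives a majorant independent of time,
  hence continuity in H.\<close>

lemma weak_solution_exists:
  assumes \<alpha>: "0 < \<alpha>" "\<alpha> < 1" and T: "0 < T"
  shows "\<exists>u\<^sub>0 u. weak_solution A \<mu> \<phi> \<alpha> T u\<^sub>0 u \<and> u T = u\<^sub>T"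
proof -
  note on = eigenbasis_orthonormal
  define b where "b n = ray_dir \<alpha> * of_real (\<mu> n)" for n
  define E where "E n t = mittag_leffler \<alpha> (b n * of_real (t powr \<alpha>))" for n t
  define a where "a n = cinner u\<^sub>T (\<phi> n) / E n T" for n
  have E: "1 \<le> cmod (E n t)" "cmod (E n t) \<le> 2 / \<alpha> - 1" for n t
    using mittag_leffler_ray_bounds[OF \<alpha>, of "\<mu> n * t powr \<alpha>"] eigenvalue_pos[of n]
    by (simp_all add: E_def b_def mult.assoc)
  have E0: "E n t \<noteq> 0" for n t using E(1)[of n t] by auto
  define d where "d n = (2 / \<alpha> - 1)\<^sup>2 * (cmod (cinner u\<^sub>T (\<phi> n)))\<^sup>2" for n
  have d: "summable d"
    unfolding d_def by (intro summable_mult sums_summable[OF Parseval[OF on]])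
  have le: "(cmod (a n * E n t))\<^sup>2 \<le> d n" for n t
  proof -
    have "cmod (a n) \<le> cmod (cinner u\<^sub>T (\<phi> n))"
      unfolding a_def norm_divide using divide_left_mono[OF E(1)[of n T], of "cmod (cinner u\<^sub>T (\<phi> n))"] E0[of n T] by simp
    then have "cmod (a n * E n t) \<le> (2 / \<alpha> - 1) * cmod (cinner u\<^sub>T (\<phi> n))"
      using mult_mono[OF _ E(2)[of n t], of "cmod (a n)" "cmod (cinner u\<^sub>T (\<phi> n))"]
      by (simp add: norm_mult mult.commute)
    from power_mono[OF this, of 2] show ?thesis by (simp add: d_def power_mult_distrib)
  qed
  have "\<exists>v. \<forall>n. cinner v (\<phi> n) = a n * E n t" for t
  proof -
    have "summable (\<lambda>n. (cmod (a n * E n t))\<^sup>2)"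
      by (rule summable_comparison_test_ev[OF _ d]) (use le in simp)
    from Riesz_Fischer[OF on this] show ?thesis by metis
  qed
  then obtain u where u: "\<And>t n. cinner (u t) (\<phi> n) = a n * E n t" by metis
  have cont: "continuous_on {0..T} u"
  proof (rule continuous_on_fourier[OF on d])
    show "continuous_on {0..T} (\<lambda>t. cinner (u t) (\<phi> n))" for n
      unfolding u E_def by (intro continuous_on_mult_left continuous_on_mittag_leffler_powr \<alpha>)
    show "(cmod (cinner (u t) (\<phi> n)))\<^sup>2 \<le> d n" for n t unfolding u by (rule le)
  qed
  have s: "1 \<le> 1 / \<alpha>" using \<alpha> by simp
  let ?E = "\<lambda>t. \<exists>f. has_caputo_derivative_dual \<mu> \<phi> (1 / \<alpha>) u \<alpha> f t \<and>
             A_dual \<mu> \<phi> (1 / \<alpha>) A (u t) \<in> H_dual \<mu> \<phi> (1 / \<alpha>) \<and>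
             (\<forall>v\<in>H_sp \<mu> \<phi> (1 / \<alpha>).
                exp (\<i> * of_real (pi * \<alpha> / 2)) * f v + A_dual \<mu> \<phi> (1 / \<alpha>) A (u t) v = 0)"
  have "weak_solution A \<mu> \<phi> \<alpha> T (u 0) u"
    unfolding weak_solution_def
  proof (intro conjI allI cont)
    show "absolutely_continuous_on 0 T (\<lambda>t. cinner (u t) (\<phi> n))" for n
      unfolding u E_def using T by (intro absolutely_continuous_on_mittag_leffler \<alpha>) simp
    have "(u \<longlongrightarrow> u 0) (at 0 within {0..T})" using cont T by (simp add: continuous_on_def)
    then have "(u \<longlongrightarrow> u 0) (at_right 0)" using T by (simp add: at_within_Icc_at_right)
    then show "((\<lambda>t. norm (u t - u 0)) \<longlongrightarrow> 0) (at_right 0)"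
      by (intro tendsto_norm_zero LIM_zero)
    show "AE t in lebesgue. 0 < t \<and> t < T \<longrightarrow>
        ?E t"
    proof (intro AE_I2 impI)
      fix t assume t: "0 < t \<and> t < T"
      \<comment> \<open>The equation forces this functional: i^\<alpha> f = -A u(t).\<close>
      define f where "f v = - ray_dir \<alpha> * A_dual \<mu> \<phi> (1 / \<alpha>) A (u t) v" for v
      have "has_caputo_derivative_dual \<mu> \<phi> (1 / \<alpha>) u \<alpha> f t"
        unfolding has_caputo_derivative_dual_def
      proof (intro conjI allI)
        show "f \<in> H_dual \<mu> \<phi> (1 / \<alpha>)"
          unfolding f_def using A_dual_cmult_H_dual[OF s] .
        fix n
        have "f (\<phi> n) = a n * (b n * E n t)"
          using eigenvector_H_sp[of n] by (simp add: f_def A_dual_def cinner_eigenvector u b_def mult_ac)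
        then show "has_caputo_derivative (\<lambda>t. cinner (u t) (\<phi> n)) \<alpha> (f (\<phi> n)) t"
          unfolding u E_def using t
          by (simp only:) (intro has_caputo_derivative_cmult has_caputo_derivative_mittag_leffler \<alpha>; simp)
      qed
      moreover have "A_dual \<mu> \<phi> (1 / \<alpha>) A (u t) \<in> H_dual \<mu> \<phi> (1 / \<alpha>)"
        using A_dual_cmult_H_dual[OF s, of 1 "u t"] by simp
      moreover have "exp (\<i> * of_real (pi * \<alpha> / 2)) * f v + A_dual \<mu> \<phi> (1 / \<alpha>) A (u t) v = 0" for v
      proof -
        have "exp (\<i> * of_real (pi * \<alpha> / 2)) * f v =
            - (ray_dir \<alpha> * exp (\<i> * of_real (pi * \<alpha> / 2))) * A_dual \<mu> \<phi> (1 / \<alpha>) A (u t) v"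
          by (simp add: f_def mult_ac)
        then show ?thesis unfolding ray_dir_mult by simp
      qed
      ultimately show "?E t"
        by blast
    qed
  qed
  moreover have "u T = u\<^sub>T"
  proof -
    have "cinner (u T - u\<^sub>T) (\<phi> n) = 0" for n
      using E0[of n T] by (simp add: cinner_diff_left u a_def)
    then have "(\<lambda>n. 0) sums (norm (u T - u\<^sub>T))\<^sup>2"
      using Parseval[OF on, of "u T - u\<^sub>T"] by simp
    then have "(norm (u T - u\<^sub>T))\<^sup>2 = 0" using sums_unique2[OF sums_zero] by fastforce
    then show ?thesis by simp
  qed
  ultimately show ?thesis by blast
qed

end

theorem theorem4p8:
  fixes D :: "'a::complex_hilbert set" and A :: "'a \<Rightarrow> 'a"
    and \<mu> :: "nat \<Rightarrow> real" and \<phi> :: "nat \<Rightarrow> 'a" and \<alpha> T :: real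
  assumes "selfadjoint_operator D A" and "negative_definite_operator D A"
    and "compact_resolvent D A" and "eigenbasis D A \<mu> \<phi>"
    and "0 < \<alpha>" and "\<alpha> < 1" and "0 < T"
  shows "(\<forall>u\<^sub>T\<in>H_sp \<mu> \<phi> 1. \<exists>u\<^sub>0 u. weak_solution A \<mu> \<phi> \<alpha> T u\<^sub>0 u \<and> u T = u\<^sub>T) \<and>
    (\<exists>C>0. \<forall>u\<^sub>0 u. weak_solution A \<mu> \<phi> \<alpha> T u\<^sub>0 u \<longrightarrow>
       ennreal (norm (u 0)) \<le> ennreal C * H_enorm \<mu> \<phi> 1 (u T))"
proof (intro conjI ballI)
  show "\<exists>u\<^sub>0 u. weak_solution A \<mu> \<phi> \<alpha> T u\<^sub>0 u \<and> u T = u\<^sub>T" for u\<^sub>T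
    by (rule weak_solution_exists[OF assms(1,4-7)])
  have pos: "0 < \<mu> 0" by (rule eigenvalue_0_pos[OF assms(1,4)])
  have "ennreal (norm (u 0)) \<le> ennreal (1 / \<mu> 0) * H_enorm \<mu> \<phi> 1 (u T)"
    if u: "weak_solution A \<mu> \<phi> \<alpha> T u\<^sub>0 u" for u\<^sub>0 u
  proof (cases "u T \<in> H_sp \<mu> \<phi> 1")
    case True
    have "norm (u 0) \<le> 1 / \<mu> 0 * H_norm \<mu> \<phi> 1 (u T)"
      using weak_solution_norm_le[OF assms(1,4-7) u] norm_le_H_norm_1[OF assms(1,4) True] by simp
    then have "ennreal (norm (u 0)) \<le> ennreal (1 / \<mu> 0 * H_norm \<mu> \<phi> 1 (u T))"
      by (rule ennreal_leI)
    also have "\<dots> = ennreal (1 / \<mu> 0) * ennreal (H_norm \<mu> \<phi> 1 (u T))"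
      using pos by (intro ennreal_mult') simp
    finally show ?thesis using True by (simp add: H_enorm_def)
  next
    case False
    \<comment> \<open>Positivity of the constant matters here, since 0 times infinity is 0 in
      \<open>ennreal\<close>.\<close>
    then show ?thesis using pos by (simp add: H_enorm_def ennreal_mult_top)
  qed
  then show "\<exists>C>0. \<forall>u\<^sub>0 u. weak_solution A \<mu> \<phi> \<alpha> T u\<^sub>0 u \<longrightarrow>
       ennreal (norm (u 0)) \<le> ennreal C * H_enorm \<mu> \<phi> 1 (u T)"
    using pos by (intro exI[of _ "1 / \<mu> 0"]) simp
qed

end
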